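(* There is an algorithm which, for every instance of metric UFTRA with uniform requirements (i.e. $r_j = r$ for all $j\in\mathcal{C}$, for some positive integer $r$), outputs a feasible solution whose total cost is at most $1.5186$ times the minimum total cost of a feasible solution of that instance, and which runs in time $O(n^{3}\max_{j} r_j)$, where $n = |\mathcal{F}|+|\mathcal{C}|$.
   Context: An instance of UFTRA (Unconstrained Fault-Tolerant Resource Allocation) consists of a finite set $\mathcal{F}$ of sites, a finite set $\mathcal{C}$ of clients, an opening cost $f_i\ge 0$ for each $i\in\mathcal{F}$, a connection cost $c_{ij}\ge 0$ for each $i\in\mathcal{F}$, $j\in\mathcal{C}$, and a positive integer requirement $r_j$ for each $j\in\mathcal{C}$. A feasible solution is a choice of nonnegative integers $y_i$ ($i\in\mathcal{F}$; the number of facilities opened at site $i$) and $x_{ij}$ ($i\in\mathcal{F}$, $j\in\mathcal{C}$; the number of connections between $j$ and facilities at $i$) such that $\sum_{i\in\mathcal{F}} x_{ij}\ge r_j$ for all $j$ and $x_{ij}\le y_i$ for all $i,j$. Its total cost is $\sum_{i} f_i y_i + \sum_{i,j} c_{ij}x_{ij}$. The instance is metric if the connection costs satisfy $c_{ij}\le c_{ij'}+c_{i'j'}+c_{i'j}$ for all $i,i'\in\mathcal{F}$, $j,j'\in\mathcal{C}$ (they come from distances in a metric space containing sites and clients). *)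

theory Defs
  imports Main "HOL.Rat" "HOL.Real"
begin

text \<open>Sites F, clients C; y i = number of facilities opened at site i,
  x i j = number of connections between client j and facilities at site i.\<close>

definition uftra_feasible ::
  "'f set \<Rightarrow> 'c set \<Rightarrow> ('c \<Rightarrow> nat) \<Rightarrow> ('f \<Rightarrow> nat) \<Rightarrow> ('f \<Rightarrow> 'c \<Rightarrow> nat) \<Rightarrow> bool" where
  "uftra_feasible F C rq y x \<longleftrightarrow>
     (\<forall>j\<in>C. (\<Sum>i\<in>F. x i j) \<ge> rq j) \<and> (\<forall>i\<in>F. \<forall>j\<in>C. x i j \<le> y i)"

definition uftra_cost ::
  "'f set \<Rightarrow> 'c set \<Rightarrow> ('f \<Rightarrow> real) \<Rightarrow> ('f \<Rightarrow> 'c \<Rightarrow> real) \<Rightarrow> ('f \<Rightarrow> nat) \<Rightarrow> ('f \<Rightarrow> 'c \<Rightarrow> nat) \<Rightarrow> real" where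
  "uftra_cost F C f c y x = (\<Sum>i\<in>F. f i * real (y i)) + (\<Sum>i\<in>F. \<Sum>j\<in>C. c i j * real (x i j))"

definition uftra_metric :: "'f set \<Rightarrow> 'c set \<Rightarrow> ('f \<Rightarrow> 'c \<Rightarrow> real) \<Rightarrow> bool" where
  "uftra_metric F C c \<longleftrightarrow>
     (\<forall>i\<in>F. \<forall>i'\<in>F. \<forall>j\<in>C. \<forall>j'\<in>C. c i j \<le> c i j' + c i' j' + c i' j)"

text \<open>Two memories: an integer (natural number) memory used for indices, counts and
  integer outputs, supporting +, truncated - and comparison; and a real memory
  supporting +, -, *, / and comparison, with rational constants and conversion
  nat-to-real (no conversion real-to-nat, i.e. no floor). Both memories are
  addressed indirectly by natural-number expressions.\<close>

type_synonym state = "(nat \<Rightarrow> nat) \<times> (nat \<Rightarrow> real)"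

datatype nexp = NC nat | NRd nexp | NPlus nexp nexp | NMinus nexp nexp

datatype rexp = RC rat | RRd nexp | ROfNat nexp | RPlus rexp rexp | RMinus rexp rexp
  | RTimes rexp rexp | RDiv rexp rexp

datatype bexp = BNLess nexp nexp | BRLess rexp rexp | BNot bexp | BAnd bexp bexp

datatype com = SKIP | NAssign nexp nexp | RAssign nexp rexp | Seq com com
  | IfC bexp com com | WhileC bexp com

fun nval :: "nexp \<Rightarrow> state \<Rightarrow> nat" where
  "nval (NC n) s = n"
| "nval (NRd a) s = fst s (nval a s)"
| "nval (NPlus a b) s = nval a s + nval b s"
| "nval (NMinus a b) s = nval a s - nval b s"

fun rval :: "rexp \<Rightarrow> state \<Rightarrow> real" where
  "rval (RC q) s = of_rat q"
| "rval (RRd a) s = snd s (nval a s)"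
| "rval (ROfNat a) s = real (nval a s)"
| "rval (RPlus a b) s = rval a s + rval b s"
| "rval (RMinus a b) s = rval a s - rval b s"
| "rval (RTimes a b) s = rval a s * rval b s"
| "rval (RDiv a b) s = rval a s / rval b s"

fun bval :: "bexp \<Rightarrow> state \<Rightarrow> bool" where
  "bval (BNLess a b) s = (nval a s < nval b s)"
| "bval (BRLess a b) s = (rval a s < rval b s)"
| "bval (BNot b) s = (\<not> bval b s)"
| "bval (BAnd a b) s = (bval a s \<and> bval b s)"

fun ncost :: "nexp \<Rightarrow> nat" where
  "ncost (NC n) = 1"
| "ncost (NRd a) = 1 + ncost a"
| "ncost (NPlus a b) = 1 + ncost a + ncost b"
| "ncost (NMinus a b) = 1 + ncost a + ncost b"

fun rcost :: "rexp \<Rightarrow> nat" where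
  "rcost (RC q) = 1"
| "rcost (RRd a) = 1 + ncost a"
| "rcost (ROfNat a) = 1 + ncost a"
| "rcost (RPlus a b) = 1 + rcost a + rcost b"
| "rcost (RMinus a b) = 1 + rcost a + rcost b"
| "rcost (RTimes a b) = 1 + rcost a + rcost b"
| "rcost (RDiv a b) = 1 + rcost a + rcost b"

fun bcost :: "bexp \<Rightarrow> nat" where
  "bcost (BNLess a b) = 1 + ncost a + ncost b"
| "bcost (BRLess a b) = 1 + rcost a + rcost b"
| "bcost (BNot b) = 1 + bcost b"
| "bcost (BAnd a b) = 1 + bcost a + bcost b"

inductive exec :: "com \<Rightarrow> state \<Rightarrow> nat \<Rightarrow> state \<Rightarrow> bool" where
  Skip: "exec SKIP s 1 s"
| NAssign: "exec (NAssign a e) s (1 + ncost a + ncost e)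
              ((fst s)(nval a s := nval e s), snd s)"
| RAssign: "exec (RAssign a e) s (1 + ncost a + rcost e)
              (fst s, (snd s)(nval a s := rval e s))"
| Seq: "exec c1 s t1 s1 \<Longrightarrow> exec c2 s1 t2 s2 \<Longrightarrow> exec (Seq c1 c2) s (t1 + t2) s2"
| IfT: "bval b s \<Longrightarrow> exec c1 s t s' \<Longrightarrow> exec (IfC b c1 c2) s (1 + bcost b + t) s'"
| IfF: "\<not> bval b s \<Longrightarrow> exec c2 s t s' \<Longrightarrow> exec (IfC b c1 c2) s (1 + bcost b + t) s'"
| WhileF: "\<not> bval b s \<Longrightarrow> exec (WhileC b c) s (1 + bcost b) s"
| WhileT: "bval b s \<Longrightarrow> exec c s t1 s1 \<Longrightarrow> exec (WhileC b c) s1 t2 s2 \<Longrightarrow>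
             exec (WhileC b c) s (1 + bcost b + t1 + t2) s2"

text \<open>Instance with sites {0..<m}, clients {0..<k}.
  Nat memory: cell 0 = m, cell 1 = k, cell 2+j = r_j (j<k), all others 0.
  Real memory: cell i = f_i (i<m), cell m + i*k + j = c_ij, all others 0.\<close>
definition input_state ::
  "nat \<Rightarrow> nat \<Rightarrow> (nat \<Rightarrow> real) \<Rightarrow> (nat \<Rightarrow> nat \<Rightarrow> real) \<Rightarrow> (nat \<Rightarrow> nat) \<Rightarrow> state" where
  "input_state m k f c rq =
     ((\<lambda>a. if a = 0 then m else if a = 1 then k
           else if 2 \<le> a \<and> a < 2 + k then rq (a - 2) else 0),
      (\<lambda>a. if a < m then f a
           else if a < m + m * k then c ((a - m) div k) ((a - m) mod k) else 0))"

definition out_y :: "state \<Rightarrow> nat \<Rightarrow> nat" where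
  "out_y s i = fst s i"

definition out_x :: "nat \<Rightarrow> nat \<Rightarrow> state \<Rightarrow> nat \<Rightarrow> nat \<Rightarrow> nat" where
  "out_x m k s i j = fst s (m + i * k + j)"

end

(* The linear relaxation for requirements r is r times the one for requirements 1, so it suffices to
   compute an (integral) solution for r = 1 whose cost is bounded relative to fractional solutions,
   and to take it r times. Solutions for r enter only through their decomposition into unit stars.

   For r = 1 we follow Mahdian, Ye and Zhang. The dual-fitting greedy algorithm of Jain, Mahdian and
   Saberi, run with opening costs multiplied by 3/2, charges the clients of a star with opening cost
   f and connection costs d at most 1.112 f + 1.7776 sum d; this comes from an explicit dual solution
   of the factor-revealing linear program. Opening afterwards, greedily, the sites with the best
   ratio of saving to opening cost turns these factors into 1.112 + ln (3/2) < 1.5186 and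
   1 + 0.7776 / (3/2) = 1.5184.

   The greedy algorithm has to find, in each of at most k rounds, the star of least average cost. The
   sums over all threshold stars of a site are maintained explicitly, and each client leaves these
   stars only once, at cost O(m k); hence the total time is cubic. *)
theory Submission
  imports Defs "HOL-Analysis.Harmonic_Numbers"
begin

section \<open>The factor-revealing program\<close>

text \<open>The scaling factor 3/2 balances two effects. The tangent of the augmentation potential
  at \<open>z - C = 3/2 * F\<close> has slope 2/3, so two thirds of the greedy bound for scaled
  opening costs survive: the opening factor returns to 1.112 and gains \<open>ln (3/2)\<close>,
  while the connection factor shrinks to (2 * 1.7776 + 1) / 3. Both end just below 1.5186. The
  obstacle in the factor-revealing program is that \<open>\<alpha> - d\<close> need not be monotone
  along a star, although summing its constraints requires comparing different clients. Its suffix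
  maximum \<open>s\<close> is monotone by construction, and the triangle inequality still yields
  \<open>s i - 2 * d j\<close> as a lower bound for earlier clients. The continuous weights of an
  optimal dual solution become harmonic sums, whose deviation from logarithms fits into the slack of
  the constants. In the augmentation, neither the optimum nor its split into opening and connection
  cost is known to the program, so the invariant speaks about all comparison solutions at once. On
  the program side the difficulty is time: refreshing the star sums is quadratic per client, inside
  nested loops, and is paid by a potential.\<close>

lemma ln_ratio_step: 
  fixes x :: real assumes "x > 1" shows "1 / x \<le> ln (x / (x - 1))" "ln (x / (x - 1)) \<le> 1 / (x - 1)"
proof -
  have "ln ((x - 1) / x) \<le> (x - 1) / x - 1" using assms by (intro ln_le_minus_one) auto
  moreover have "ln ((x - 1) / x) = - ln (x / (x - 1))" using assms by (simp add: ln_div)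
  ultimately show "1 / x \<le> ln (x / (x - 1))" using assms by (simp add: field_simps)
  have "ln (x / (x - 1)) \<le> x / (x - 1) - 1" using assms by (intro ln_le_minus_one) auto
  then show "ln (x / (x - 1)) \<le> 1 / (x - 1)" using assms by (simp add: field_simps)
qed

lemma sum_inverse_le_ln:
  assumes "a \<le> b" "b < n"
  shows "(\<Sum>i\<in>{a..<b}. 1 / (real n - real i)) \<le> ln ((real n - real a) / (real n - real b))"
  using assms
proof (induction b rule: dec_induct)
  case base then show ?case by simp
next
  case (step b)
  have "1 / (real n - real b) \<le> ln ((real n - real b) / (real n - real b - 1))"
    using step.prems by (intro ln_ratio_step) auto
  moreover have "ln ((real n - real a) / (real n - real b)) + ln ((real n - real b) / (real n - real b - 1))
     = ln ((real n - real a) / (real n - real (Suc b)))"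
    using step.prems step.hyps by (simp add: ln_div algebra_simps)
  ultimately show ?case using step by simp
qed

lemma sum_inverse_pred_ge_ln:
  assumes "a \<le> b" "b < n"
  shows "(\<Sum>i\<in>{a..<b}. 1 / (real n - real i - 1)) \<ge> ln ((real n - real a) / (real n - real b))"
  using assms
proof (induction b rule: dec_induct)
  case base then show ?case by simp
next
  case (step b)
  have "1 / (real n - real b - 1) \<ge> ln ((real n - real b) / (real n - real b - 1))"
    using step.prems by (intro ln_ratio_step) auto
  moreover have "ln ((real n - real a) / (real n - real b)) + ln ((real n - real b) / (real n - real b - 1))
     = ln ((real n - real a) / (real n - real (Suc b)))"
    using step.prems step.hyps by (simp add: ln_div algebra_simps)
  ultimately show ?case using step by simp
qed

text \<open>Replacing 1 / (n - i) by 1 / (n - i - 1) shifts the summation by one index, so the two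
  sums differ only in their boundary terms.\<close>

lemma sum_inverse_ge_ln:
  assumes "a \<le> b" "b < n"
  shows "(\<Sum>i\<in>{a..<b}. 1 / (real n - real i)) \<ge>
    ln ((real n - real a) / (real n - real b)) - (1 / (real n - real b) - 1 / (real n - real a))"
proof -
  have "(\<Sum>i\<in>{a..<b}. 1 / (real n - real i - 1)) = (\<Sum>i\<in>{a..<b}. 1 / (real n - real i))
     + (1 / (real n - real b) - 1 / (real n - real a))"
    using assms
  proof (induction b rule: dec_induct)
    case base then show ?case by simp
  next
    case (step b) then show ?case by (simp add: algebra_simps)
  qed
  then show ?thesis using sum_inverse_pred_ge_ln[OF assms] by linarith
qed

lemma sum_inverse_telescope:
  assumes "a \<le> b" "b < n"
  shows "(\<Sum>i\<in>{a..<b}. 1 / ((real n - real i) * (real n - real i - 1)))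
     = 1 / (real n - real b) - 1 / (real n - real a)"
  using assms
proof (induction b rule: dec_induct)
  case base then show ?case by simp
next
  case (step b)
  have "1 / ((real n - real b) * (real n - real b - 1)) = 1 / (real n - real b - 1) - 1 / (real n - real b)"
    using step.prems by (simp add: field_simps)
  then show ?case using step by (simp add: algebra_simps)
qed

text \<open>The arguments are the ratios produced by the breakpoints: 567 = 792 - 225, then 775 and
  692 are 1000 - 225 and 1000 - 308, then 308 and 208 are 1000 - 692 and 1000 - 792. The value 3/2
  is the scaling of the opening costs.\<close>

lemma ln_bounds_numeric:
  "ln (792/567::real) \<le> 0.3343" "ln (792/567::real) \<ge> 0.3341"
  "ln (775/692::real) \<le> 0.1134" "ln (775/692::real) \<ge> 0.1131"
  "ln (308/208::real) \<ge> 0.3924" "ln (3/2::real) \<le> 0.4056"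
  using ln_approx_bounds[of "792/567" 3] ln_approx_bounds[of "775/692" 3]
    ln_approx_bounds[of "308/208" 3] ln_approx_bounds[of "3/2" 3]
  by (auto simp: eval_nat_numeral)

section \<open>An explicit dual solution: weighted sums of the offer constraints\<close>

lemma add_le_by_parts:
  fixes S :: real
  shows "S + P \<le> Q \<Longrightarrow> Q \<le> R \<Longrightarrow> Z \<le> P \<Longrightarrow> Z = W \<Longrightarrow> S + W \<le> R"
  by linarith

text \<open>For the clients of a star of a site, sorted by the time of connection, \<open>\<alpha>\<close> is the budget, \<open>d\<close> the
  distance and \<open>s i\<close> the maximum of \<open>\<alpha> l - d l\<close> over \<open>l \<ge> i\<close>: by the triangle inequality, client
  \<open>j < i\<close> still offers \<open>s i - 2 d j\<close> to the site when \<open>i\<close> is connected.\<close>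

locale offer_sequences =
  fixes K :: nat and \<alpha> s d :: "nat \<Rightarrow> real" and f :: real
  assumes d_nonneg: "i < K \<Longrightarrow> 0 \<le> d i"
    and s_nonneg: "i < K \<Longrightarrow> 0 \<le> s i"
    and s_antimono: "i \<le> j \<Longrightarrow> j < K \<Longrightarrow> s j \<le> s i"
    and alpha_le: "i < K \<Longrightarrow> \<alpha> i \<le> s i + d i"
    and offers: "i < K \<Longrightarrow>
      (\<Sum>j<i. max (s i - 2 * d j) 0) + (\<Sum>j\<in>{i..<K}. max (\<alpha> i - d j) 0) \<le> f"
begin

text \<open>Since \<open>max u 0\<close> dominates both \<open>u\<close> and 0, it dominates
  \<open>w * u\<close> for every weight \<open>w\<close> in [0, 1]. Hence offers of clients before
  \<open>a\<close> may be counted with weight \<open>w\<close>, those from \<open>i\<close> to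
  \<open>b\<close> in full, and all others dropped. The choice of \<open>a\<close>, \<open>b\<close>
  and \<open>w\<close> is the freedom that the dual solution exploits.\<close>

lemma offers_truncated:
  assumes "i < K" "a \<le> i" "i \<le> b" "b \<le> K" "0 \<le> w" "w \<le> 1"
  shows "(real b - real i) * \<alpha> i + w * (real a * s i)
    \<le> f + sum d {i..<b} + w * (2 * sum d {..<a})"
proof -
  have "w * (\<Sum>j<a. s i - 2 * d j) \<le> 1 * (\<Sum>j<a. max (s i - 2 * d j) 0)"
  proof -
    have "w * (\<Sum>j<a. s i - 2 * d j) \<le> w * (\<Sum>j<a. max (s i - 2 * d j) 0)"
      using assms by (intro mult_left_mono sum_mono) auto
    also have "\<dots> \<le> 1 * (\<Sum>j<a. max (s i - 2 * d j) 0)"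
      using assms by (intro mult_right_mono sum_nonneg) auto
    finally show ?thesis .
  qed
  also have "\<dots> \<le> (\<Sum>j<i. max (s i - 2 * d j) 0)"
    using assms by (auto intro!: sum_mono2)
  finally have 1: "w * (\<Sum>j<a. s i - 2 * d j) \<le> (\<Sum>j<i. max (s i - 2 * d j) 0)" .
  have "(\<Sum>j\<in>{i..<b}. \<alpha> i - d j) \<le> (\<Sum>j\<in>{i..<b}. max (\<alpha> i - d j) 0)"
    by (intro sum_mono) auto
  also have "\<dots> \<le> (\<Sum>j\<in>{i..<K}. max (\<alpha> i - d j) 0)"
    using assms by (intro sum_mono2) auto
  finally have 2: "(\<Sum>j\<in>{i..<b}. \<alpha> i - d j) \<le> (\<Sum>j\<in>{i..<K}. max (\<alpha> i - d j) 0)" .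
  have "(\<Sum>j\<in>{i..<b}. \<alpha> i - d j) = (real b - real i) * \<alpha> i - sum d {i..<b}"
    using assms by (simp add: sum_subtractf of_nat_diff)
  moreover have "w * (\<Sum>j<a. s i - 2 * d j) = w * (real a * s i) - w * (2 * sum d {..<a})"
    by (simp add: sum_subtractf sum_distrib_left right_diff_distrib)
  ultimately show ?thesis using 1 2 offers[OF assms(1)] by linarith
qed

lemma early_rows:
  assumes "a \<le> b" "b \<le> q" "q < K" "b < n" "n \<le> K"
  defines "E \<equiv> (\<Sum>i\<in>{a..<b}. 1 / (real n - real i))"
  shows "sum \<alpha> {a..<b} + (real n * E - (real b - real a)) / 2 * s q \<le> E * (f + sum d {..<n})"
proof -
  have row: "\<alpha> i + (real n / (real n - real i) - 1) / 2 * s q \<le> 1 / (real n - real i) * (f + sum d {..<n})"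
    if i: "i \<in> {a..<b}" for i
  proof -
    have "sum d {..<n} = sum d {..<i} + sum d {i..<n}"
      using i assms by (subst sum.atLeastLessThan_concat[of 0 i n, symmetric, simplified lessThan_atLeast0[symmetric]])
        (auto simp: lessThan_atLeast0)
    \<comment> \<open>The weight 1/2 turns the coefficient 2 of the early distances into 1, so that
      the right-hand side becomes the same for all rows.\<close>
    moreover have "(real n - real i) * \<alpha> i + 1/2 * (real i * s i) \<le> f + sum d {i..<n} + 1/2 * (2 * sum d {..<i})"
      using i assms by (intro offers_truncated) auto
    moreover have "real i * s q \<le> real i * s i"
      using i assms by (intro mult_left_mono s_antimono) auto
    ultimately have "(real n - real i) * \<alpha> i + real i / 2 * s q \<le> f + sum d {..<n}" by simp
    moreover have p: "real n - real i > 0" using i assms by auto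
    ultimately have "((real n - real i) * \<alpha> i + real i / 2 * s q) / (real n - real i) \<le> (f + sum d {..<n}) / (real n - real i)"
      by (simp add: divide_right_mono)
    moreover have "((real n - real i) * \<alpha> i + real i / 2 * s q) / (real n - real i)
       = \<alpha> i + (real n / (real n - real i) - 1) / 2 * s q"
      using p by (simp add: field_simps)
    ultimately show ?thesis by simp
  qed
  have "(\<Sum>i\<in>{a..<b}. \<alpha> i + (real n / (real n - real i) - 1) / 2 * s q) \<le> E * (f + sum d {..<n})"
    unfolding E_def sum_distrib_right by (intro sum_mono row)
  also have "(\<Sum>i\<in>{a..<b}. \<alpha> i + (real n / (real n - real i) - 1) / 2 * s q)
      = sum \<alpha> {a..<b} + (\<Sum>i\<in>{a..<b}. real n / (real n - real i) - 1) / 2 * s q"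
    by (simp add: sum.distrib sum_distrib_right sum_divide_distrib)
  also have "(\<Sum>i\<in>{a..<b}. real n / (real n - real i) - 1) = real n * E - (real b - real a)"
    using assms(1) by (simp add: E_def sum_distrib_left sum_subtractf of_nat_diff)
  finally show ?thesis .
qed

text \<open>In the full row of client \<open>i\<close> the budget has coefficient
  \<open>K - i\<close>. Adding \<open>i - a\<close> copies of
  \<open>\<alpha> i \<le> s i + d i\<close> raises it to \<open>K - a\<close> for every row and
  lowers the coefficient of \<open>s i\<close> from \<open>i\<close> to \<open>a\<close>, so the
  rows can be summed directly.\<close>

lemma middle_rows:
  assumes "a \<le> b" "b < K"
  shows "(real K - real a) * sum \<alpha> {a..<b} + real a * (real b - real a) * s b
     \<le> (real b - real a) * (f + sum d {..<K} + sum d {..<b})"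
proof -
  have row: "(real K - real a) * \<alpha> i + real a * s b
      \<le> f + sum d {..<K} + (sum d {..<i} + (real i - real a) * d i)"
    if i: "i \<in> {a..<b}" for i
  proof -
    have "sum d {..<K} = sum d {..<i} + sum d {i..<K}"
      using i assms by (subst sum.atLeastLessThan_concat[of 0 i K, symmetric, simplified lessThan_atLeast0[symmetric]])
        (auto simp: lessThan_atLeast0)
    moreover have "(real K - real i) * \<alpha> i + 1 * (real i * s i) \<le> f + sum d {i..<K} + 1 * (2 * sum d {..<i})"
      using i assms by (intro offers_truncated) auto
    moreover have "(real i - real a) * \<alpha> i \<le> (real i - real a) * (s i + d i)"
      using i assms by (intro mult_left_mono alpha_le) auto
    moreover have "real a * s b \<le> real a * s i"
      using i assms by (intro mult_left_mono s_antimono) auto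
    ultimately show ?thesis by (simp add: algebra_simps)
  qed
  \<comment> \<open>When \<open>c\<close> grows by one, the right side grows by the new summand of
    the left side plus \<open>d c\<close>.\<close>
  have tri: "a \<le> c \<Longrightarrow> c \<le> K \<Longrightarrow>
     (\<Sum>i\<in>{a..<c}. sum d {..<i} + (real i - real a) * d i) \<le> (real c - real a) * sum d {..<c}" for c
  proof (induction c rule: dec_induct)
    case base then show ?case by simp
  next
    case (step c)
    have "0 \<le> d c" using step d_nonneg by auto
    then show ?case using step by (simp add: algebra_simps)
  qed
  have "(\<Sum>i\<in>{a..<b}. (real K - real a) * \<alpha> i + real a * s b)
     \<le> (\<Sum>i\<in>{a..<b}. f + sum d {..<K} + (sum d {..<i} + (real i - real a) * d i))"
    by (intro sum_mono row)
  also have "\<dots> = (real b - real a) * (f + sum d {..<K}) + (\<Sum>i\<in>{a..<b}. sum d {..<i} + (real i - real a) * d i)"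
    using assms(1) by (subst sum.distrib) (simp add: of_nat_diff)
  also have "\<dots> \<le> (real b - real a) * (f + sum d {..<K}) + (real b - real a) * sum d {..<b}"
    using tri[of b] assms by simp
  also have "(\<Sum>i\<in>{a..<b}. (real K - real a) * \<alpha> i + real a * s b)
     = (real K - real a) * sum \<alpha> {a..<b} + real a * (real b - real a) * s b"
    using assms(1) by (simp add: sum.distrib sum_distrib_left[symmetric] of_nat_diff)
  finally show ?thesis by (simp add: algebra_simps)
qed

lemma late_rows:
  fixes C :: real
  assumes "q \<le> n" "n < K" "0 \<le> C" "C \<le> real K - real n"
  defines "\<Theta> \<equiv> C * (1 / (real K - real n) - 1 / (real K - real q))"
  shows "sum \<alpha> {q..<n} - (real n - real q) * s q
      + (real q * \<Theta> + C * (\<Sum>i\<in>{q..<n}. 1 / (real K - real i - 1))) * s n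
     \<le> \<Theta> * (f + 2 * sum d {..<q} + sum d {n..<K}) + (1 - C / (real K - real q)) * sum d {q..<n}"
proof -
  \<comment> \<open>These weights of the rows make every distance \<open>d l\<close> with
    \<open>q \<le> l < n\<close> end up with the same coefficient \<open>1 - C / (K - q)\<close>,
    and their partial sums telescope. The remaining weight of each budget is filled up with
    \<open>\<alpha> i \<le> s i + d i\<close>.\<close>
  define \<theta> where "\<theta> i = C * (1 / ((real K - real i) * (real K - real i - 1)))" for i
  have th_nonneg: "0 \<le> \<theta> i" if "i < n" for i using that assms by (simp add: \<theta>_def)
  have th_eq: "(real K - real i) * \<theta> i = C * (1 / (real K - real i - 1))" if "i < n" for i
    using that assms by (simp add: \<theta>_def)
  have th_sum: "(\<Sum>i\<in>{q..<b}. \<theta> i) = C * (1 / (real K - real b) - 1 / (real K - real q))"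
    if "q \<le> b" "b < K" for b
    using sum_inverse_telescope[OF that] unfolding \<theta>_def by (simp only: sum_distrib_left[symmetric])
  have row: "\<alpha> i - s q + (real q * \<theta> i + C * (1 / (real K - real i - 1))) * s n
      \<le> \<theta> i * (f + 2 * sum d {..<q}) + (\<theta> i * sum d {i..<K} + (1 - (real K - real i) * \<theta> i) * d i)"
    if i: "i \<in> {q..<n}" for i
  proof -
    have i': "i < n" "i < K" using i assms by auto
    have "(real K - real i) * \<alpha> i + 1 * (real q * s i) \<le> f + sum d {i..<K} + 1 * (2 * sum d {..<q})"
      using i assms by (intro offers_truncated) auto
    from mult_left_mono[OF this th_nonneg[OF i'(1)]]
    have 1: "(real K - real i) * \<theta> i * \<alpha> i + real q * \<theta> i * s i
        \<le> \<theta> i * (f + 2 * sum d {..<q}) + \<theta> i * sum d {i..<K}"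
      by (simp add: algebra_simps)
    \<comment> \<open>The weight left for \<open>\<alpha> i \<le> s i + d i\<close> must be
      nonnegative; this is what bounds \<open>C\<close> by \<open>K - n\<close>.\<close>
    have le1: "(real K - real i) * \<theta> i \<le> 1"
      unfolding th_eq[OF i'(1)] using i assms by (simp add: field_simps)
    have "(1 - (real K - real i) * \<theta> i) * \<alpha> i \<le> (1 - (real K - real i) * \<theta> i) * (s i + d i)"
      using i' le1 by (intro mult_left_mono alpha_le) auto
    with 1 have 2: "\<alpha> i - s i + (real q * \<theta> i + (real K - real i) * \<theta> i) * s i
       \<le> \<theta> i * (f + 2 * sum d {..<q}) + (\<theta> i * sum d {i..<K} + (1 - (real K - real i) * \<theta> i) * d i)"
      by (simp add: algebra_simps)
    have "(real q * \<theta> i + (real K - real i) * \<theta> i) * s n \<le> (real q * \<theta> i + (real K - real i) * \<theta> i) * s i"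
      using i assms th_nonneg[OF i'(1)] by (intro mult_left_mono s_antimono) auto
    moreover have "s i \<le> s q" using i assms by (intro s_antimono) auto
    ultimately show ?thesis using 2 th_eq[OF i'(1)] by simp
  qed
  have tri: "q \<le> b \<Longrightarrow> b \<le> n \<Longrightarrow>
     (\<Sum>i\<in>{q..<b}. \<theta> i * sum d {i..<K} + (1 - (real K - real i) * \<theta> i) * d i)
      = (\<Sum>i\<in>{q..<b}. \<theta> i) * sum d {b..<K} + (1 - C / (real K - real q)) * sum d {q..<b}" for b
  proof (induction b rule: dec_induct)
    case base then show ?case by simp
  next
    case (step b)
    have b: "b < n" "b < K" using step assms by auto
    have e: "sum d {b..<K} = d b + sum d {Suc b..<K}" using b by (simp add: sum.atLeast_Suc_lessThan)
    have "(\<Sum>i\<in>{q..<Suc b}. \<theta> i) = C * (1 / (real K - real b - 1)) - C / (real K - real q)"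
      using th_sum[of "Suc b"] step.hyps b assms by (simp add: right_diff_distrib algebra_simps)
    then have coef: "(\<Sum>i\<in>{q..<Suc b}. \<theta> i) + 1 - (real K - real b) * \<theta> b = 1 - C / (real K - real q)"
      using th_eq[OF b(1)] by simp
    have "(\<Sum>i\<in>{q..<Suc b}. \<theta> i * sum d {i..<K} + (1 - (real K - real i) * \<theta> i) * d i)
       = (\<Sum>i\<in>{q..<Suc b}. \<theta> i) * sum d {Suc b..<K} + (1 - C / (real K - real q)) * sum d {q..<b}
         + ((\<Sum>i\<in>{q..<Suc b}. \<theta> i) + 1 - (real K - real b) * \<theta> b) * d b"
    proof -
      have "(\<Sum>i\<in>{q..<Suc b}. \<theta> i * sum d {i..<K} + (1 - (real K - real i) * \<theta> i) * d i)
        = (\<Sum>i\<in>{q..<b}. \<theta> i) * sum d {b..<K} + (1 - C / (real K - real q)) * sum d {q..<b}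
          + (\<theta> b * sum d {b..<K} + (1 - (real K - real b) * \<theta> b) * d b)"
        using step by simp
      then show ?thesis unfolding e using step.hyps(1) by (simp add: algebra_simps)
    qed
    then show ?case unfolding coef using step.hyps(1) by (simp add: distrib_left)
  qed
  have "(\<Sum>i\<in>{q..<n}. \<alpha> i - s q + (real q * \<theta> i + C * (1 / (real K - real i - 1))) * s n)
     \<le> (\<Sum>i\<in>{q..<n}. \<theta> i * (f + 2 * sum d {..<q}) + (\<theta> i * sum d {i..<K} + (1 - (real K - real i) * \<theta> i) * d i))"
    by (intro sum_mono row)
  also have "\<dots> = \<Theta> * (f + 2 * sum d {..<q}) + (\<Theta> * sum d {n..<K} + (1 - C / (real K - real q)) * sum d {q..<n})"
    using tri[of n] th_sum[of n] assms by (simp add: sum.distrib sum_distrib_right[symmetric] \<Theta>_def)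
  also have "(\<Sum>i\<in>{q..<n}. \<alpha> i - s q + (real q * \<theta> i + C * (1 / (real K - real i - 1))) * s n)
     = sum \<alpha> {q..<n} - (real n - real q) * s q + (\<Sum>i\<in>{q..<n}. real q * \<theta> i + C * (1 / (real K - real i - 1))) * s n"
    using assms(1) by (subst sum.distrib) (simp add: sum_subtractf of_nat_diff sum_distrib_right)
  also have "(\<Sum>i\<in>{q..<n}. real q * \<theta> i + C * (1 / (real K - real i - 1)))
     = real q * \<Theta> + C * (\<Sum>i\<in>{q..<n}. 1 / (real K - real i - 1))"
    by (simp only: sum.distrib sum_distrib_left[symmetric] \<Theta>_def th_sum[OF assms(1,2)])
  finally show ?thesis by (simp add: algebra_simps)
qed


text \<open>The breakpoints 225, 308, 692, 792 (per mille) and the factor 70 come from optimising the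
  dual solution of the factor-revealing program; they follow Mahdian, Ye and Zhang.\<close>
theorem sum_alpha_le:
  assumes K: "K = 1000 * k" and k: "k > 0"
  shows "sum \<alpha> {..<K} \<le> 1.112 * f + 1.7776 * sum d {..<K}"
proof -
  define E1 where "E1 = (\<Sum>i\<in>{0..<225*k}. 1 / (real (792*k) - real i))"
  define E2 where "E2 = (\<Sum>i\<in>{225*k..<308*k}. 1 / (real K - real i))"
  define E4 where "E4 = (\<Sum>i\<in>{692*k..<792*k}. 1 / (real K - real i - 1))"
  define x where "x = real k * s (692*k)"
  define y where "y = real k * s (792*k)"
  define D1 D2 D3 where "D1 = sum d {..<692*k}" and "D2 = sum d {692*k..<792*k}" and "D3 = sum d {792*k..<K}"
  have f: "0 \<le> f" using offers[of 0] k K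
    by (meson max.cobounded2 mult_pos_pos order_trans sum_nonneg add_nonneg_nonneg zero_less_numeral)
  have D: "0 \<le> D1" "0 \<le> D2" "0 \<le> D3" unfolding D1_def D2_def D3_def K
    by (auto intro!: sum_nonneg d_nonneg simp: K)
  have xy: "y \<le> x" "0 \<le> y" unfolding x_def y_def using k
    by (auto intro!: mult_left_mono mult_nonneg_nonneg s_antimono s_nonneg simp: K)
  have rk: "real k > 0" using k by simp
  have cat: "sum g {..<b} = sum g {..<a} + sum g {a..<b}" if "a \<le> b" for a b and g :: "nat \<Rightarrow> real"
    using that by (subst sum.atLeastLessThan_concat[of 0 a b, symmetric, simplified lessThan_atLeast0[symmetric]])
      (auto simp: lessThan_atLeast0)
  have d792: "sum d {..<792*k} = D1 + D2" unfolding D1_def D2_def by (rule cat) simp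
  have dK: "sum d {..<K} = D1 + D2 + D3" unfolding d792[symmetric] D3_def K by (rule cat) simp
  \<comment> \<open>The lower bounds lose the boundary terms of the harmonic sum, which after
    scaling do not grow with \<open>k\<close>: 792/567 - 1 is below 0.4 here, and 1000/692 -
    1000/775 is below 0.16 for \<open>E2\<close>.\<close>
  have E1: "E1 \<le> 0.3343" "E1 * real (792*k) \<ge> (0.3341 * 792 - 0.4) * real k"
  proof -
    have "E1 \<le> ln ((real (792*k) - real 0) / (real (792*k) - real (225*k)))"
      unfolding E1_def using k by (intro sum_inverse_le_ln) auto
    also have "(real (792*k) - real 0) / (real (792*k) - real (225*k)) = 792/567" using rk by (simp add: field_simps)
    finally show "E1 \<le> 0.3343" using ln_bounds_numeric by linarith
    have "ln ((real (792*k) - real 0) / (real (792*k) - real (225*k))) - (1 / (real (792*k) - real (225*k)) - 1 / (real (792*k) - real 0)) \<le> E1"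
      unfolding E1_def using k by (intro sum_inverse_ge_ln) auto
    also have "(real (792*k) - real 0) / (real (792*k) - real (225*k)) = 792/567" using rk by (simp add: field_simps)
    also have "1 / (real (792*k) - real (225*k)) - 1 / (real (792*k) - real 0) = (1/567 - 1/792) / real k"
      using rk by (simp add: field_simps)
    finally have "0.3341 - (1/567 - 1/792) / real k \<le> E1" using ln_bounds_numeric by linarith
    note lower = this
    have "real k \<ge> 1" using k by simp
    then have "(0.3341 * 792 - 0.4) * real k \<le> 0.3341 * 792 * real k - (792/567 - 1)" by (simp add: algebra_simps)
    also have "\<dots> = (0.3341 - (1/567 - 1/792) / real k) * real (792*k)" using rk by (simp add: K field_simps)
    also have "\<dots> \<le> E1 * real (792*k)" by (intro mult_right_mono lower) auto
    finally show "E1 * real (792*k) \<ge> (0.3341 * 792 - 0.4) * real k" .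
  qed
  have E2: "E2 \<le> 0.1134" "E2 * real K \<ge> (0.1131 * 1000 - 0.16) * real k"
  proof -
    have "E2 \<le> ln ((real K - real (225*k)) / (real K - real (308*k)))"
      unfolding E2_def using k K by (intro sum_inverse_le_ln) auto
    also have "(real K - real (225*k)) / (real K - real (308*k)) = 775/692" using rk by (simp add: K field_simps)
    finally show "E2 \<le> 0.1134" using ln_bounds_numeric by linarith
    have "ln ((real K - real (225*k)) / (real K - real (308*k))) - (1 / (real K - real (308*k)) - 1 / (real K - real (225*k))) \<le> E2"
      unfolding E2_def using k K by (intro sum_inverse_ge_ln) auto
    also have "(real K - real (225*k)) / (real K - real (308*k)) = 775/692" using rk by (simp add: K field_simps)
    also have "1 / (real K - real (308*k)) - 1 / (real K - real (225*k)) = (1/692 - 1/775) / real k"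
      using rk by (simp add: K field_simps)
    finally have "0.1131 - (1/692 - 1/775) / real k \<le> E2" using ln_bounds_numeric by linarith
    note lower = this
    have "real k \<ge> 1" using k by simp
    then have "(0.1131 * 1000 - 0.16) * real k \<le> 0.1131 * 1000 * real k - (1000/692 - 1000/775)" by (simp add: algebra_simps)
    also have "\<dots> = (0.1131 - (1/692 - 1/775) / real k) * real K" using rk by (simp add: K field_simps)
    also have "\<dots> \<le> E2 * real K" by (intro mult_right_mono lower) auto
    finally show "E2 * real K \<ge> (0.1131 * 1000 - 0.16) * real k" .
  qed
  have E4: "E4 \<ge> 0.3924"
  proof -
    have "ln ((real K - real (692*k)) / (real K - real (792*k))) \<le> E4"
      unfolding E4_def using k K by (intro sum_inverse_pred_ge_ln) auto
    also have "(real K - real (692*k)) / (real K - real (792*k)) = 308/208" using rk by (simp add: K field_simps)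
    finally show ?thesis using ln_bounds_numeric by linarith
  qed
  \<comment> \<open>These rows are cut off at 792 rather than 1000, so \<open>D3\<close> does not
    occur in them. The last clients already contribute the full coefficient 1 to \<open>D3\<close>
    in \<open>R5\<close>, and the total for \<open>D3\<close> is the tightest of all.\<close>
  have R1: "sum \<alpha> {0..<225*k} + (0.3341 * 792 - 0.4 - 225) / 2 * x \<le> 0.3343 * (f + (D1 + D2))"
  proof -
    have "sum \<alpha> {0..<225*k} + (real (792*k) * E1 - (real (225*k) - real 0)) / 2 * s (692*k) \<le> E1 * (f + sum d {..<792*k})"
      unfolding E1_def using k K by (intro early_rows) auto
    moreover have "E1 * (f + sum d {..<792*k}) \<le> 0.3343 * (f + sum d {..<792*k})"
      using E1 f D unfolding d792 by (intro mult_right_mono) auto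
    moreover have "((0.3341 * 792 - 0.4 - 225) * real k) / 2 * s (692*k)
        \<le> (real (792*k) * E1 - (real (225*k) - real 0)) / 2 * s (692*k)"
      using E1 k K by (intro mult_right_mono s_nonneg) (auto simp: algebra_simps)
    moreover have "((0.3341 * 792 - 0.4 - 225) * real k) / 2 * s (692*k) = (0.3341 * 792 - 0.4 - 225) / 2 * x"
      by (simp add: x_def)
    ultimately show ?thesis unfolding d792 by (rule add_le_by_parts)
  qed
  have R2: "sum \<alpha> {225*k..<308*k} + (113.1 - 0.16 - 83) / 2 * x \<le> 0.1134 * (f + (D1 + D2 + D3))"
  proof -
    have "sum \<alpha> {225*k..<308*k} + (real K * E2 - (real (308*k) - real (225*k))) / 2 * s (692*k) \<le> E2 * (f + sum d {..<K})"
      unfolding E2_def using k K by (intro early_rows) auto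
    moreover have "E2 * (f + sum d {..<K}) \<le> 0.1134 * (f + sum d {..<K})"
      using E2 f D unfolding dK by (intro mult_right_mono) auto
    moreover have "((113.1 - 0.16 - 83) * real k) / 2 * s (692*k)
        \<le> (real K * E2 - (real (308*k) - real (225*k))) / 2 * s (692*k)"
      using E2 k K by (intro mult_right_mono s_nonneg) (auto simp: algebra_simps)
    moreover have "((113.1 - 0.16 - 83) * real k) / 2 * s (692*k) = (113.1 - 0.16 - 83) / 2 * x"
      by (simp add: x_def)
    ultimately show ?thesis unfolding dK by (rule add_le_by_parts)
  qed
  have R3: "692 * sum \<alpha> {308*k..<692*k} + 308 * 384 * x \<le> 384 * (f + 2 * D1 + D2 + D3)"
  proof -
    have "(real K - real (308*k)) * sum \<alpha> {308*k..<692*k} + real (308*k) * (real (692*k) - real (308*k)) * s (692*k)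
       \<le> (real (692*k) - real (308*k)) * (f + sum d {..<K} + sum d {..<692*k})"
      using k K by (intro middle_rows) auto
    then have "real k * (692 * sum \<alpha> {308*k..<692*k} + 308 * 384 * x) \<le> real k * (384 * (f + 2 * D1 + D2 + D3))"
      unfolding dK D1_def[symmetric] x_def by (simp add: K algebra_simps)
    then show ?thesis using rk by (simp only: mult_le_cancel_left_pos)
  qed
  have R4: "sum \<alpha> {692*k..<792*k} - 100 * x + (692 * (70/208 - 70/308) + 70 * 0.3924) * y
      \<le> (70/208 - 70/308) * (f + 2 * D1 + D3) + (1 - 70/308) * D2"
  proof -
    have th: "real (70*k) * (1 / (real K - real (792*k)) - 1 / (real K - real (692*k))) = 70/208 - 70/308"
      using rk by (simp add: K field_simps)
    have c: "real (70*k) / (real K - real (692*k)) = 70/308" using rk by (simp add: K field_simps)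
    have "sum \<alpha> {692*k..<792*k} - (real (792*k) - real (692*k)) * s (692*k)
       + (real (692*k) * (real (70*k) * (1 / (real K - real (792*k)) - 1 / (real K - real (692*k)))) + real (70*k) * E4) * s (792*k)
       \<le> (real (70*k) * (1 / (real K - real (792*k)) - 1 / (real K - real (692*k)))) * (f + 2 * sum d {..<692*k} + sum d {792*k..<K})
         + (1 - real (70*k) / (real K - real (692*k))) * sum d {692*k..<792*k}"
      unfolding E4_def using k K by (intro late_rows) auto
    then have 1: "sum \<alpha> {692*k..<792*k} - (real (792*k) - real (692*k)) * s (692*k)
       + (real (692*k) * (70/208 - 70/308) + real (70*k) * E4) * s (792*k)
       \<le> (70/208 - 70/308) * (f + 2 * D1 + D3) + (1 - 70/308) * D2"
      unfolding th c D1_def D2_def D3_def .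
    have "(real (792*k) - real (692*k)) * s (692*k) = 100 * x" by (simp add: x_def)
    moreover have "(real (692*k) * (70/208 - 70/308) + real (70*k) * E4) * s (792*k)
        = 692 * (70/208 - 70/308) * y + 70 * E4 * y" by (simp add: y_def algebra_simps)
    moreover have "70 * 0.3924 * y \<le> 70 * E4 * y" using E4 xy by (intro mult_right_mono) auto
    ultimately show ?thesis using 1 by (simp add: algebra_simps)
  qed
  have R5: "sum \<alpha> {792*k..<K} \<le> 208 * y + D3"
  proof -
    have "sum \<alpha> {792*k..<K} \<le> (\<Sum>i\<in>{792*k..<K}. s (792*k) + d i)"
    proof (intro sum_mono)
      fix i assume i: "i \<in> {792*k..<K}"
      have "\<alpha> i \<le> s i + d i" using i by (intro alpha_le) auto
      also have "s i \<le> s (792*k)" using i by (intro s_antimono) auto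
      finally show "\<alpha> i \<le> s (792*k) + d i" by simp
    qed
    also have "\<dots> = 208 * y + D3" by (simp add: sum.distrib y_def D3_def K)
    finally show ?thesis .
  qed
  have "sum \<alpha> {..<K} = sum \<alpha> {0..<225*k} + sum \<alpha> {225*k..<308*k} + sum \<alpha> {308*k..<692*k}
      + sum \<alpha> {692*k..<792*k} + sum \<alpha> {792*k..<K}"
    using cat[of "792*k" K \<alpha>] cat[of "692*k" "792*k" \<alpha>] cat[of "308*k" "692*k" \<alpha>] cat[of "225*k" "308*k" \<alpha>]
    by (simp add: K lessThan_atLeast0)
  \<comment> \<open>After dividing \<open>R3\<close> by 692, the coefficients of \<open>f\<close>
    add up to about 1.1119 and those of \<open>D1\<close>, \<open>D2\<close>, \<open>D3\<close> to
    about 1.7761, 1.7753 and 1.77758. On the left \<open>x\<close> collects about 105.49, on the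
    right \<open>y\<close> about 104.92, and these cancel because \<open>y \<le> x\<close>.\<close>
  then show ?thesis unfolding dK using R1 R2 R3 R4 R5 f D xy by (simp add: field_simps)
qed

end

section \<open>Replication: arbitrary star sizes\<close>

lemma sum_lessThan_split:
  fixes a b :: nat
  shows "a \<le> b \<Longrightarrow> sum g {..<b} = sum g {..<a} + sum g {a..<b}"
  by (metis lessThan_atLeast0 sum.atLeastLessThan_concat zero_le)

lemma sum_div_blocks:
  fixes g :: "nat \<Rightarrow> real"
  assumes "M > 0"
  shows "(\<Sum>i<M * k. g (i div M)) = real M * (\<Sum>i<k. g i)"
proof (induction k)
  case 0 then show ?case by simp
next
  case (Suc k)
  have "(\<Sum>i<M * Suc k. g (i div M)) = (\<Sum>i<M * k. g (i div M)) + (\<Sum>i\<in>{M*k..<M*k+M}. g (i div M))"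
    by (subst sum_lessThan_split[of "M*k"]) (simp_all add: add.commute)
  also have "(\<Sum>i\<in>{M*k..<M*k+M}. g (i div M)) = (\<Sum>i\<in>{M*k..<M*k+M}. g k)"
  proof (intro sum.cong refl)
    fix i assume "i \<in> {M*k..<M*k+M}"
    then have "i div M = k" by (intro div_nat_eqI) (auto simp: algebra_simps)
    then show "g (i div M) = g k" by simp
  qed
  finally show ?case using Suc by (simp add: algebra_simps)
qed

text \<open>Every client is replicated 1000 times, so that the breakpoints become integral.\<close>

theorem factor_revealing_bound:
  fixes \<alpha> s d :: "nat \<Rightarrow> real" and f :: real
  assumes "0 \<le> f"
    and d_nonneg: "\<And>i. i < k \<Longrightarrow> 0 \<le> d i"
    and s_nonneg: "\<And>i. i < k \<Longrightarrow> 0 \<le> s i"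
    and s_antimono: "\<And>i j. i \<le> j \<Longrightarrow> j < k \<Longrightarrow> s j \<le> s i"
    and alpha_le: "\<And>i. i < k \<Longrightarrow> \<alpha> i \<le> s i + d i"
    and s_le: "\<And>i. i < k \<Longrightarrow> s i \<le> \<alpha> i + d i"
    and offers: "\<And>i. i < k \<Longrightarrow>
      (\<Sum>j<i. max (s i - 2 * d j) 0) + (\<Sum>j\<in>{i..<k}. max (\<alpha> i - d j) 0) \<le> f"
  shows "(\<Sum>i<k. \<alpha> i) \<le> 1.112 * f + 1.7776 * (\<Sum>i<k. d i)"
proof (cases "k = 0")
  case True then show ?thesis using assms(1) by simp
next
  case False
  define M :: nat where "M = 1000"
  have M: "M > 0" by (simp add: M_def)
  have lt: "i div M < k" if "i < M * k" for i using that by (simp add: less_mult_imp_div_less mult.commute)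
  interpret offer_sequences "M * k" "\<lambda>i. \<alpha> (i div M)" "\<lambda>i. s (i div M)" "\<lambda>i. d (i div M)" "real M * f"
  proof
    fix i assume i: "i < M * k"
    show "0 \<le> d (i div M)" "0 \<le> s (i div M)" "\<alpha> (i div M) \<le> s (i div M) + d (i div M)"
      using lt[OF i] d_nonneg s_nonneg alpha_le by auto
    define g where "g = i div M"
    define \<phi> where "\<phi> h = (if h < g then max (s g - 2 * d h) 0 else max (\<alpha> g - d h) 0)" for h
    have g: "g < k" using lt[OF i] by (simp add: g_def)
    \<comment> \<open>A copy \<open>j < i\<close> may belong to the same original client as
      \<open>i\<close>. The original constraint counts that client as a late one, so its early offer
      \<open>s g - 2 * d g\<close> has to be dominated by \<open>\<alpha> g - d g\<close>; this is
      the use of \<open>s_le\<close>.\<close>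
    have 1: "max (s g - 2 * d (j div M)) 0 \<le> \<phi> (j div M)" if "j < i" for j
    proof -
      have "j div M \<le> g" using that by (simp add: g_def div_le_mono)
      moreover have "s g - 2 * d g \<le> \<alpha> g - d g" using s_le[OF g] by simp
      ultimately show ?thesis by (auto simp: \<phi>_def not_less)
    qed
    have 2: "max (\<alpha> g - d (j div M)) 0 = \<phi> (j div M)" if "i \<le> j" for j
      using div_le_mono[OF that, of M] by (simp add: \<phi>_def g_def)
    have "(\<Sum>j<i. max (s g - 2 * d (j div M)) 0) + (\<Sum>j\<in>{i..<M*k}. max (\<alpha> g - d (j div M)) 0)
      \<le> (\<Sum>j<i. \<phi> (j div M)) + (\<Sum>j\<in>{i..<M*k}. \<phi> (j div M))"
      using 1 2 by (intro add_mono sum_mono) auto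
    also have "\<dots> = (\<Sum>j<M*k. \<phi> (j div M))"
      using i by (subst sum.atLeastLessThan_concat[of 0 i "M*k", simplified lessThan_atLeast0[symmetric]]) auto
    also have "\<dots> = real M * (\<Sum>h<k. \<phi> h)" by (rule sum_div_blocks[OF M])
    also have "(\<Sum>h<k. \<phi> h) = (\<Sum>h<g. \<phi> h) + (\<Sum>h\<in>{g..<k}. \<phi> h)"
      using g by (subst sum.atLeastLessThan_concat[of 0 g k, simplified lessThan_atLeast0[symmetric]]) auto
    also have "\<dots> = (\<Sum>h<g. max (s g - 2 * d h) 0) + (\<Sum>h\<in>{g..<k}. max (\<alpha> g - d h) 0)"
      by (simp add: \<phi>_def)
    also have "real M * \<dots> \<le> real M * f" using offers[OF g] by (intro mult_left_mono) auto
    finally show "(\<Sum>j<i. max (s (i div M) - 2 * d (j div M)) 0)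
        + (\<Sum>j\<in>{i..<M*k}. max (\<alpha> (i div M) - d (j div M)) 0) \<le> real M * f" by (simp add: g_def)
  next
    fix i j assume "i \<le> j" "j < M * k"
    then show "s (j div M) \<le> s (i div M)" using s_antimono lt by (simp add: div_le_mono)
  qed
  have "(\<Sum>i<M*k. \<alpha> (i div M)) \<le> 1.112 * (real M * f) + 1.7776 * (\<Sum>i<M*k. d (i div M))"
    using False by (intro sum_alpha_le[of k]) (auto simp: M_def)
  then have "real M * (\<Sum>i<k. \<alpha> i) \<le> real M * (1.112 * f + 1.7776 * (\<Sum>i<k. d i))"
    unfolding sum_div_blocks[OF M] by (simp add: algebra_simps)
  then show ?thesis using M by (simp only: mult_le_cancel_left_pos of_nat_0_less_iff)
qed

section \<open>The greedy algorithm of Jain, Mahdian and Saberi\<close>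

definition saving :: "nat \<Rightarrow> (nat \<Rightarrow> nat \<Rightarrow> real) \<Rightarrow> (nat \<Rightarrow> real) \<Rightarrow> nat \<Rightarrow> real" where
  "saving k c D i = (\<Sum>j<k. max (D j - c i j) 0)"

text \<open>A client \<open>j\<close> is unconnected iff \<open>D j < 0\<close>; otherwise \<open>D j\<close> is its current connection cost.\<close>

definition star :: "nat \<Rightarrow> (nat \<Rightarrow> nat \<Rightarrow> real) \<Rightarrow> (nat \<Rightarrow> real) \<Rightarrow> nat \<Rightarrow> nat \<Rightarrow> nat set" where
  "star k c D i j = {j'. j' < k \<and> D j' < 0 \<and> c i j' \<le> c i j}"

text \<open>Only stars given by a threshold client are rated: for a fixed number of clients the
  nearest unconnected ones are cheapest. The saving credits the site with what connected clients
  gain by switching to it.\<close>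

definition star_ratio ::
  "nat \<Rightarrow> (nat \<Rightarrow> nat \<Rightarrow> real) \<Rightarrow> (nat \<Rightarrow> real) \<Rightarrow> (nat \<Rightarrow> real) \<Rightarrow> nat \<Rightarrow> nat \<Rightarrow> real" where
  "star_ratio k c D g i j =
    (g i - saving k c D i + sum (c i) (star k c D i j)) / real (card (star k c D i j))"

definition connect :: "(nat \<Rightarrow> nat \<Rightarrow> real) \<Rightarrow> nat \<Rightarrow> nat \<Rightarrow> (nat \<Rightarrow> real) \<Rightarrow> nat \<Rightarrow> real" where
  "connect c i j D j' =
    (if D j' < 0 then if c i j' \<le> c i j then c i j' else D j' else min (D j') (c i j'))"

text \<open>The dual view of the greedy rule: time \<open>t\<close> is the common budget of the
  unconnected clients, and a site opens when these bids reach its residual cost.\<close>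

definition offer :: "nat \<Rightarrow> (nat \<Rightarrow> nat \<Rightarrow> real) \<Rightarrow> (nat \<Rightarrow> real) \<Rightarrow> real \<Rightarrow> nat \<Rightarrow> real" where
  "offer k c D t i = (\<Sum>j<k. if D j < 0 then max (t - c i j) 0 else max (D j - c i j) 0)"

text \<open>Ghost data of a run: \<open>\<alpha> j\<close> is the budget of \<open>j\<close> when it is first connected, \<open>e j\<close> the index of
  that event, \<open>X j l\<close> the connection cost of \<open>j\<close> just before the event connecting \<open>l\<close>, \<open>Op\<close> the
  set of open sites, \<open>t\<close> the current time and \<open>n\<close> the number of events so far.\<close>

locale jms_inv =
  fixes m k :: nat and c :: "nat \<Rightarrow> nat \<Rightarrow> real" and f D :: "nat \<Rightarrow> real" and sg :: "nat \<Rightarrow> nat"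
    and g :: "nat \<Rightarrow> real" and n :: nat and \<alpha> :: "nat \<Rightarrow> real" and e :: "nat \<Rightarrow> nat"
    and X :: "nat \<Rightarrow> nat \<Rightarrow> real" and t :: real and Op :: "nat set"
  assumes Op: "Op \<subseteq> {..<m}" and t_nonneg: "0 \<le> t"
    and g: "i < m \<Longrightarrow> g i = (if i \<in> Op then 0 else f i)"
    and sg_Op: "j < k \<Longrightarrow> 0 \<le> D j \<Longrightarrow> sg j \<in> Op"
    and D_sg: "j < k \<Longrightarrow> 0 \<le> D j \<Longrightarrow> D j = c (sg j) j"
    and offer_le: "i < m \<Longrightarrow> offer k c D t i \<le> g i"
    and balance: "(\<Sum>j | j < k \<and> 0 \<le> D j. \<alpha> j) = sum f Op + (\<Sum>j | j < k \<and> 0 \<le> D j. D j)"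
    and alpha_nonneg: "j < k \<Longrightarrow> 0 \<le> D j \<Longrightarrow> 0 \<le> \<alpha> j"
    and alpha_le_t: "j < k \<Longrightarrow> 0 \<le> D j \<Longrightarrow> \<alpha> j \<le> t"
    and e_less: "j < k \<Longrightarrow> 0 \<le> D j \<Longrightarrow> e j < n"
    and D_le_alpha: "j < k \<Longrightarrow> 0 \<le> D j \<Longrightarrow> D j \<le> \<alpha> j"
    and alpha_mono: "j < k \<Longrightarrow> l < k \<Longrightarrow> 0 \<le> D j \<Longrightarrow> 0 \<le> D l \<Longrightarrow> e j \<le> e l \<Longrightarrow> \<alpha> j \<le> \<alpha> l"
    and X_le_alpha: "j < k \<Longrightarrow> l < k \<Longrightarrow> 0 \<le> D j \<Longrightarrow> 0 \<le> D l \<Longrightarrow> e j < e l \<Longrightarrow> X j l \<le> \<alpha> j"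
    and D_le_X: "j < k \<Longrightarrow> l < k \<Longrightarrow> 0 \<le> D j \<Longrightarrow> 0 \<le> D l \<Longrightarrow> e j < e l \<Longrightarrow> D j \<le> X j l"
    and alpha_le_X: "j < k \<Longrightarrow> l < k \<Longrightarrow> 0 \<le> D j \<Longrightarrow> 0 \<le> D l \<Longrightarrow> e j < e l \<Longrightarrow> i < m \<Longrightarrow>
      \<alpha> l \<le> X j l + c i j + c i l"
    and X_antimono: "j < k \<Longrightarrow> l < k \<Longrightarrow> l' < k \<Longrightarrow> 0 \<le> D j \<Longrightarrow> 0 \<le> D l \<Longrightarrow> 0 \<le> D l' \<Longrightarrow>
      e j < e l \<Longrightarrow> e l \<le> e l' \<Longrightarrow> X j l' \<le> X j l"
    and budget: "l < k \<Longrightarrow> i < m \<Longrightarrow> 0 \<le> D l \<Longrightarrow>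
      (\<Sum>j<k. if 0 \<le> D j \<and> e j < e l then max (X j l - c i j) 0 else max (\<alpha> l - c i j) 0) \<le> f i"

section \<open>One iteration of the greedy algorithm and its budgets\<close>

lemma offer_eq:
  assumes c: "\<And>j. j < k \<Longrightarrow> 0 \<le> c i j"
  shows "offer k c D t i = (\<Sum>j | j < k \<and> D j < 0. max (t - c i j) 0) + saving k c D i"
proof -
  have "offer k c D t i = (\<Sum>j<k. (if D j < 0 then max (t - c i j) 0 else 0) + max (D j - c i j) 0)"
    unfolding offer_def
  proof (intro sum.cong refl)
    fix j assume "j \<in> {..<k}"
    then have "0 \<le> c i j" using c by simp
    then show "(if D j < 0 then max (t - c i j) 0 else max (D j - c i j) 0)
      = (if D j < 0 then max (t - c i j) 0 else 0) + max (D j - c i j) 0" by simp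
  qed
  also have "\<dots> = (\<Sum>j<k. if D j < 0 then max (t - c i j) 0 else 0) + saving k c D i"
    by (simp add: sum.distrib saving_def)
  also have "(\<Sum>j<k. if D j < 0 then max (t - c i j) 0 else 0) = (\<Sum>j | j < k \<and> D j < 0. max (t - c i j) 0)"
    by (intro sum.mono_neutral_cong_right) auto
  finally show ?thesis .
qed

text \<open>The unconnected clients with a positive bid at time \<open>t\<close> form exactly the
  threshold star of the farthest of them. That this star has average cost at least \<open>t\<close>
  means that the bids do not exceed the residual cost.\<close>

lemma offer_le_of_star_ratio:
  assumes i: "i < m" and tau: "offer k c D \<tau> i \<le> g i"
    and t: "\<And>j. j < k \<Longrightarrow> D j < 0 \<Longrightarrow> t \<le> star_ratio k c D g i j"
    and c: "\<And>j. j < k \<Longrightarrow> 0 \<le> c i j"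
  shows "offer k c D t i \<le> g i"
proof -
  define U where "U = {j. j < k \<and> D j < 0}"
  have fin: "finite U" by (simp add: U_def)
  have off: "offer k c D t' i = (\<Sum>j\<in>U. max (t' - c i j) 0) + saving k c D i" for t'
    unfolding U_def by (rule offer_eq) (use c in blast)
  define T where "T = {j \<in> U. c i j < t}"
  have finT: "finite T" using fin by (simp add: T_def)
  have sumT: "(\<Sum>j\<in>U. max (t - c i j) 0) = (\<Sum>j\<in>T. t - c i j)"
    using fin by (intro sum.mono_neutral_cong_right) (auto simp: T_def)
  show ?thesis
  proof (cases "T = {}")
    \<comment> \<open>Without positive bids of unconnected clients only the switching gains remain,
      and these are already covered by the bound at time \<open>\<tau>\<close>.\<close>
    case True
    have "0 \<le> (\<Sum>j\<in>U. max (\<tau> - c i j) 0)" by (intro sum_nonneg) auto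
    then show ?thesis using tau True sumT off by simp
  next
    case False
    then have "Max (c i ` T) \<in> c i ` T" using finT by (intro Max_in) auto
    then obtain j where j: "j \<in> T" and jM: "c i j = Max (c i ` T)" by auto
    have jmax: "c i j' \<le> c i j" if "j' \<in> T" for j' unfolding jM using finT that by (intro Max_ge) auto
    have "star k c D i j = T" using j jmax by (auto simp: star_def T_def U_def)
    moreover have "t \<le> star_ratio k c D g i j" using j by (intro t) (auto simp: T_def U_def)
    moreover have "card T > 0" using False finT by (simp add: card_gt_0_iff)
    ultimately have "t * real (card T) \<le> g i - saving k c D i + sum (c i) T"
      by (simp add: star_ratio_def pos_le_divide_eq)
    then show ?thesis unfolding off sumT by (simp add: sum_subtractf mult.commute)
  qed
qed


lemma uftra_metricD:
  "uftra_metric {..<m} {..<k} c \<Longrightarrow> i < m \<Longrightarrow> i' < m \<Longrightarrow> j < k \<Longrightarrow> j' < k \<Longrightarrow>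
    c i j \<le> c i j' + c i' j' + c i' j"
  by (auto simp: uftra_metric_def)

text \<open>The program chooses a star of least average cost, whereas the invariant speaks of
  budgets growing with time. The two agree if the event is dated at the ratio \<open>t\<close> of
  the best star: at that time no site is overbid, and the bids for \<open>bi\<close> just reach its
  residual cost.\<close>

lemma jms_step:
  assumes metric: "uftra_metric {..<m} {..<k} c"
    and c: "\<And>i j. i < m \<Longrightarrow> j < k \<Longrightarrow> 0 \<le> c i j" and f: "\<And>i. i < m \<Longrightarrow> 0 \<le> f i"
    and inv: "jms_inv m k c f D sg g n \<alpha> e X \<tau> Op"
    and b: "bi < m" "bj < k" "D bj < 0"
    and best: "\<And>i j. i < m \<Longrightarrow> j < k \<Longrightarrow> D j < 0 \<Longrightarrow> star_ratio k c D g bi bj \<le> star_ratio k c D g i j"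
    and D': "\<And>j. j < k \<Longrightarrow> D' j = connect c bi bj D j"
    and sg': "\<And>j. j < k \<Longrightarrow> sg' j = (if (D j < 0 \<and> c bi j \<le> c bi bj) \<or> c bi j < D j then bi else sg j)"
    and g': "\<And>i. i < m \<Longrightarrow> g' i = (if i = bi then 0 else g i)"
  shows "\<exists>\<alpha> e X t Op. jms_inv m k c f D' sg' g' (Suc n) \<alpha> e X t Op"
proof -
  define t where "t = star_ratio k c D g bi bj"
  define S where "S = star k c D bi bj"
  define U where "U = {j. j < k \<and> D j < 0}"
  define N where "N = {j. j < k \<and> 0 \<le> D j}"
  interpret I: jms_inv m k c f D sg g n \<alpha> e X \<tau> Op by (rule inv)
  note Op = I.Op and tau0 = I.t_nonneg and gi = I.g and sg = I.sg_Op I.D_sg and off = I.offer_le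
    and acc = I.balance[folded N_def]
    and al = I.alpha_nonneg I.alpha_le_t I.e_less I.D_le_alpha
  have fin: "finite S" "finite U" "finite N" by (simp_all add: S_def star_def U_def N_def)
  have SU: "S \<subseteq> U" "bj \<in> S" using b by (auto simp: S_def star_def U_def)
  have cardS: "card S > 0" using SU fin by (auto simp: card_gt_0_iff)
  have tS: "t * real (card S) = g bi - saving k c D bi + sum (c bi) S"
    using cardS by (simp add: t_def star_ratio_def S_def[symmetric])
  have F1: "offer k c D t i \<le> g i" if "i < m" for i
  proof (rule offer_le_of_star_ratio[where k = k and i = i])
    show "t \<le> star_ratio k c D g i j" if "j < k" "D j < 0" for j
      unfolding t_def using best \<open>i < m\<close> that by blast
  qed (use that off c in blast)+
  have offU: "offer k c D t' i = (\<Sum>j\<in>U. max (t' - c i j) 0) + saving k c D i" if "i < m" for t' i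
    unfolding U_def by (rule offer_eq) (use c that in blast)
  have U_eq: "(\<Sum>j\<in>U. max (t' - c i j) 0) = (\<Sum>j\<in>S. max (t' - c i j) 0) + (\<Sum>j\<in>U - S. max (t' - c i j) 0)" for t' i
    using sum.subset_diff[OF SU(1) fin(2)] by (simp add: add.commute)
  \<comment> \<open>Time does not run backwards: at \<open>\<tau>\<close> the bids of
    \<open>S\<close> were at most the residual cost less the saving, while at \<open>t\<close> they
    sum up to it.\<close>
  have tau_t: "\<tau> \<le> t"
  proof -
    have "(\<Sum>j\<in>S. \<tau> - c bi j) \<le> (\<Sum>j\<in>S. max (\<tau> - c bi j) 0)" by (intro sum_mono) auto
    also have "\<dots> \<le> (\<Sum>j\<in>U. max (\<tau> - c bi j) 0)" unfolding U_eq by (simp add: sum_nonneg)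
    also have "\<dots> \<le> g bi - saving k c D bi" using off[OF b(1)] offU[OF b(1)] by simp
    finally have "\<tau> * real (card S) \<le> t * real (card S)" using tS by (simp add: sum_subtractf mult.commute)
    then show ?thesis using cardS by simp
  qed
  have t0: "0 \<le> t" using tau0 tau_t by simp
  \<comment> \<open>The signed bids of \<open>S\<close> already pay the residual cost and the
    positive parts of all bids do not exceed it. So no member of \<open>S\<close> bids a negative
    amount and nobody outside bids a positive one, whence \<open>S_le\<close> and
    \<open>U_ge\<close>.\<close>
  have F2: "(\<Sum>j\<in>S. max (t - c bi j) 0 - (t - c bi j)) + (\<Sum>j\<in>U - S. max (t - c bi j) 0) \<le> 0"
  proof -
    have "(\<Sum>j\<in>S. max (t - c bi j) 0) + (\<Sum>j\<in>U - S. max (t - c bi j) 0) \<le> g bi - saving k c D bi"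
      using F1[OF b(1)] offU[OF b(1)] U_eq by simp
    also have "\<dots> = (\<Sum>j\<in>S. t - c bi j)" using tS by (simp add: sum_subtractf mult.commute)
    finally show ?thesis by (simp add: sum_subtractf)
  qed
  have S_le: "c bi j \<le> t" if "j \<in> S" for j
  proof -
    have "0 \<le> (\<Sum>j\<in>U - S. max (t - c bi j) 0)" by (intro sum_nonneg) auto
    then have "(\<Sum>j\<in>S. max (t - c bi j) 0 - (t - c bi j)) \<le> 0" using F2 by linarith
    then have "(\<Sum>j\<in>S. max (t - c bi j) 0 - (t - c bi j)) = 0" by (intro antisym sum_nonneg) auto
    then have "max (t - c bi j) 0 - (t - c bi j) = 0" using that fin by (subst (asm) sum_nonneg_eq_0_iff) auto
    then show ?thesis by simp
  qed
  have U_ge: "t \<le> c bi j" if "j \<in> U - S" for j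
  proof -
    have "0 \<le> (\<Sum>j\<in>S. max (t - c bi j) 0 - (t - c bi j))" by (intro sum_nonneg) auto
    then have "(\<Sum>j\<in>U - S. max (t - c bi j) 0) \<le> 0" using F2 by linarith
    then have "(\<Sum>j\<in>U - S. max (t - c bi j) 0) = 0" by (intro antisym sum_nonneg) auto
    then have "max (t - c bi j) 0 = 0" using that fin by (subst (asm) sum_nonneg_eq_0_iff) auto
    then show ?thesis by simp
  qed
  have cases: "j \<in> S \<or> j \<in> U - S \<or> j \<in> N" if "j < k" for j using that by (auto simp: U_def N_def)
  have D'S: "D' j = c bi j" "sg' j = bi" "D j < 0" "j < k" "0 \<le> D' j" if "j \<in> S" for j
    using that D'[of j] sg'[of j] c[of bi j] b by (auto simp: S_def star_def connect_def)
  have D'U: "D' j = D j" "D j < 0" "j < k" if "j \<in> U - S" for j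
    using that D'[of j] by (auto simp: S_def star_def connect_def U_def)
  have D'N: "D' j = min (D j) (c bi j)" "0 \<le> D j" "j < k" "0 \<le> D' j" "sg' j = (if c bi j < D j then bi else sg j)" if "j \<in> N" for j
    using that D'[of j] sg'[of j] c[of bi j] b by (auto simp: connect_def N_def)
  have N': "{j. j < k \<and> 0 \<le> D' j} = N \<union> S"
  proof (intro set_eqI iffI)
    fix j assume "j \<in> {j. j < k \<and> 0 \<le> D' j}"
    then have "j < k" "0 \<le> D' j" by auto
    then show "j \<in> N \<union> S" using cases[of j] D'U(1,2)[of j] by auto
  next
    fix j assume "j \<in> N \<union> S"
    then show "j \<in> {j. j < k \<and> 0 \<le> D' j}" using D'S(4,5)[of j] D'N(3,4)[of j] by auto
  qed
  have disj: "N \<inter> S = {}" using SU by (auto simp: N_def U_def)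
  have notS: "j \<notin> S" if "0 \<le> D j" for j using that by (auto simp: S_def star_def)
  have old: "0 \<le> D j" if "j < k" "0 \<le> D' j" "j \<notin> S" for j
    using that cases[of j] D'U(1,2)[of j] D'N(2)[of j] by auto
  have D'_le: "D' j \<le> D j" if "j < k" "0 \<le> D j" for j using D'N[of j] that by (simp add: N_def)
  have D'_le_t: "D' j \<le> t" if "j \<in> S" for j using D'S S_le that by simp
  define \<alpha>' where "\<alpha>' j = (if j \<in> S then t else \<alpha> j)" for j
  define e' where "e' j = (if j \<in> S then n else e j)" for j
  define X' where "X' j l = (if l \<in> S then D j else X j l)" for j l
  define Op' where "Op' = insert bi Op"
  have eS: "e' j = n" "\<alpha>' j = t" "X' l j = D l" if "j \<in> S" for j l
    using that by (auto simp: e'_def \<alpha>'_def X'_def)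
  have eN: "e' j = e j" "\<alpha>' j = \<alpha> j" "X' l j = X l j" if "j \<notin> S" for j l
    using that by (auto simp: e'_def \<alpha>'_def X'_def)
  \<comment> \<open>The new event has the largest index, so a client with a strictly smaller one was
    connected before.\<close>
  have first_old: "j \<notin> S" "0 \<le> D j" if "j < k" "0 \<le> D' j" "l < k" "0 \<le> D' l" "e' j < e' l" for j l
  proof -
    have "e' l \<le> n" using that(3,4) old[OF that(3,4)] al(3)[of l] eS(1)[of l] eN(1)[of l] by (cases "l \<in> S") auto
    then show "j \<notin> S" using that(5) eS(1)[of j] by auto
    then show "0 \<le> D j" using old that by auto
  qed
  have "jms_inv m k c f D' sg' g' (Suc n) \<alpha>' e' X' t Op'"
  proof
    show "Op' \<subseteq> {..<m}" using Op b by (auto simp: Op'_def)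
    show "0 \<le> t" by (rule t0)
    show "g' i = (if i \<in> Op' then 0 else f i)" if "i < m" for i
      using that by (auto simp: g' gi Op'_def)
  next
    fix j assume j: "j < k" "0 \<le> D' j"
    have "sg' j \<in> Op' \<and> D' j = c (sg' j) j"
    proof (cases "j \<in> S")
      case True
      show ?thesis unfolding D'S(1)[OF True] D'S(2)[OF True] by (simp add: Op'_def)
    next
      case False
      then have o: "0 \<le> D j" and jN: "j \<in> N" using j old by (auto simp: N_def)
      show ?thesis
      proof (cases "c bi j < D j")
        case True
        then show ?thesis using D'N(1,5)[OF jN] by (simp add: Op'_def)
      next
        case F: False
        then have "D' j = D j" "sg' j = sg j" using D'N(1,5)[OF jN] by auto
        then show ?thesis using sg[OF j(1) o] by (metis Op'_def insertI2)
      qed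
    qed
    then show "sg' j \<in> Op'" "D' j = c (sg' j) j" by blast+
    show "0 \<le> \<alpha>' j" using j old[of j] t0 al(1)[of j] by (auto simp: \<alpha>'_def)
    show "\<alpha>' j \<le> t" using j old[of j] al(2)[of j] tau_t by (auto simp: \<alpha>'_def)
    show "e' j < Suc n" using j old[of j] al(3)[of j] by (auto simp: e'_def)
    show "D' j \<le> \<alpha>' j" using j old[of j] al(4)[of j] D'_le_t[of j] D'_le[of j] by (auto simp: \<alpha>'_def)
  next
    fix i assume i: "i < m"
    show "offer k c D' t i \<le> g' i"
    proof (cases "i = bi")
      case True
      have "(if D' j < 0 then max (t - c bi j) 0 else max (D' j - c bi j) 0) = 0" if "j < k" for j
        using cases[OF that] D'S(1,5)[of j] D'U[of j] D'N(1,4)[of j] U_ge[of j] by (auto simp: max_def)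
      then have "offer k c D' t bi = 0" by (simp add: offer_def)
      then show ?thesis using True g'[OF i] by simp
    next
      case False
      have "offer k c D' t i \<le> offer k c D t i" unfolding offer_def
      proof (intro sum_mono)
        fix j assume "j \<in> {..<k}"
        then have j: "j < k" by simp
        consider "j \<in> S" | "j \<in> U - S" | "j \<in> N" using cases[OF j] by blast
        then show "(if D' j < 0 then max (t - c i j) 0 else max (D' j - c i j) 0)
            \<le> (if D j < 0 then max (t - c i j) 0 else max (D j - c i j) 0)"
        proof cases
          case 1 then show ?thesis using D'S(3,5)[of j] D'_le_t[of j] by auto
        next
          case 2 then show ?thesis using D'U[of j] by auto
        next
          case 3 then show ?thesis using D'N(2,4)[of j] D'_le[OF j] by auto
        qed
      qed
      then show ?thesis using F1[OF i] g'[OF i] False by simp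
    qed
  next
    \<comment> \<open>The new budgets pay the residual cost less the saving, plus the new
      connections. The saving is exactly the drop in the connection costs of the old clients, so the
      balance is preserved.\<close>
    have savN: "saving k c D bi = (\<Sum>j\<in>N. D j - D' j)"
    proof -
      have "saving k c D bi = (\<Sum>j\<in>N. max (D j - c bi j) 0)" unfolding saving_def
      proof (intro sum.mono_neutral_right)
        show "\<forall>j\<in>{..<k} - N. max (D j - c bi j) 0 = 0"
        proof
          fix j assume "j \<in> {..<k} - N"
          then have "j < k" "D j < 0" by (auto simp: N_def)
          then show "max (D j - c bi j) 0 = 0" using c[OF b(1), of j] by simp
        qed
      qed (auto simp: N_def)
      also have "\<dots> = (\<Sum>j\<in>N. D j - D' j)" by (intro sum.cong) (auto simp: D'N)
      finally show ?thesis .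
    qed
    have "(\<Sum>j\<in>N \<union> S. \<alpha>' j) = (\<Sum>j\<in>N. \<alpha>' j) + (\<Sum>j\<in>S. \<alpha>' j)"
      using disj fin by (subst sum.union_disjoint) auto
    also have "(\<Sum>j\<in>N. \<alpha>' j) = (\<Sum>j\<in>N. \<alpha> j)" using disj by (intro sum.cong) (auto simp: \<alpha>'_def)
    also have "(\<Sum>j\<in>S. \<alpha>' j) = t * real (card S)" by (simp add: \<alpha>'_def)
    also have "(\<Sum>j\<in>N. \<alpha> j) + t * real (card S) = sum f Op + g bi + (\<Sum>j\<in>N. D' j) + (\<Sum>j\<in>S. c bi j)"
      using acc tS savN by (simp add: sum_subtractf)
    also have "sum f Op + g bi = sum f Op'"
      using gi[OF b(1)] Op finite_subset[OF Op] by (auto simp: Op'_def insert_absorb)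
    also have "(\<Sum>j\<in>S. c bi j) = (\<Sum>j\<in>S. D' j)" by (intro sum.cong) (auto simp: D'S)
    also have "sum f Op' + (\<Sum>j\<in>N. D' j) + (\<Sum>j\<in>S. D' j) = sum f Op' + (\<Sum>j\<in>N \<union> S. D' j)"
      using disj fin by (subst sum.union_disjoint) auto
    finally show "(\<Sum>j | j < k \<and> 0 \<le> D' j. \<alpha>' j) = sum f Op' + (\<Sum>j | j < k \<and> 0 \<le> D' j. D' j)"
      unfolding N' .
  next
    fix j l assume j: "j < k" and l: "l < k" and Dj: "0 \<le> D' j" and Dl: "0 \<le> D' l" and le: "e' j \<le> e' l"
    show "\<alpha>' j \<le> \<alpha>' l"
    proof (cases "l \<in> S")
      case True
      then show ?thesis using old[OF j Dj] al(2)[OF j] tau_t by (cases "j \<in> S") (auto simp: \<alpha>'_def)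
    next
      case False
      then have "e' l < n" using old[OF l Dl] al(3)[OF l] by (simp add: e'_def)
      then have "j \<notin> S" using le by (auto simp: e'_def)
      then show ?thesis using False old[OF j Dj] old[OF l Dl] I.alpha_mono[OF j l] le by (simp add: \<alpha>'_def e'_def)
    qed
  next
    fix j l assume j: "j < k" and l: "l < k" and Dj: "0 \<le> D' j" and Dl: "0 \<le> D' l" and lt: "e' j < e' l"
    note o = first_old[OF j Dj l Dl lt]
    show "X' j l \<le> \<alpha>' j"
    proof (cases "l \<in> S")
      case True then show ?thesis using al(4)[OF j o(2)] eS(3) eN(2)[OF o(1)] by simp
    next
      case False
      then show ?thesis using I.X_le_alpha[OF j l o(2) old[OF l Dl False]] lt eN[OF o(1)] eN[OF False] by simp
    qed
    show "D' j \<le> X' j l"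
    proof (cases "l \<in> S")
      case True then show ?thesis using D'_le[OF j o(2)] eS(3) by simp
    next
      case False
      then show ?thesis using I.D_le_X[OF j l o(2) old[OF l Dl False]] lt eN[OF o(1)] eN[OF False] D'_le[OF j o(2)] by simp
    qed
    fix i assume i: "i < m"
    show "\<alpha>' l \<le> X' j l + c i j + c i l"
    proof (cases "l \<in> S")
      case False
      then show ?thesis using I.alpha_le_X[OF j l o(2) old[OF l Dl False] _ i] lt eN[OF o(1)] eN[OF False] by simp
    next
      case True
      \<comment> \<open>The site currently serving \<open>j\<close> is open and has residual cost 0,
        so the still unconnected \<open>l\<close> cannot bid for it: \<open>t\<close> is at most its
        distance from \<open>l\<close>. The metric inequality then bounds that distance by a detour
        through \<open>j\<close> and \<open>i\<close>.\<close>
      have s: "sg j \<in> Op" "D j = c (sg j) j" using sg j o by auto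
      have sm: "sg j < m" using s Op by auto
      have "max (t - c (sg j) l) 0 = (if D l < 0 then max (t - c (sg j) l) 0 else max (D l - c (sg j) l) 0)"
        using D'S(3)[OF True] by simp
      also have "\<dots> \<le> offer k c D t (sg j)" unfolding offer_def
        using l by (intro member_le_sum) auto
      also have "\<dots> \<le> 0" using F1[OF sm] gi[OF sm] s by simp
      finally have "t \<le> c (sg j) l" by simp
      also have "\<dots> \<le> c (sg j) j + c i j + c i l"
        using uftra_metricD[OF metric sm i l j] by simp
      finally show ?thesis using True s eS by simp
    qed
  next
    fix j l l' assume j: "j < k" and l: "l < k" and l': "l' < k" and Dj: "0 \<le> D' j" and Dl: "0 \<le> D' l"
      and Dl': "0 \<le> D' l'" and lt: "e' j < e' l" and le: "e' l \<le> e' l'"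
    note o = first_old[OF j Dj l Dl lt]
    show "X' j l' \<le> X' j l"
    proof (cases "l' \<in> S")
      case True
      show ?thesis
      proof (cases "l \<in> S")
        case False
        then show ?thesis using True I.D_le_X[OF j l o(2) old[OF l Dl False]] lt eN[OF o(1)] eN[OF False] eS(3) by simp
      qed (use True eS(3) in simp)
    next
      case False
      then have "e' l' < n" using old[OF l' Dl'] al(3)[OF l'] by (simp add: e'_def)
      then have ls: "l \<notin> S" using le by (auto simp: e'_def)
      show ?thesis
        using I.X_antimono[OF j l l' o(2) old[OF l Dl ls] old[OF l' Dl' False]] lt le
          eN[OF o(1)] eN[OF False] eN[OF ls] by simp
    qed
  next
    fix l i assume l: "l < k" and i: "i < m" and Dl: "0 \<le> D' l"
    show "(\<Sum>j<k. if 0 \<le> D' j \<and> e' j < e' l then max (X' j l - c i j) 0 else max (\<alpha>' l - c i j) 0) \<le> f i"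
    proof (cases "l \<in> S")
      case True
      have "(\<Sum>j<k. if 0 \<le> D' j \<and> e' j < e' l then max (X' j l - c i j) 0 else max (\<alpha>' l - c i j) 0)
         = offer k c D t i" unfolding offer_def
      proof (intro sum.cong refl)
        fix j assume "j \<in> {..<k}"
        then have j: "j < k" by simp
        have "(0 \<le> D' j \<and> e' j < e' l) \<longleftrightarrow> \<not> D j < 0"
        proof
          assume a: "0 \<le> D' j \<and> e' j < e' l"
          then show "\<not> D j < 0" using first_old[OF j _ l Dl] by simp
        next
          assume a: "\<not> D j < 0"
          then have "j \<in> N" "j \<notin> S" using j notS[of j] by (auto simp: N_def)
          then show "0 \<le> D' j \<and> e' j < e' l"
            using D'N(4)[of j] eS(1)[OF True] eN(1)[of j] al(3)[OF j] a by simp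
        qed
        then show "(if 0 \<le> D' j \<and> e' j < e' l then max (X' j l - c i j) 0 else max (\<alpha>' l - c i j) 0)
          = (if D j < 0 then max (t - c i j) 0 else max (D j - c i j) 0)"
          using eS[OF True] by simp
      qed
      also have "\<dots> \<le> f i" using F1[OF i] gi[OF i] f[OF i] by (auto split: if_splits)
      finally show ?thesis .
    next
      case False
      have l0: "0 \<le> D l" using old[OF l Dl False] .
      have "(\<Sum>j<k. if 0 \<le> D' j \<and> e' j < e' l then max (X' j l - c i j) 0 else max (\<alpha>' l - c i j) 0)
         = (\<Sum>j<k. if 0 \<le> D j \<and> e j < e l then max (X j l - c i j) 0 else max (\<alpha> l - c i j) 0)"
      proof (intro sum.cong refl)
        fix j assume "j \<in> {..<k}"
        then have j: "j < k" by simp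
        have "(0 \<le> D' j \<and> e' j < e' l) \<longleftrightarrow> (0 \<le> D j \<and> e j < e l)"
        proof
          assume a: "0 \<le> D' j \<and> e' j < e' l"
          then show "0 \<le> D j \<and> e j < e l" using first_old[OF j _ l Dl] eN(1)[OF False] eN(1)[of j] by auto
        next
          assume a: "0 \<le> D j \<and> e j < e l"
          then have "j \<in> N" "j \<notin> S" using j notS[of j] by (auto simp: N_def)
          then show "0 \<le> D' j \<and> e' j < e' l"
            using D'N(4)[of j] eN(1)[OF False] eN(1)[of j] a by simp
        qed
        then show "(if 0 \<le> D' j \<and> e' j < e' l then max (X' j l - c i j) 0 else max (\<alpha>' l - c i j) 0)
          = (if 0 \<le> D j \<and> e j < e l then max (X j l - c i j) 0 else max (\<alpha> l - c i j) 0)"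
          using eN[OF False] by simp
      qed
      then show ?thesis using I.budget[OF l i l0] by simp
    qed
  qed
  then show ?thesis by blast
qed

text \<open>Ordered by connection events, the clients of \<open>A\<close> give a feasible point of
  the factor-revealing program of site \<open>i\<close>: the recorded costs \<open>X\<close> say
  what earlier clients were still willing to bid, and \<open>budget\<close> bounds all bids by the
  opening cost.\<close>

lemma jms_star_bound:
  fixes c :: "nat \<Rightarrow> nat \<Rightarrow> real"
  assumes inv: "jms_inv m k c f D sg g n \<alpha> e X t Op"
    and conn: "\<And>j. j < k \<Longrightarrow> 0 \<le> D j"
    and c: "\<And>j. j < k \<Longrightarrow> 0 \<le> c i j" and f: "0 \<le> f i" and i: "i < m"
    and A: "A \<subseteq> {..<k}"
  shows "sum \<alpha> A \<le> 1.112 * f i + 1.7776 * sum (c i) A"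
proof -
  interpret jms_inv m k c f D sg g n \<alpha> e X t Op by (rule inv)
  define L where "L = sort_key e (sorted_list_of_set A)"
  have finA: "finite A" using A finite_subset by blast
  have L: "distinct L" "set L = A" "length L = card A" "sorted (map e L)"
    using finA by (simp_all add: L_def)
  define N where "N = card A"
  define al where "al h = \<alpha> (L ! h)" for h
  define d where "d h = c i (L ! h)" for h
  \<comment> \<open>The inserted 0 keeps \<open>s\<close> nonnegative and makes the maximum
    meaningful for an empty suffix as well.\<close>
  define s where "s h = Max (insert 0 ((\<lambda>l. al l - d l) ` {h..<N}))" for h
  have bij: "bij_betw (\<lambda>h. L ! h) {..<N} A"
    using L by (intro bij_betw_nth) (auto simp: N_def)
  have reindex: "sum F A = (\<Sum>h<N. F (L ! h))" for F :: "nat \<Rightarrow> real"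
    using sum.reindex_bij_betw[OF bij, of F] by simp
  have lt: "L ! h < k" if "h < N" for h
  proof -
    have "L ! h \<in> set L" using that L(3) by (intro nth_mem) (simp add: N_def)
    then show ?thesis using L(2) A by auto
  qed
  have e_le: "e (L ! h) \<le> e (L ! l)" if "h \<le> l" "l < N" for h l
    using sorted_nth_mono[OF L(4), of h l] that L(3) by (simp add: N_def)
  have con: "0 \<le> D (L ! h)" if "h < N" for h using conn[OF lt[OF that]] .
  \<comment> \<open>Clients connected by the same event appear in arbitrary order after sorting, so
    they must be interchangeable as far as budgets are concerned.\<close>
  have tie: "al l = al h" if "h < N" "l < N" "e (L ! l) = e (L ! h)" for h l
    using alpha_mono[OF lt[OF that(1)] lt[OF that(2)] con[OF that(1)] con[OF that(2)]]
      alpha_mono[OF lt[OF that(2)] lt[OF that(1)] con[OF that(2)] con[OF that(1)]] that(3)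
    by (simp add: al_def)
  have s_ge: "al l - d l \<le> s h" if "h \<le> l" "l < N" for h l
    unfolding s_def using that by (intro Max_ge) auto
  have s_cases: "s h = 0 \<or> (\<exists>l. h \<le> l \<and> l < N \<and> s h = al l - d l)" for h
    using Max_in[of "insert 0 ((\<lambda>l. al l - d l) ` {h..<N})"] by (auto simp: s_def)
  have s_bound: "s h \<le> y" if "0 \<le> y" "\<And>l. h \<le> l \<Longrightarrow> l < N \<Longrightarrow> al l - d l \<le> y" for h y
    using s_cases[of h] that by auto
  have d0: "0 \<le> d h" if "h < N" for h unfolding d_def by (rule c[OF lt[OF that]])
  have al_le: "al l \<le> al p + d p + d l" if "p < N" "l < N" "e (L ! p) \<le> e (L ! l)" for p l
  proof (cases "e (L ! p) = e (L ! l)")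
    case True then show ?thesis using tie[of p l] that d0[of p] d0[of l] by simp
  next
    case False
    then have lt': "e (L ! p) < e (L ! l)" using that by simp
    show ?thesis
      using alpha_le_X[OF lt[OF that(1)] lt[OF that(2)] con[OF that(1)] con[OF that(2)] lt' i]
        X_le_alpha[OF lt[OF that(1)] lt[OF that(2)] con[OF that(1)] con[OF that(2)] lt']
      by (simp add: al_def d_def)
  qed
  have "(\<Sum>h<N. al h) \<le> 1.112 * f i + 1.7776 * (\<Sum>h<N. d h)"
  proof (rule factor_revealing_bound[where s = s])
    show "0 \<le> f i" by (rule f)
    show "0 \<le> s h" for h unfolding s_def by (intro Max_ge) auto
    show "s l \<le> s h" if "h \<le> l" "l < N" for h l
      unfolding s_def using that by (intro Max_mono) auto
    fix h assume h: "h < N"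
    show "0 \<le> d h" by (rule d0[OF h])
    show "al h \<le> s h + d h" using s_ge[of h h] h by simp
    show "s h \<le> al h + d h"
    proof (rule s_bound)
      show "0 \<le> al h + d h" using alpha_nonneg[OF lt[OF h] con[OF h]] d0[OF h] by (simp add: al_def)
      show "al l - d l \<le> al h + d h" if "h \<le> l" "l < N" for l
        using al_le[OF h that(2) e_le[OF that]] by simp
    qed
    define F where "F j = (if 0 \<le> D j \<and> e j < e (L ! h) then max (X j (L ! h) - c i j) 0
        else max (\<alpha> (L ! h) - c i j) 0)" for j
    \<comment> \<open>If \<open>p\<close> was connected strictly before \<open>h\<close>, its bid
      comes from \<open>X\<close> at the event of \<open>h\<close>, and by antimonotonicity of
      \<open>X\<close> this bid handles every later \<open>l\<close> in the maximum. If both belong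
      to the same event, \<open>p\<close> still bids with the budget of \<open>h\<close>, and
      \<open>al_le\<close> takes the place of \<open>X\<close>.\<close>
    have before: "max (s h - 2 * d p) 0 \<le> F (L ! p)" if p: "p < h" for p
    proof -
      have pN: "p < N" using p h by simp
      have F0: "0 \<le> F (L ! p)" by (simp add: F_def)
      have "s h \<le> F (L ! p) + 2 * d p"
      proof (rule s_bound)
        show "0 \<le> F (L ! p) + 2 * d p" using F0 d0[OF pN] by simp
        fix l assume l: "h \<le> l" "l < N"
        show "al l - d l \<le> F (L ! p) + 2 * d p"
        proof (cases "e (L ! p) < e (L ! h)")
          case True
          have el: "e (L ! h) \<le> e (L ! l)" using e_le l by simp
          have "al l \<le> X (L ! p) (L ! l) + d p + d l"
            using alpha_le_X[OF lt[OF pN] lt[OF l(2)] con[OF pN] con[OF l(2)] _ i] True el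
            by (simp add: al_def d_def)
          also have "X (L ! p) (L ! l) \<le> X (L ! p) (L ! h)"
            using X_antimono[OF lt[OF pN] lt[OF h] lt[OF l(2)] con[OF pN] con[OF h] con[OF l(2)] True el] .
          also have "X (L ! p) (L ! h) \<le> F (L ! p) + d p"
            using True con[OF pN] by (simp add: F_def d_def)
          finally show ?thesis by simp
        next
          case False
          then have "e (L ! p) = e (L ! h)" using e_le[of p h] p h by simp
          then have "al p = al h" using tie[OF h pN] by simp
          moreover have "al l \<le> al p + d p + d l" using al_le[OF pN l(2)] e_le[of p l] p l by simp
          moreover have "al h - d p \<le> F (L ! p)" using False by (simp add: F_def d_def al_def)
          ultimately show ?thesis by simp
        qed
      qed
      then show ?thesis using F0 by simp
    qed
    have after: "max (al h - d p) 0 \<le> F (L ! p)" if "h \<le> p" "p < N" for p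
      using e_le[OF that] by (simp add: F_def al_def d_def)
    have "(\<Sum>p<h. max (s h - 2 * d p) 0) + (\<Sum>p\<in>{h..<N}. max (al h - d p) 0)
      \<le> (\<Sum>p<h. F (L ! p)) + (\<Sum>p\<in>{h..<N}. F (L ! p))"
      using before after by (intro add_mono sum_mono) auto
    also have "\<dots> = (\<Sum>p<N. F (L ! p))" using h by (subst sum_lessThan_split[of h N]) auto
    also have "\<dots> = sum F A" by (simp add: reindex)
    also have "\<dots> \<le> (\<Sum>j<k. F j)" using A by (intro sum_mono2) (auto simp: F_def)
    also have "\<dots> \<le> f i" unfolding F_def using budget[OF lt[OF h] i con[OF h]] .
    finally show "(\<Sum>p<h. max (s h - 2 * d p) 0) + (\<Sum>p\<in>{h..<N}. max (al h - d p) 0) \<le> f i" .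
  qed
  then show ?thesis by (simp add: reindex al_def d_def)
qed

lemma sum_threshold:
  fixes w :: real
  assumes "x \<le> y"
  shows "(\<Sum>v<(y::nat). if v < x then w else 0) = real x * w"
proof -
  have "(\<Sum>v<y. if v < x then w else 0) = (\<Sum>v<x. w)"
    using assms by (intro sum.mono_neutral_cong_right) auto
  then show ?thesis by simp
qed

text \<open>A solution is split into unit stars: copy \<open>v\<close> of site \<open>i\<close> serves the clients \<open>j\<close> with
  \<open>v < x i j\<close>.\<close>

lemma sum_copies:
  fixes w :: "nat \<Rightarrow> real"
  assumes "\<And>j. j < k \<Longrightarrow> x j \<le> (y::nat)"
  shows "(\<Sum>v<y. sum w {j. j < k \<and> v < x j}) = (\<Sum>j<k. real (x j) * w j)"
proof -
  have "(\<Sum>v<y. sum w {j. j < k \<and> v < x j}) = (\<Sum>v<y. \<Sum>j<k. if v < x j then w j else 0)"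
    by (intro sum.cong refl sum.mono_neutral_cong_left) auto
  also have "\<dots> = (\<Sum>j<k. \<Sum>v<y. if v < x j then w j else 0)" by (rule sum.swap)
  also have "\<dots> = (\<Sum>j<k. real (x j) * w j)" using assms by (intro sum.cong refl sum_threshold) auto
  finally show ?thesis .
qed

text \<open>This is weak duality: by \<open>balance\<close> the budgets pay the computed unit
  solution, a feasible solution serves each client at least \<open>r\<close> times, and the star
  bound applies to each copy of each opened site.\<close>

lemma jms_bound:
  fixes c :: "nat \<Rightarrow> nat \<Rightarrow> real"
  assumes inv: "jms_inv m k c f D sg g n \<alpha> e X t Op"
    and conn: "\<And>j. j < k \<Longrightarrow> 0 \<le> D j"
    and c: "\<And>i j. i < m \<Longrightarrow> j < k \<Longrightarrow> 0 \<le> c i j" and f: "\<And>i. i < m \<Longrightarrow> 0 \<le> f i"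
    and feas: "uftra_feasible {..<m} {..<k} (\<lambda>_. r) y x"
  shows "real r * (sum f Op + (\<Sum>j<k. D j))
    \<le> 1.112 * (\<Sum>i<m. f i * real (y i)) + 1.7776 * (\<Sum>i<m. \<Sum>j<k. c i j * real (x i j))"
proof -
  interpret jms_inv m k c f D sg g n \<alpha> e X t Op by (rule inv)
  have "{j. j < k \<and> 0 \<le> D j} = {..<k}" using conn by auto
  then have "real r * (sum f Op + (\<Sum>j<k. D j)) = (\<Sum>j<k. real r * \<alpha> j)"
    using balance by (simp add: sum_distrib_left[symmetric])
  also have "\<dots> \<le> (\<Sum>j<k. real (\<Sum>i<m. x i j) * \<alpha> j)"
    using feas alpha_nonneg conn by (intro sum_mono mult_right_mono) (auto simp: uftra_feasible_def simp del: of_nat_sum)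
  also have "\<dots> = (\<Sum>i<m. \<Sum>j<k. real (x i j) * \<alpha> j)"
    unfolding of_nat_sum sum_distrib_right by (rule sum.swap)
  also have "\<dots> \<le> (\<Sum>i<m. 1.112 * (f i * real (y i)) + 1.7776 * (\<Sum>j<k. c i j * real (x i j)))"
  proof (intro sum_mono)
    fix i assume "i \<in> {..<m}"
    then have i: "i < m" by simp
    have xy: "x i j \<le> y i" if "j < k" for j using feas i that by (simp add: uftra_feasible_def)
    have sc: "(\<Sum>v<y i. sum w {j. j < k \<and> v < x i j}) = (\<Sum>j<k. real (x i j) * w j)" for w
      using xy by (intro sum_copies)
    have "(\<Sum>j<k. real (x i j) * \<alpha> j) = (\<Sum>v<y i. sum \<alpha> {j. j < k \<and> v < x i j})"
      by (simp only: sc)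
    also have "\<dots> \<le> (\<Sum>v<y i. 1.112 * f i + 1.7776 * sum (c i) {j. j < k \<and> v < x i j})"
    proof (intro sum_mono jms_star_bound[OF inv conn])
    qed (use i c f in auto)
    also have "\<dots> = real (y i) * (1.112 * f i) + 1.7776 * (\<Sum>j<k. real (x i j) * c i j)"
      by (simp only: sum.distrib sum_distrib_left[symmetric] sc sum_constant card_lessThan mult.left_commute)
    finally show "(\<Sum>j<k. real (x i j) * \<alpha> j) \<le> 1.112 * (f i * real (y i)) + 1.7776 * (\<Sum>j<k. c i j * real (x i j))"
      by (simp add: mult.commute mult.left_commute)
  qed
  also have "\<dots> = 1.112 * (\<Sum>i<m. f i * real (y i)) + 1.7776 * (\<Sum>i<m. \<Sum>j<k. c i j * real (x i j))"
    by (simp only: sum.distrib sum_distrib_left)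
  finally show ?thesis .
qed

section \<open>Greedy augmentation\<close>

text \<open>An upper bound on what the augmentation of a solution of connection cost \<open>z\<close> still leads to,
  compared with a solution of opening cost \<open>F\<close> and connection cost \<open>C\<close>. It is concave in \<open>z\<close>, with
  slope \<open>F / (z - C)\<close>, the reciprocal of the ratio of saving to cost which the best site attains.\<close>

definition aug_potential :: "real \<Rightarrow> real \<Rightarrow> real \<Rightarrow> real" where
  "aug_potential F C z = (if z - C \<le> F then z else F * ln ((z - C) / F) + F + C)"

text \<open>By concavity the potential falls over [z - s, z] at least with its slope at
  \<open>z\<close>. That slope is 1 or \<open>F / (z - C)\<close>, and in either case it is at least
  \<open>f / s\<close> by hypothesis. The proof separates whether the step stays in the linear part,
  enters it, or stays in the logarithmic part.\<close>

lemma aug_potential_step: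
  assumes F: "0 < F" and f: "0 \<le> f" "f < s" and ratio: "f * (z - C) \<le> s * F"
  shows "f + aug_potential F C (z - s) \<le> aug_potential F C z"
proof (cases "z - C \<le> F")
  case True then show ?thesis using f by (simp add: aug_potential_def)
next
  case False
  define u where "u = z - C"
  have u: "F < u" "0 < u" using False F by (auto simp: u_def)
  have fsu: "f \<le> s * F / u" using ratio u by (simp add: u_def pos_le_divide_eq)
  show ?thesis
  proof (cases "z - s - C \<le> F")
    case True
    have "1 - F / u \<le> ln (u / F)" using ln_le_minus_one[of "F / u"] F u by (simp add: ln_div)
    then have "F * (1 - F / u) \<le> F * ln (u / F)" using F by (intro mult_left_mono) auto
    moreover have "(u - F) * (1 - F / u) \<le> s * (1 - F / u)"
      using True u by (intro mult_right_mono) (auto simp: u_def)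
    moreover have "(u - F) * (1 - F / u) = u - F - F * (1 - F / u)" using u by (simp add: field_simps)
    moreover have "s * (1 - F / u) = s - s * F / u" by (simp add: algebra_simps)
    ultimately have "f + (z - s) \<le> F * ln (u / F) + F + C" using fsu unfolding u_def by linarith
    then show ?thesis using True False by (simp add: aug_potential_def u_def)
  next
    case F2: False
    have us: "u - s > 0" using F2 F by (simp add: u_def)
    have "1 - (u - s) / u \<le> ln (u / (u - s))" using ln_le_minus_one[of "(u - s) / u"] us u by (simp add: ln_div)
    then have "s / u \<le> ln (u / (u - s))" using u by (simp add: field_simps)
    then have "F * (s / u) \<le> F * ln (u / (u - s))" using F by (intro mult_left_mono) auto
    moreover have "ln (u / F) = ln ((u - s) / F) + ln (u / (u - s))" using us u F by (simp add: ln_div)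
    then have "F * ln (u / F) = F * ln ((u - s) / F) + F * ln (u / (u - s))" by (simp add: distrib_left)
    moreover have "s * F / u = F * (s / u)" by simp
    ultimately have "f + F * ln ((u - s) / F) \<le> F * ln (u / F)" using fsu by linarith
    moreover have "z - s - C = u - s" by (simp add: u_def)
    ultimately have "f + F * ln ((z - s - C) / F) \<le> F * ln ((z - C) / F)" by (simp only: u_def)
    then show ?thesis using False F2 by (simp add: aug_potential_def)
  qed
qed

text \<open>In the logarithmic part this is the tangent at \<open>z - C = 3/2 * F\<close>, with
  0.4056 as upper bound for \<open>ln (3/2)\<close>.\<close>

lemma aug_potential_le:
  assumes F: "0 < F"
  shows "aug_potential F C z \<le> 2/3 * z + 1/3 * C + 0.4056 * F"
proof (cases "z - C \<le> F")
  case True then show ?thesis using F by (simp add: aug_potential_def)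
next
  case False
  define u where "u = z - C"
  have u: "F < u" "0 < u" using False F by (auto simp: u_def)
  have "ln (u / F) = ln (2/3 * (u / F)) + ln (3/2)" using u F by (simp add: ln_div ln_mult)
  also have "\<dots> \<le> (2/3 * (u / F) - 1) + 0.4056"
    using u F by (intro add_mono ln_le_minus_one ln_bounds_numeric) simp
  finally have "F * ln (u / F) \<le> F * ((2/3 * (u / F) - 1) + 0.4056)" using F by (intro mult_left_mono) auto
  also have "\<dots> = 2/3 * u - F + 0.4056 * F" using F by (simp add: field_simps)
  finally show ?thesis using False by (simp add: aug_potential_def u_def field_simps)
qed

text \<open>\<open>F\<close> and \<open>C\<close> are costs per unit of requirement. They are only
  upper bounds, so \<open>F\<close> can be taken positive even if the solution opens free sites
  only.\<close>

definition benchmark where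
  "benchmark m k r f c F C \<longleftrightarrow> (\<exists>y x. uftra_feasible {..<m} {..<k} (\<lambda>_. r) y x \<and>
     (\<Sum>i<m. f i * real (y i)) \<le> real r * F \<and> (\<Sum>i<m. \<Sum>j<k. c i j * real (x i j)) \<le> real r * C)"

text \<open>The constants are 1.5176 = 1.112 + 0.4056 and 1.5184 = (2 * 1.7776 + 1) / 3.\<close>

definition aug_inv where
  "aug_inv m k r f c D sg Op \<longleftrightarrow> Op \<subseteq> {..<m} \<and> (\<forall>j<k. sg j \<in> Op \<and> D j = c (sg j) j) \<and>
     (\<forall>F C. 0 < F \<longrightarrow> benchmark m k r f c F C \<longrightarrow>
        sum f Op + aug_potential F C (\<Sum>j<k. D j) \<le> 1.5176 * F + 1.5184 * C)"

lemma aug_inv_init: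
  fixes c :: "nat \<Rightarrow> nat \<Rightarrow> real"
  assumes inv: "jms_inv m k c (\<lambda>i. 3/2 * f i) D sg g n \<alpha> e X t Op"
    and conn: "\<And>j. j < k \<Longrightarrow> 0 \<le> D j"
    and c: "\<And>i j. i < m \<Longrightarrow> j < k \<Longrightarrow> 0 \<le> c i j" and f: "\<And>i. i < m \<Longrightarrow> 0 \<le> f i"
    and r: "0 < r"
  shows "aug_inv m k r f c D sg Op"
proof -
  interpret jms_inv m k c "\<lambda>i. 3/2 * f i" D sg g n \<alpha> e X t Op by (rule inv)
  have "sum f Op + aug_potential F C (\<Sum>j<k. D j) \<le> 1.5176 * F + 1.5184 * C"
    if F: "0 < F" and bm: "benchmark m k r f c F C" for F C
  proof -
    obtain y x where feas: "uftra_feasible {..<m} {..<k} (\<lambda>_. r) y x"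
      and fF: "(\<Sum>i<m. f i * real (y i)) \<le> real r * F"
      and cC: "(\<Sum>i<m. \<Sum>j<k. c i j * real (x i j)) \<le> real r * C"
      using bm by (auto simp: benchmark_def)
    have "real r * ((\<Sum>i\<in>Op. 3/2 * f i) + (\<Sum>j<k. D j))
      \<le> 1.112 * (\<Sum>i<m. 3/2 * f i * real (y i)) + 1.7776 * (\<Sum>i<m. \<Sum>j<k. c i j * real (x i j))"
      by (rule jms_bound[OF inv conn c _ feas]) (use f in auto)
    also have "(\<Sum>i<m. 3/2 * f i * real (y i)) = 3/2 * (\<Sum>i<m. f i * real (y i))"
      unfolding sum_distrib_left by (simp add: mult.assoc)
    also have "1.112 * (3/2 * (\<Sum>i<m. f i * real (y i))) + 1.7776 * (\<Sum>i<m. \<Sum>j<k. c i j * real (x i j))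
       \<le> 1.112 * (3/2 * (real r * F)) + 1.7776 * (real r * C)"
      using fF cC by (intro add_mono mult_left_mono) auto
    also have "\<dots> = real r * (1.668 * F + 1.7776 * C)" by (simp add: algebra_simps)
    finally have "(\<Sum>i\<in>Op. 3/2 * f i) + (\<Sum>j<k. D j) \<le> 1.668 * F + 1.7776 * C"
      using r by (simp only: mult_le_cancel_left_pos of_nat_0_less_iff)
    then have "3/2 * sum f Op + (\<Sum>j<k. D j) \<le> 1.668 * F + 1.7776 * C" by (simp only: sum_distrib_left)
    moreover have "0 \<le> (\<Sum>i<m. \<Sum>j<k. c i j * real (x i j))"
      using c by (intro sum_nonneg mult_nonneg_nonneg) auto
    then have "0 \<le> real r * C" using cC by linarith
    then have "0 \<le> C" using r by (simp add: zero_le_mult_iff)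
    ultimately show ?thesis using aug_potential_le[OF F, of C "\<Sum>j<k. D j"] F by (simp add: field_simps)
  qed
  then show ?thesis unfolding aug_inv_def using Op sg_Op D_sg conn by blast
qed

text \<open>Each of the at least \<open>r\<close> connections of a client in the comparison solution
  can be charged to a copy of its site, and the saving of that site counts the positive part of the
  difference of distances.\<close>

lemma benchmark_saving:
  fixes c :: "nat \<Rightarrow> nat \<Rightarrow> real"
  assumes feas: "uftra_feasible {..<m} {..<k} (\<lambda>_. r) y x" and D: "\<And>j. j < k \<Longrightarrow> 0 \<le> D j"
  shows "real r * (\<Sum>j<k. D j) - (\<Sum>i<m. \<Sum>j<k. c i j * real (x i j)) \<le> (\<Sum>i<m. real (y i) * saving k c D i)"
proof -
  have "real r * (\<Sum>j<k. D j) \<le> (\<Sum>j<k. real (\<Sum>i<m. x i j) * D j)"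
    unfolding sum_distrib_left using feas D
    by (intro sum_mono mult_right_mono) (auto simp: uftra_feasible_def simp del: of_nat_sum)
  also have "\<dots> = (\<Sum>i<m. \<Sum>j<k. real (x i j) * D j)"
    unfolding of_nat_sum sum_distrib_right by (rule sum.swap)
  finally have "real r * (\<Sum>j<k. D j) - (\<Sum>i<m. \<Sum>j<k. c i j * real (x i j))
     \<le> (\<Sum>i<m. \<Sum>j<k. real (x i j) * (D j - c i j))"
    by (simp add: sum_subtractf right_diff_distrib mult.commute)
  also have "\<dots> \<le> (\<Sum>i<m. \<Sum>j<k. real (y i) * max (D j - c i j) 0)"
  proof (intro sum_mono)
    fix i j assume ij: "i \<in> {..<m}" "j \<in> {..<k}"
    have "real (x i j) * (D j - c i j) \<le> real (x i j) * max (D j - c i j) 0" by (intro mult_left_mono) auto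
    also have "\<dots> \<le> real (y i) * max (D j - c i j) 0"
      using feas ij by (intro mult_right_mono) (auto simp: uftra_feasible_def)
    finally show "real (x i j) * (D j - c i j) \<le> real (y i) * max (D j - c i j) 0" .
  qed
  also have "\<dots> = (\<Sum>i<m. real (y i) * saving k c D i)" by (simp add: saving_def sum_distrib_left)
  finally show ?thesis .
qed

text \<open>An averaging argument: the copies opened by a benchmark together save at least
  \<open>r * (z - C)\<close> at cost at most \<open>r * F\<close>, so the best ratio is no worse
  than \<open>(z - C) / F\<close>. The potential then pays for the opening.\<close>

lemma aug_inv_step:
  fixes c :: "nat \<Rightarrow> nat \<Rightarrow> real"
  assumes inv: "aug_inv m k r f c D sg Op"
    and c: "\<And>i j. i < m \<Longrightarrow> j < k \<Longrightarrow> 0 \<le> c i j" and f: "\<And>i. i < m \<Longrightarrow> 0 \<le> f i"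
    and r: "0 < r" and b: "b < m" "f b < saving k c D b"
    and best: "\<And>i. i < m \<Longrightarrow> f i < saving k c D i \<Longrightarrow> saving k c D i * f b \<le> saving k c D b * f i"
    and D': "\<And>j. j < k \<Longrightarrow> D' j = min (D j) (c b j)"
    and sg': "\<And>j. j < k \<Longrightarrow> sg' j = (if c b j < D j then b else sg j)"
  shows "aug_inv m k r f c D' sg' (insert b Op)"
proof -
  have Op: "Op \<subseteq> {..<m}" and sgD: "\<And>j. j < k \<Longrightarrow> sg j \<in> Op \<and> D j = c (sg j) j"
    using inv by (auto simp: aug_inv_def)
  have D0: "0 \<le> D j" if "j < k" for j using sgD[OF that] Op c[of "sg j" j] that by auto
  have D'sum: "(\<Sum>j<k. D' j) = (\<Sum>j<k. D j) - saving k c D b"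
    unfolding saving_def sum_subtractf[symmetric] by (intro sum.cong) (auto simp: D')
  \<comment> \<open>The search compares gainful sites only. For the others the ratio of saving to
    cost is at most 1, below that of \<open>b\<close>.\<close>
  have best': "saving k c D i * f b \<le> saving k c D b * f i" if "i < m" for i
  proof (cases "f i < saving k c D i")
    case True then show ?thesis by (rule best[OF that])
  next
    case False
    then have "saving k c D i * f b \<le> f i * f b" using f[OF b(1)] by (intro mult_right_mono) auto
    also have "\<dots> \<le> f i * saving k c D b" using f[OF that] b by (intro mult_left_mono) auto
    finally show ?thesis by (simp add: mult.commute)
  qed
  have "sum f (insert b Op) + aug_potential F C (\<Sum>j<k. D' j) \<le> 1.5176 * F + 1.5184 * C"
    if F: "0 < F" and bm: "benchmark m k r f c F C" for F C
  proof -
    obtain y x where feas: "uftra_feasible {..<m} {..<k} (\<lambda>_. r) y x"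
      and fF: "(\<Sum>i<m. f i * real (y i)) \<le> real r * F"
      and cC: "(\<Sum>i<m. \<Sum>j<k. c i j * real (x i j)) \<le> real r * C"
      using bm by (auto simp: benchmark_def)
    have "real r * (f b * ((\<Sum>j<k. D j) - C)) \<le> f b * (\<Sum>i<m. real (y i) * saving k c D i)"
    proof -
      have "real r * ((\<Sum>j<k. D j) - C) \<le> (\<Sum>i<m. real (y i) * saving k c D i)"
        using benchmark_saving[where c = c and D = D, OF feas D0] cC by (simp add: right_diff_distrib)
      from mult_left_mono[OF this f[OF b(1)]] show ?thesis by (simp add: mult.left_commute)
    qed
    also have "\<dots> = (\<Sum>i<m. real (y i) * (saving k c D i * f b))"
      unfolding sum_distrib_left by (intro sum.cong) (simp_all add: mult_ac)
    also have "\<dots> \<le> (\<Sum>i<m. real (y i) * (saving k c D b * f i))"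
      using best' by (intro sum_mono mult_left_mono) auto
    also have "\<dots> = saving k c D b * (\<Sum>i<m. f i * real (y i))"
      unfolding sum_distrib_left by (intro sum.cong) (simp_all add: mult_ac)
    also have "\<dots> \<le> saving k c D b * (real r * F)"
      using fF b f[OF b(1)] by (intro mult_left_mono) auto
    finally have "real r * (f b * ((\<Sum>j<k. D j) - C)) \<le> real r * (saving k c D b * F)" by (simp only: mult_ac)
    then have "f b * ((\<Sum>j<k. D j) - C) \<le> saving k c D b * F"
      using r by (simp only: mult_le_cancel_left_pos of_nat_0_less_iff)
    then have "f b + aug_potential F C (\<Sum>j<k. D' j) \<le> aug_potential F C (\<Sum>j<k. D j)"
      unfolding D'sum by (intro aug_potential_step F f b)
    moreover have "sum f (insert b Op) \<le> f b + sum f Op"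
      using f[OF b(1)] finite_subset[OF Op] by (cases "b \<in> Op") (auto simp: insert_absorb)
    moreover have "sum f Op + aug_potential F C (\<Sum>j<k. D j) \<le> 1.5176 * F + 1.5184 * C"
      using inv F bm unfolding aug_inv_def by blast
    ultimately show ?thesis by linarith
  qed
  moreover have "sg' j \<in> insert b Op \<and> D' j = c (sg' j) j" if "j < k" for j
  proof (cases "c b j < D j")
    case True then show ?thesis using D'[OF that] sg'[OF that] by simp
  next
    case False
    then have "D' j = D j" "sg' j = sg j" using D'[OF that] sg'[OF that] by auto
    then show ?thesis using sgD[OF that] by (metis insertI2)
  qed
  moreover have "insert b Op \<subseteq> {..<m}" using Op b by auto
  ultimately show ?thesis unfolding aug_inv_def by blast
qed

lemma aug_inv_final:
  fixes c :: "nat \<Rightarrow> nat \<Rightarrow> real"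
  assumes inv: "aug_inv m k r f c D sg Op"
    and c: "\<And>i j. i < m \<Longrightarrow> j < k \<Longrightarrow> 0 \<le> c i j" and f: "\<And>i. i < m \<Longrightarrow> 0 \<le> f i"
    and r: "0 < r" and no: "\<And>i. i < m \<Longrightarrow> saving k c D i \<le> f i"
    and feas: "uftra_feasible {..<m} {..<k} (\<lambda>_. r) y x"
  shows "real r * (sum f Op + (\<Sum>j<k. D j)) \<le> 1.5184 * uftra_cost {..<m} {..<k} f c y x"
proof -
  have Op: "Op \<subseteq> {..<m}" and sgD: "\<And>j. j < k \<Longrightarrow> sg j \<in> Op \<and> D j = c (sg j) j"
    using inv by (auto simp: aug_inv_def)
  have D0: "0 \<le> D j" if "j < k" for j using sgD[OF that] Op c[of "sg j" j] that by auto
  define Fy Cx where "Fy = (\<Sum>i<m. f i * real (y i))" and "Cx = (\<Sum>i<m. \<Sum>j<k. c i j * real (x i j))"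
  define F C where "F = Fy / real r" and "C = Cx / real r"
  have rF: "Fy = real r * F" "Cx = real r * C" using r by (simp_all add: F_def C_def)
  have "0 \<le> Fy" unfolding Fy_def using f by (intro sum_nonneg) auto
  then have F0: "0 \<le> F" by (simp add: F_def)
  have "real r * (\<Sum>j<k. D j) \<le> Cx + (\<Sum>i<m. real (y i) * saving k c D i)"
    using benchmark_saving[where c = c and D = D, OF feas D0] by (simp add: Cx_def)
  also have "(\<Sum>i<m. real (y i) * saving k c D i) \<le> Fy"
    unfolding Fy_def using no by (intro sum_mono) (subst mult.commute, rule mult_right_mono, auto)
  finally have "real r * (\<Sum>j<k. D j) \<le> real r * (C + F)" by (simp add: rF distrib_left)
  then have "(\<Sum>j<k. D j) \<le> C + F" using r by (simp only: mult_le_cancel_left_pos of_nat_0_less_iff)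
  then have DC: "(\<Sum>j<k. D j) - C \<le> F" by simp
  have "sum f Op + (\<Sum>j<k. D j) \<le> 1.5184 * (F + C) + \<epsilon>" if e: "0 < \<epsilon>" for \<epsilon>
  proof -
    \<comment> \<open>The potential divides by \<open>F\<close>, which may be 0 here; it is
      therefore enlarged, and the enlargement disappears in the limit.\<close>
    define F' where "F' = F + \<epsilon> / 2"
    have "Fy \<le> real r * F'" unfolding rF F'_def using e by (intro mult_left_mono) auto
    then have "benchmark m k r f c F' C"
      unfolding benchmark_def using feas rF(2) unfolding Fy_def Cx_def
      by (intro exI[of _ y] exI[of _ x] conjI) simp_all
    moreover have F'0: "0 < F'" using F0 e by (simp add: F'_def)
    ultimately have "sum f Op + aug_potential F' C (\<Sum>j<k. D j) \<le> 1.5176 * F' + 1.5184 * C"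
      using inv unfolding aug_inv_def by blast
    moreover have "aug_potential F' C (\<Sum>j<k. D j) = (\<Sum>j<k. D j)" using DC e by (simp add: aug_potential_def F'_def)
    ultimately show ?thesis using F0 e by (simp add: F'_def field_simps)
  qed
  then have "sum f Op + (\<Sum>j<k. D j) \<le> 1.5184 * (F + C)" by (rule field_le_epsilon)
  then have "real r * (sum f Op + (\<Sum>j<k. D j)) \<le> real r * (1.5184 * (F + C))" by (intro mult_left_mono) auto
  also have "\<dots> = 1.5184 * (Fy + Cx)" unfolding rF by (simp add: algebra_simps)
  also have "Fy + Cx = uftra_cost {..<m} {..<k} f c y x" by (simp add: Fy_def Cx_def uftra_cost_def)
  finally show ?thesis .
qed

section \<open>The program\<close>

text \<open>The potential \<open>\<Phi>\<close> pays for the update of the star sums, which happens once per client but inside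
  a loop that runs once per client in every iteration.\<close>

definition pruns :: "(state \<Rightarrow> nat) \<Rightarrow> com \<Rightarrow> state \<Rightarrow> nat \<Rightarrow> (state \<Rightarrow> bool) \<Rightarrow> bool" where
  "pruns \<Phi> p s T Q \<longleftrightarrow> (\<exists>t s'. exec p s t s' \<and> t + \<Phi> s' \<le> T + \<Phi> s \<and> Q s')"

abbreviation runs :: "com \<Rightarrow> state \<Rightarrow> nat \<Rightarrow> (state \<Rightarrow> bool) \<Rightarrow> bool" where
  "runs \<equiv> pruns (\<lambda>_. 0)"

section \<open>Rules for amortised running time\<close>

lemma runs_mono: "pruns \<Phi> p s T Q \<Longrightarrow> T \<le> T' \<Longrightarrow> (\<And>s'. Q s' \<Longrightarrow> Q' s') \<Longrightarrow> pruns \<Phi> p s T' Q'"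
  unfolding pruns_def by (meson add_le_mono1 order_trans)

lemma runs_Seq:
  assumes "pruns \<Phi> p s T R" "\<And>s'. R s' \<Longrightarrow> pruns \<Phi> q s' T' Q"
  shows "pruns \<Phi> (Seq p q) s (T + T') Q"
proof -
  obtain t s1 where 1: "exec p s t s1" "t + \<Phi> s1 \<le> T + \<Phi> s" "R s1" using assms(1) by (auto simp: pruns_def)
  obtain t' s2 where 2: "exec q s1 t' s2" "t' + \<Phi> s2 \<le> T' + \<Phi> s1" "Q s2"
    using assms(2)[OF 1(3)] by (auto simp: pruns_def)
  have "exec (Seq p q) s (t + t') s2" by (rule exec.Seq[OF 1(1) 2(1)])
  moreover have "t + t' + \<Phi> s2 \<le> T + T' + \<Phi> s" using 1(2) 2(2) by simp
  ultimately show ?thesis using 2(3) unfolding pruns_def by blast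
qed

lemma runs_Seq_le:
  assumes "pruns \<Phi> p s T R" "\<And>s'. R s' \<Longrightarrow> pruns \<Phi> q s' T' Q" "T + T' \<le> T''"
  shows "pruns \<Phi> (Seq p q) s T'' Q"
  using runs_mono[OF runs_Seq[OF assms(1,2)] assms(3)] by blast

lemma runs_IfT:
  assumes "bval b s" "pruns \<Phi> p s T Q" "1 + bcost b + T \<le> T'"
  shows "pruns \<Phi> (IfC b p q) s T' Q"
proof -
  obtain t s' where 1: "exec p s t s'" "t + \<Phi> s' \<le> T + \<Phi> s" "Q s'" using assms(2) by (auto simp: pruns_def)
  have "exec (IfC b p q) s (1 + bcost b + t) s'" by (rule IfT[OF assms(1) 1(1)])
  moreover have "1 + bcost b + t + \<Phi> s' \<le> T' + \<Phi> s" using 1(2) assms(3) by simp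
  ultimately show ?thesis using 1(3) unfolding pruns_def by blast
qed

lemma runs_IfF:
  assumes "\<not> bval b s" "pruns \<Phi> q s T Q" "1 + bcost b + T \<le> T'"
  shows "pruns \<Phi> (IfC b p q) s T' Q"
proof -
  obtain t s' where 1: "exec q s t s'" "t + \<Phi> s' \<le> T + \<Phi> s" "Q s'" using assms(2) by (auto simp: pruns_def)
  have "exec (IfC b p q) s (1 + bcost b + t) s'" by (rule IfF[OF assms(1) 1(1)])
  moreover have "1 + bcost b + t + \<Phi> s' \<le> T' + \<Phi> s" using 1(2) assms(3) by simp
  ultimately show ?thesis using 1(3) unfolding pruns_def by blast
qed

lemma pruns_of_runs:
  assumes "runs p s T (\<lambda>s'. T + \<Phi> s' \<le> T' + \<Phi> s \<and> Q s')"
  shows "pruns \<Phi> p s T' Q"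
proof -
  obtain t s' where 1: "exec p s t s'" "t \<le> T" "T + \<Phi> s' \<le> T' + \<Phi> s" "Q s'"
    using assms by (auto simp: pruns_def)
  have "t + \<Phi> s' \<le> T' + \<Phi> s" using 1(2,3) by simp
  then show ?thesis using 1(1,4) unfolding pruns_def by blast
qed

lemma runs_of_pruns:
  assumes "pruns \<Phi> p s T Q" "T + \<Phi> s \<le> T'"
  shows "runs p s T' Q"
proof -
  obtain t s' where 1: "exec p s t s'" "t + \<Phi> s' \<le> T + \<Phi> s" "Q s'"
    using assms(1) by (auto simp: pruns_def)
  have "t + 0 \<le> T' + 0" using 1(2) assms(2) by simp
  then show ?thesis using 1(1,3) unfolding pruns_def by blast
qed

text \<open>Loop-free code is executed symbolically by rewriting with \<open>effect\<close>. The
  time bound \<open>len\<close> adds both branches of a conditional, which is good enough for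
  constants.\<close>

fun straight :: "com \<Rightarrow> bool" where
  "straight (Seq p q) \<longleftrightarrow> straight p \<and> straight q"
| "straight (IfC b p q) \<longleftrightarrow> straight p \<and> straight q"
| "straight (WhileC b p) \<longleftrightarrow> False"
| "straight _ \<longleftrightarrow> True"

fun effect :: "com \<Rightarrow> state \<Rightarrow> state" where
  "effect (NAssign a e) s = ((fst s)(nval a s := nval e s), snd s)"
| "effect (RAssign a e) s = (fst s, (snd s)(nval a s := rval e s))"
| "effect (Seq p q) s = effect q (effect p s)"
| "effect (IfC b p q) s = (if bval b s then effect p s else effect q s)"
| "effect _ s = s"

fun len :: "com \<Rightarrow> nat" where
  "len (NAssign a e) = 1 + ncost a + ncost e"
| "len (RAssign a e) = 1 + ncost a + rcost e"
| "len (Seq p q) = len p + len q"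
| "len (IfC b p q) = 1 + bcost b + len p + len q"
| "len _ = 1"

lemma exec_straight: "straight p \<Longrightarrow> \<exists>t \<le> len p. exec p s t (effect p s)"
proof (induction p arbitrary: s)
  case (Seq p q)
  then have pq: "straight p" "straight q" by auto
  obtain t where 1: "t \<le> len p" "exec p s t (effect p s)" using Seq.IH(1)[OF pq(1)] by blast
  obtain t' where 2: "t' \<le> len q" "exec q (effect p s) t' (effect q (effect p s))"
    using Seq.IH(2)[OF pq(2)] by blast
  have "exec (Seq p q) s (t + t') (effect q (effect p s))" by (rule exec.Seq[OF 1(2) 2(2)])
  then show ?case using 1(1) 2(1) by (intro exI[of _ "t + t'"]) simp
next
  case (IfC b p q)
  then have pq: "straight p" "straight q" by auto
  show ?case
  proof (cases "bval b s")
    case True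
    obtain t where 1: "t \<le> len p" "exec p s t (effect p s)" using IfC.IH(1)[OF pq(1)] by blast
    have "exec (IfC b p q) s (1 + bcost b + t) (effect p s)" by (rule IfT[OF True 1(2)])
    then show ?thesis using 1(1) True by (intro exI[of _ "1 + bcost b + t"]) simp
  next
    case False
    obtain t where 1: "t \<le> len q" "exec q s t (effect q s)" using IfC.IH(2)[OF pq(2)] by blast
    have "exec (IfC b p q) s (1 + bcost b + t) (effect q s)" by (rule IfF[OF False 1(2)])
    then show ?thesis using 1(1) False by (intro exI[of _ "1 + bcost b + t"]) simp
  qed
next
  case SKIP
  show ?case using exec.Skip[of s] by (intro exI[of _ 1]) simp
next
  case (NAssign a e)
  show ?case using exec.NAssign[of a e s] by (intro exI[of _ "1 + ncost a + ncost e"]) simp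
next
  case (RAssign a e)
  show ?case using exec.RAssign[of a e s] by (intro exI[of _ "1 + ncost a + rcost e"]) simp
qed simp

lemma runs_straight:
  assumes "straight p" "len p \<le> T" "Q (effect p s)"
  shows "runs p s T Q"
proof -
  obtain t where 1: "t \<le> len p" "exec p s t (effect p s)" using exec_straight[OF assms(1)] by blast
  have "t + 0 \<le> T + 0" using 1(1) assms(2) by simp
  then show ?thesis using 1(2) assms(3) unfolding pruns_def by blast
qed

text \<open>The invariant is indexed by the number of completed rounds, so termination and the time
  bound both come from the fixed total \<open>n\<close>.\<close>

lemma runs_while:
  assumes body: "\<And>x s. x < n \<Longrightarrow> I x s \<Longrightarrow> bval b s \<and> pruns \<Phi> p s T (I (Suc x))"
    and stop: "\<And>s. I n s \<Longrightarrow> \<not> bval b s"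
    and init: "I 0 s"
  shows "pruns \<Phi> (WhileC b p) s (n * (T + 1 + bcost b) + 1 + bcost b) (I n)"
proof -
  have "pruns \<Phi> (WhileC b p) s ((n - x) * (T + 1 + bcost b) + 1 + bcost b) (I n)"
    if "x \<le> n" "I x s" for x s
    using that
  proof (induction "n - x" arbitrary: x s)
    case 0
    then have "exec (WhileC b p) s (1 + bcost b) s" using stop by (intro WhileF) auto
    then show ?case using 0 unfolding pruns_def by (intro exI[of _ "1 + bcost b"] exI[of _ s]) auto
  next
    case (Suc d)
    then have x: "x < n" "d = n - Suc x" by auto
    have bv: "bval b s" and "pruns \<Phi> p s T (I (Suc x))" using body[OF x(1) Suc.prems(2)] by auto
    then obtain t s' where 1: "exec p s t s'" "t + \<Phi> s' \<le> T + \<Phi> s" "I (Suc x) s'"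
      by (auto simp: pruns_def)
    have "pruns \<Phi> (WhileC b p) s' ((n - Suc x) * (T + 1 + bcost b) + 1 + bcost b) (I n)"
      using x 1 by (intro Suc.hyps(1)) auto
    then obtain t' s'' where 2: "exec (WhileC b p) s' t' s''" "I n s''"
      "t' + \<Phi> s'' \<le> (n - Suc x) * (T + 1 + bcost b) + 1 + bcost b + \<Phi> s'" by (auto simp: pruns_def)
    have "exec (WhileC b p) s (1 + bcost b + t + t') s''" using bv 1(1) 2(1) by (rule WhileT)
    moreover have "n - x = Suc (n - Suc x)" using x by simp
    then have "1 + bcost b + t + t' + \<Phi> s'' \<le> (n - x) * (T + 1 + bcost b) + 1 + bcost b + \<Phi> s"
      using 1(2) 2(3) by simp
    ultimately show ?case using 2(2) unfolding pruns_def by blast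
  qed
  from this[of 0 s] init show ?thesis by simp
qed

abbreviation V :: "nat \<Rightarrow> nexp" where "V a \<equiv> NRd (NC a)"

definition for_loop :: "nat \<Rightarrow> nat \<Rightarrow> com \<Rightarrow> com" where
  "for_loop v b p = Seq (NAssign (NC v) (NC 0))
     (WhileC (BNLess (V v) (V b)) (Seq p (NAssign (NC v) (NPlus (V v) (NC 1)))))"

text \<open>The body has to establish the next invariant for the state whose counter is already
  advanced. The potential must ignore the counter, so that the loop overhead leaves it
  unchanged.\<close>

lemma pruns_for:
  assumes vb: "v \<noteq> b"
    and body: "\<And>x s. x < n \<Longrightarrow> I x s \<Longrightarrow> fst s v = x \<Longrightarrow> fst s b = n \<Longrightarrow>
      pruns \<Phi> p s T (\<lambda>s'. fst s' v = x \<and> fst s' b = n \<and> I (Suc x) ((fst s')(v := Suc x), snd s'))"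
    and Phi: "\<And>s x. \<Phi> ((fst s)(v := x), snd s) = \<Phi> s"
    and init: "I 0 ((fst s)(v := 0), snd s)" and n: "fst s b = n"
    and final: "\<And>s'. I n s' \<Longrightarrow> fst s' v = n \<Longrightarrow> fst s' b = n \<Longrightarrow> Q s'"
    and T': "n * (T + 13) + 10 \<le> T'"
  shows "pruns \<Phi> (for_loop v b p) s T' Q"
  unfolding for_loop_def
proof (rule runs_Seq_le)
  show "pruns \<Phi> (NAssign (NC v) (NC 0)) s 3 (\<lambda>s'. s' = ((fst s)(v := 0), snd s))"
    by (rule pruns_of_runs, rule runs_straight[where T = 3]) (simp_all add: Phi)
  fix s' assume s': "s' = ((fst s)(v := 0), snd s)"
  let ?I = "\<lambda>x s. I x s \<and> fst s v = x \<and> fst s b = n"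
  have "pruns \<Phi> (WhileC (BNLess (V v) (V b)) (Seq p (NAssign (NC v) (NPlus (V v) (NC 1))))) s'
     (n * (T + 6 + 1 + bcost (BNLess (V v) (V b))) + 1 + bcost (BNLess (V v) (V b))) (?I n)"
  proof (rule runs_while[where I = ?I])
    fix x s assume x: "x < n" and "I x s \<and> fst s v = x \<and> fst s b = n"
    then have I: "I x s" "fst s v = x" "fst s b = n" by auto
    have "pruns \<Phi> (Seq p (NAssign (NC v) (NPlus (V v) (NC 1)))) s (T + 6) (?I (Suc x))"
    proof (rule runs_Seq[OF body[OF x I]])
      fix s' assume "fst s' v = x \<and> fst s' b = n \<and> I (Suc x) ((fst s')(v := Suc x), snd s')"
      then show "pruns \<Phi> (NAssign (NC v) (NPlus (V v) (NC 1))) s' 6 (?I (Suc x))"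
        using vb by - (rule pruns_of_runs, rule runs_straight[where T = 6], simp_all add: Phi)
    qed
    then show "bval (BNLess (V v) (V b)) s \<and> pruns \<Phi> (Seq p (NAssign (NC v) (NPlus (V v) (NC 1)))) s (T + 6) (?I (Suc x))"
      using x I by simp
  qed (use init n vb s' in auto)
  then show "pruns \<Phi> (WhileC (BNLess (V v) (V b)) (Seq p (NAssign (NC v) (NPlus (V v) (NC 1))))) s' (n * (T + 13) + 7) Q"
    by (rule runs_mono) (use final in \<open>auto simp: algebra_simps\<close>)
qed (use T' in simp)

lemmas runs_for = pruns_for[where \<Phi> = "\<lambda>_. 0", OF _ _ refl]

text \<open>The real memory is used as a sequence of blocks of length \<open>L = m + m k\<close> (kept in cell 3): block 0
  is the input, block 1 holds the residual opening costs and the sums of the connection costs of the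
  stars, block 2 the sizes of the stars, block 3 the connection costs of the clients (-1 if
  unconnected), block 4 the sites serving them.\<close>

definition adr :: "nat \<Rightarrow> nat \<Rightarrow> nat \<Rightarrow> nat" where
  "adr L b x = b * L + x"

text \<open>Natural-number expressions have no product, so the block start is formed by repeated
  addition of the block length in cell 3. The block number is a constant of the program, hence the
  cost is constant.\<close>

fun blk :: "nat \<Rightarrow> nexp \<Rightarrow> nexp" where
  "blk 0 e = e"
| "blk (Suc b) e = NPlus (V 3) (blk b e)"

lemma nval_blk [simp]: "nval (blk b e) s = adr (fst s 3) b (nval e s)"
  by (induction b) (auto simp: adr_def)

lemma ncost_blk [simp]: "ncost (blk b e) = 3 * b + ncost e"
  by (induction b) auto

declare blk.simps [simp del]

lemma adr_eq_iff:
  assumes "x < L" "x' < L"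
  shows "adr L b x = adr L b' x' \<longleftrightarrow> b = b' \<and> x = x'"
proof
  assume a: "adr L b x = adr L b' x'"
  have "adr L b x div L = b" "adr L b' x' div L = b'" using assms by (auto simp: adr_def)
  then show "b = b' \<and> x = x'" using a by (auto simp: adr_def)
qed auto

lemma cell_less:
  fixes i j k m :: nat
  assumes "i < m" "j < k"
  shows "m + i * k + j < m + m * k"
proof -
  have "i * k + j < i * k + k" using assms(2) by (rule add_strict_left_mono)
  also have "i * k + k = Suc i * k" by simp
  also have "\<dots> \<le> m * k" using assms by (intro mult_le_mono1) auto
  finally show ?thesis by simp
qed

lemma cell_eq_iff:
  fixes i j k i' j' :: nat
  assumes "j < k" "j' < k"
  shows "i * k + j = i' * k + j' \<longleftrightarrow> i = i' \<and> j = (j'::nat)"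
proof
  assume a: "i * k + j = i' * k + j'"
  have "(i * k + j) div k = i" "(i' * k + j') div k = i'" using assms by auto
  then show "i = i' \<and> j = j'" using a by auto
qed auto

abbreviation rd :: "nat \<Rightarrow> nexp \<Rightarrow> rexp" where "rd b e \<equiv> RRd (blk b e)"

abbreviation "cur \<equiv> NPlus (V 5) (V 6)"

definition size_loop :: com where
  "size_loop = Seq (NAssign (NC 3) (V 0)) (for_loop 4 0 (NAssign (NC 3) (NPlus (V 3) (V 1))))"

text \<open>Loop over the sites with the site in cell 4 and the offset of its row in cell 5.\<close>

definition site_loop :: "com \<Rightarrow> com" where
  "site_loop p = Seq (NAssign (NC 5) (V 0)) (for_loop 4 0 (Seq p (NAssign (NC 5) (NPlus (V 5) (V 1)))))"

text \<open>Unconnected clients add nothing: their mark -1 lies below every connection cost.\<close>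

definition saving_prog :: com where
  "saving_prog = Seq (RAssign (blk 5 (NC 0)) (RC 0))
     (for_loop 6 1 (IfC (BRLess (rd 0 cur) (rd 3 (V 6)))
        (RAssign (blk 5 (NC 0)) (RPlus (rd 5 (NC 0)) (RMinus (rd 3 (V 6)) (rd 0 cur)))) SKIP))"

definition init_row :: com where
  "init_row = for_loop 7 1 (IfC (BRLess (rd 0 cur) (rd 0 (NPlus (V 5) (V 7)))) SKIP
     (Seq (RAssign (blk 1 cur) (RPlus (rd 1 cur) (rd 0 (NPlus (V 5) (V 7)))))
          (RAssign (blk 2 cur) (RPlus (rd 2 cur) (RC 1)))))"

definition init_stars :: com where
  "init_stars = site_loop (Seq (RAssign (blk 1 (V 4)) (RTimes (RC (3/2)) (rd 0 (V 4))))
     (for_loop 6 1 (Seq (RAssign (blk 1 cur) (RC 0)) (Seq (RAssign (blk 2 cur) (RC 0)) init_row))))"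

definition init_clients :: com where
  "init_clients = for_loop 6 1 (Seq (RAssign (blk 3 (V 6)) (RC (-1))) (RAssign (blk 4 (V 6)) (RC 0)))"

locale uftra_run =
  fixes m k r L w :: nat and f :: "nat \<Rightarrow> real" and c :: "nat \<Rightarrow> nat \<Rightarrow> real"
  assumes m: "0 < m" and L: "L = m + m * k" and w: "w = m + k" and r: "0 < r"
    and f: "i < m \<Longrightarrow> 0 \<le> f i" and c: "i < m \<Longrightarrow> j < k \<Longrightarrow> 0 \<le> c i j"
    and metric: "uftra_metric {..<m} {..<k} c"
begin

section \<open>Time bounds, frames and memory invariants\<close>

lemma w_bounds: "m \<le> w" "k \<le> w" "1 \<le> w" using m w by auto

lemma w_powers: "w \<le> w ^ 2" "1 \<le> w ^ 2" "w ^ 2 \<le> w ^ 3" "1 \<le> w ^ 3"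
  using w_bounds by (auto simp: power2_eq_square power3_eq_cube)

text \<open>Every loop runs at most \<open>w\<close> times, so each nesting level raises the power
  of \<open>w\<close> by one, and additive overhead is absorbed by that power.\<close>

lemma loop_cost:
  assumes n: "n \<le> w" and a: "a + x \<le> b * w ^ e" and d: "b + y \<le> d"
  shows "n * (a + x) + y \<le> d * w ^ Suc e"
proof -
  have "n * (a + x) \<le> w * (b * w ^ e)" using n a by (rule mult_le_mono)
  moreover have "y * 1 \<le> y * w ^ Suc e" using w_bounds by (intro mult_le_mono2) (simp add: one_le_power)
  moreover have "w * (b * w ^ e) + y * w ^ Suc e = (b + y) * w ^ Suc e" by (simp add: algebra_simps)
  moreover have "(b + y) * w ^ Suc e \<le> d * w ^ Suc e" using d by (rule mult_le_mono1)
  ultimately show ?thesis by linarith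
qed


lemma site_less: "i < m \<Longrightarrow> i < L" by (simp add: L)

lemma client_less: "j < k \<Longrightarrow> j < L"
proof -
  assume "j < k"
  moreover have "k \<le> m * k" using m by simp
  ultimately show ?thesis unfolding L by linarith
qed

lemma cell_less_L: "i < m \<Longrightarrow> j < k \<Longrightarrow> m + i * k + j < L"
  unfolding L by (rule cell_less)

lemma L_pos: "0 < L" using m by (simp add: L)

lemma adr_L_eq [simp]: "x < L \<Longrightarrow> x' < L \<Longrightarrow> adr L b x = adr L b' x' \<longleftrightarrow> b = b' \<and> x = x'"
  by (rule adr_eq_iff)

definition frame :: "nat set \<Rightarrow> nat set \<Rightarrow> state \<Rightarrow> state \<Rightarrow> bool" where
  "frame A B s s' \<longleftrightarrow> (\<forall>a. a \<notin> A \<longrightarrow> fst s' a = fst s a) \<and>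
     (\<forall>b x. b \<notin> B \<longrightarrow> x < L \<longrightarrow> snd s' (adr L b x) = snd s (adr L b x))"

lemma frame_refl [simp]: "frame A B s s" by (simp add: frame_def)

lemma frame_trans: "frame A B s s' \<Longrightarrow> frame A' B' s' s'' \<Longrightarrow> A \<subseteq> A'' \<Longrightarrow> A' \<subseteq> A'' \<Longrightarrow> B \<subseteq> B'' \<Longrightarrow> B' \<subseteq> B'' \<Longrightarrow>
    frame A'' B'' s s''"
  unfolding frame_def subset_iff by metis

lemma frame_pair_simps [simp]:
  "v \<in> A \<Longrightarrow> frame A B s (n(v := x), R) \<longleftrightarrow> frame A B s (n, R)"
  "v \<in> A \<Longrightarrow> frame A B (n(v := x), R) s' \<longleftrightarrow> frame A B (n, R) s'"
  "b \<in> B \<Longrightarrow> y < L \<Longrightarrow> frame A B s (n, R(adr L b y := z)) \<longleftrightarrow> frame A B s (n, R)"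
  "b \<in> B \<Longrightarrow> y < L \<Longrightarrow> frame A B (n, R(adr L b y := z)) s' \<longleftrightarrow> frame A B (n, R) s'"
  by (auto simp: frame_def)

lemma frame_fst: "frame A B s s' \<Longrightarrow> a \<notin> A \<Longrightarrow> fst s' a = fst s a" by (auto simp: frame_def)

lemma frame_snd: "frame A B s s' \<Longrightarrow> b \<notin> B \<Longrightarrow> x < L \<Longrightarrow> snd s' (adr L b x) = snd s (adr L b x)"
  by (auto simp: frame_def)

text \<open>The working cells from 3 on overwrite requirements of the input. Uniformity makes the
  one in cell 2 sufficient; without clients that cell holds no requirement.\<close>

definition base :: "state \<Rightarrow> bool" where
  "base s \<longleftrightarrow> fst s 0 = m \<and> fst s 1 = k \<and> (0 < k \<longrightarrow> fst s 2 = r) \<and> fst s 3 = L \<and>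
     (\<forall>i<m. snd s (adr L 0 i) = f i) \<and> (\<forall>i<m. \<forall>j<k. snd s (adr L 0 (m + i * k + j)) = c i j)"

lemma base_frame: "base s \<Longrightarrow> frame A B s s' \<Longrightarrow> A \<inter> {0,1,2,3} = {} \<Longrightarrow> 0 \<notin> B \<Longrightarrow> base s'"
  using site_less cell_less_L by (auto simp: base_def frame_def)

lemma base_upd [simp]: "3 < v \<Longrightarrow> base (n(v := x), R) \<longleftrightarrow> base (n, R)"
  by (simp add: base_def)

lemma baseD:
  assumes "base s"
  shows "fst s 0 = m" "fst s 1 = k" "fst s (Suc 0) = k" "fst s 3 = L"
    "i < m \<Longrightarrow> snd s (adr L 0 i) = f i" "i < m \<Longrightarrow> j < k \<Longrightarrow> snd s (adr L 0 (m + i * k + j)) = c i j"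
  using assms by (auto simp: base_def)

abbreviation D :: "state \<Rightarrow> nat \<Rightarrow> real" where "D s j \<equiv> snd s (adr L 3 j)"
abbreviation sg :: "state \<Rightarrow> nat \<Rightarrow> real" where "sg s j \<equiv> snd s (adr L 4 j)"
abbreviation g :: "state \<Rightarrow> nat \<Rightarrow> real" where "g s i \<equiv> snd s (adr L 1 i)"
abbreviation starsum :: "state \<Rightarrow> nat \<Rightarrow> nat \<Rightarrow> real" where "starsum s i j \<equiv> snd s (adr L 1 (m + i * k + j))"
abbreviation starcard :: "state \<Rightarrow> nat \<Rightarrow> nat \<Rightarrow> real" where "starcard s i j \<equiv> snd s (adr L 2 (m + i * k + j))"

definition stars_ok :: "state \<Rightarrow> bool" where
  "stars_ok s \<longleftrightarrow> (\<forall>i<m. \<forall>j<k. starsum s i j = sum (c i) (star k c (D s) i j) \<and>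
     starcard s i j = real (card (star k c (D s) i j)))"

lemma saving_cong: "(\<And>j. j < k \<Longrightarrow> d j = d' j) \<Longrightarrow> saving k c d i = saving k c d' i"
  by (simp add: saving_def)

lemma star_cong: "(\<And>j. j < k \<Longrightarrow> d j < 0 \<longleftrightarrow> d' j < 0) \<Longrightarrow> star k c d i j = star k c d' i j"
  by (auto simp: star_def)

text \<open>The premise \<open>ins\<close> makes the invariant independent of cells 4 and 5, which
  the loop itself changes outside of the body.\<close>

lemma runs_site_loop:
  assumes base: "base s"
    and body: "\<And>i s'. i < m \<Longrightarrow> I i s' \<Longrightarrow> base s' \<Longrightarrow> fst s' 4 = i \<Longrightarrow> fst s' 5 = m + i * k \<Longrightarrow>
      runs p s' T (\<lambda>s''. base s'' \<and> fst s'' 4 = i \<and> fst s'' 5 = m + i * k \<and> I (Suc i) s'')"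
    and ins: "\<And>i s' x y. I i s' \<Longrightarrow> I i ((fst s')(4 := x, 5 := y), snd s')"
    and init: "I 0 s" and T: "m * (T + 20) + 15 \<le> T'"
    and final: "\<And>s'. I m s' \<Longrightarrow> base s' \<Longrightarrow> Q s'"
  shows "runs (site_loop p) s T' Q"
  unfolding site_loop_def
proof (rule runs_Seq_le)
  show "runs (NAssign (NC 5) (V 0)) s 4 (\<lambda>s'. s' = ((fst s)(5 := m), snd s))"
    using base by (intro runs_straight) (auto simp: base_def)
  fix s' assume s': "s' = ((fst s)(5 := m), snd s)"
  have ins4: "I i ((fst s')(4 := x), snd s')" if "I i s'" for i s' x
    using ins[OF that, of x "fst s' 5"] by (simp add: fun_upd_idem)
  have ins5: "I i ((fst s')(5 := x), snd s')" if "I i s'" for i s' x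
    using ins[OF that, of "fst s' 4" x] by (simp add: fun_upd_idem)
  show "runs (for_loop 4 0 (Seq p (NAssign (NC 5) (NPlus (V 5) (V 1))))) s' (m * (T + 20) + 10) Q"
  proof (rule runs_for[where I = "\<lambda>i s'. I i s' \<and> base s' \<and> fst s' 5 = m + i * k" and T = "T + 7"])
    show "I 0 ((fst s')(4 := 0), snd s') \<and> base ((fst s')(4 := 0), snd s') \<and> fst ((fst s')(4 := 0), snd s') 5 = m + 0 * k"
      using ins4[OF ins5[OF init, of m], of 0] base by (simp add: s' base_def)
    show "fst s' 0 = m" using base s' by (simp add: base_def)
    fix i s assume i: "i < m" "I i s \<and> base s \<and> fst s 5 = m + i * k" "fst s 4 = i"
    then have b: "runs p s T (\<lambda>s''. base s'' \<and> fst s'' 4 = i \<and> fst s'' 5 = m + i * k \<and> I (Suc i) s'')"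
      by (intro body) auto
    show "runs (Seq p (NAssign (NC 5) (NPlus (V 5) (V 1)))) s (T + 7) (\<lambda>s'. fst s' 4 = i \<and> fst s' 0 = m \<and>
       I (Suc i) ((fst s')(4 := Suc i), snd s') \<and> base ((fst s')(4 := Suc i), snd s') \<and>
       fst ((fst s')(4 := Suc i), snd s') 5 = m + Suc i * k)"
    proof (rule runs_Seq[OF b])
      fix s' assume s': "base s' \<and> fst s' 4 = i \<and> fst s' 5 = m + i * k \<and> I (Suc i) s'"
      then have "I (Suc i) ((fst s')(5 := m + i * k + k, 4 := Suc i), snd s')"
        using ins4[OF ins5[of "Suc i" s']] by auto
      then show "runs (NAssign (NC 5) (NPlus (V 5) (V 1))) s' 7 (\<lambda>s'. fst s' 4 = i \<and> fst s' 0 = m \<and>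
       I (Suc i) ((fst s')(4 := Suc i), snd s') \<and> base ((fst s')(4 := Suc i), snd s') \<and>
       fst ((fst s')(4 := Suc i), snd s') 5 = m + Suc i * k)"
        using s' by (intro runs_straight) (simp_all add: baseD[of s'] add.assoc add.commute[of k])
    qed
  qed (use final in auto)
qed (use T in simp)

lemma runs_saving:
  assumes base: "base s" and i: "i < m" "fst s 5 = m + i * k"
  shows "runs saving_prog s (150 * w)
    (\<lambda>s'. frame {6} {5} s s' \<and> snd s' (adr L 5 0) = saving k c (D s) i)"
  unfolding saving_prog_def
proof (rule runs_Seq_le)
  show "runs (RAssign (blk 5 (NC 0)) (RC 0)) s 18 (\<lambda>s'. s' = (fst s, (snd s)(adr L 5 0 := 0)))"
    using base by (intro runs_straight) (auto simp: baseD)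
  fix s' assume s': "s' = (fst s, (snd s)(adr L 5 0 := 0))"
  show "runs (for_loop 6 1 (IfC (BRLess (rd 0 cur) (rd 3 (V 6)))
        (RAssign (blk 5 (NC 0)) (RPlus (rd 5 (NC 0)) (RMinus (rd 3 (V 6)) (rd 0 cur)))) SKIP)) s' (k * (100 + 13) + 10)
     (\<lambda>s'. frame {6} {5} s s' \<and> snd s' (adr L 5 0) = saving k c (D s) i)"
  proof (rule runs_for[where I = "\<lambda>x s'. frame {6} {5} s s' \<and>
      snd s' (adr L 5 0) = (\<Sum>j<x. max (D s j - c i j) 0)" and T = 100])
    fix x s' assume x: "x < k" and "frame {6} {5} s s' \<and> snd s' (adr L 5 0) = (\<Sum>j<x. max (D s j - c i j) 0)"
      and v: "fst s' 6 = x"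
    then have I: "frame {6} {5} s s'" "snd s' (adr L 5 0) = (\<Sum>j<x. max (D s j - c i j) 0)" by auto
    have b': "base s'" by (rule base_frame[OF base I(1)]) auto
    have rdD: "snd s' (adr L 3 x) = D s x" by (rule frame_snd[OF I(1) _ client_less[OF x]]) simp
    have c5: "fst s' 5 = m + i * k" using frame_fst[OF I(1), of 5] i by simp
    note ev = baseD[OF b'] rdD c5 v baseD(6)[OF b' i(1) x] L_pos
    show "runs (IfC (BRLess (rd 0 cur) (rd 3 (V 6)))
        (RAssign (blk 5 (NC 0)) (RPlus (rd 5 (NC 0)) (RMinus (rd 3 (V 6)) (rd 0 cur)))) SKIP) s' 100
       (\<lambda>s'. fst s' 6 = x \<and> fst s' 1 = k \<and> frame {6} {5} s ((fst s')(6 := Suc x), snd s') \<and>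
        snd ((fst s')(6 := Suc x), snd s') (adr L 5 0) = (\<Sum>j<Suc x. max (D s j - c i j) 0))"
      by (intro runs_straight) (simp_all add: ev I max_def)
  qed (use base s' L_pos in \<open>simp_all add: saving_def baseD[of s]\<close>)
qed (use w_bounds in simp)

end

definition update_stars :: com where
  "update_stars = site_loop (for_loop 7 1 (IfC (BRLess (rd 0 (NPlus (V 5) (V 7))) (rd 0 cur)) SKIP
     (Seq (RAssign (blk 1 (NPlus (V 5) (V 7))) (RMinus (rd 1 (NPlus (V 5) (V 7))) (rd 0 cur)))
          (RAssign (blk 2 (NPlus (V 5) (V 7))) (RMinus (rd 2 (NPlus (V 5) (V 7))) (RC 1))))))"

abbreviation "best_cell \<equiv> NPlus (V 10) (V 6)"

definition assign_best :: com where
  "assign_best = Seq (RAssign (blk 3 (V 6)) (rd 0 best_cell)) (RAssign (blk 4 (V 6)) (ROfNat (V 9)))"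

definition connect_loop :: com where
  "connect_loop = for_loop 6 1 (IfC (BRLess (rd 0 best_cell) (rd 3 (V 6))) assign_best
     (IfC (BAnd (BRLess (rd 3 (V 6)) (RC 0)) (BNot (BRLess (rd 6 (NC 0)) (rd 0 best_cell))))
        (Seq assign_best update_stars) SKIP))"

lemma Collect_less_Suc:
  "{j. j < Suc x \<and> P j} = (if P x then insert x {j. j < x \<and> P j} else {j. j < x \<and> P j})"
  by (auto simp: less_Suc_eq)

context uftra_run
begin

section \<open>Effects and costs of the initialisation\<close>

lemma cell_eq [simp]: "j < k \<Longrightarrow> j' < k \<Longrightarrow> i * k + j = i' * k + j' \<longleftrightarrow> i = i' \<and> j = j'"
  by (rule cell_eq_iff)

lemma site_neq_cell [simp]: "i < m \<Longrightarrow> i \<noteq> m + i' * k + j" "i < m \<Longrightarrow> m + i' * k + j \<noteq> i"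
  by linarith+

lemma runs_size_loop:
  assumes "fst s 0 = m" "fst s 1 = k"
  shows "runs size_loop s (40 * w) (\<lambda>s'. snd s' = snd s \<and> fst s' 3 = L \<and> (\<forall>a. a \<notin> {3, 4} \<longrightarrow> fst s' a = fst s a))"
  unfolding size_loop_def
proof (rule runs_Seq_le)
  show "runs (NAssign (NC 3) (V 0)) s 4 (\<lambda>s'. s' = ((fst s)(3 := m), snd s))"
    using assms by (intro runs_straight) simp_all
  fix s' assume s': "s' = ((fst s)(3 := m), snd s)"
  show "runs (for_loop 4 0 (NAssign (NC 3) (NPlus (V 3) (V 1)))) s' (m * (7 + 13) + 10)
    (\<lambda>s'. snd s' = snd s \<and> fst s' 3 = L \<and> (\<forall>a. a \<notin> {3, 4} \<longrightarrow> fst s' a = fst s a))"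
  proof (rule runs_for[where T = 7 and I = "\<lambda>x s'. snd s' = snd s \<and> fst s' 3 = m + x * k \<and>
      (\<forall>a. a \<notin> {3, 4} \<longrightarrow> fst s' a = fst s a)"])
    fix x s' assume "x < m" and I: "snd s' = snd s \<and> fst s' 3 = m + x * k \<and> (\<forall>a. a \<notin> {3, 4} \<longrightarrow> fst s' a = fst s a)"
      and v: "fst s' 4 = x" "fst s' 0 = m"
    have "fst s' 1 = k" using I assms(2) by simp
    then show "runs (NAssign (NC 3) (NPlus (V 3) (V 1))) s' 7 (\<lambda>s'. fst s' 4 = x \<and> fst s' 0 = m \<and>
      snd ((fst s')(4 := Suc x), snd s') = snd s \<and> fst ((fst s')(4 := Suc x), snd s') 3 = m + Suc x * k \<and>
      (\<forall>a. a \<notin> {3, 4} \<longrightarrow> fst ((fst s')(4 := Suc x), snd s') a = fst s a))"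
      using I v by (intro runs_straight) simp_all
  qed (use assms s' L in simp_all)
qed (use w_bounds in simp)

lemma runs_init_row:
  assumes base: "base s" and ij: "i < m" "j < k" "fst s 5 = m + i * k" "fst s 6 = j"
    and zero: "starsum s i j = 0" "starcard s i j = 0"
  shows "runs init_row s (200 * w) (\<lambda>s'. (\<forall>a. a \<noteq> 7 \<longrightarrow> fst s' a = fst s a) \<and>
    snd s' = (snd s)(adr L 1 (m + i * k + j) := sum (c i) {l. l < k \<and> c i l \<le> c i j},
       adr L 2 (m + i * k + j) := real (card {l. l < k \<and> c i l \<le> c i j})))"
  unfolding init_row_def
proof (rule runs_for[where T = 150 and I = "\<lambda>x s'. (\<forall>a. a \<noteq> 7 \<longrightarrow> fst s' a = fst s a) \<and>
    snd s' = (snd s)(adr L 1 (m + i * k + j) := sum (c i) {l. l < x \<and> c i l \<le> c i j},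
       adr L 2 (m + i * k + j) := real (card {l. l < x \<and> c i l \<le> c i j}))"])
  note lt = cell_less_L[OF ij(1,2)] L_pos
  fix x s'
  assume x: "x < k" and I: "(\<forall>a. a \<noteq> 7 \<longrightarrow> fst s' a = fst s a) \<and>
    snd s' = (snd s)(adr L 1 (m + i * k + j) := sum (c i) {l. l < x \<and> c i l \<le> c i j},
       adr L 2 (m + i * k + j) := real (card {l. l < x \<and> c i l \<le> c i j}))" and v: "fst s' 7 = x"
  have cells: "fst s' a = fst s a" if "a \<noteq> 7" for a using I that by blast
  have R: "snd s' = (snd s)(adr L 1 (m + i * k + j) := sum (c i) {l. l < x \<and> c i l \<le> c i j},
       adr L 2 (m + i * k + j) := real (card {l. l < x \<and> c i l \<le> c i j}))" using I by blast
  note lx = cell_less_L[OF ij(1) x]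
  show "runs (IfC (BRLess (rd 0 cur) (rd 0 (NPlus (V 5) (V 7)))) SKIP
     (Seq (RAssign (blk 1 cur) (RPlus (rd 1 cur) (rd 0 (NPlus (V 5) (V 7)))))
          (RAssign (blk 2 cur) (RPlus (rd 2 cur) (RC 1))))) s' 150
     (\<lambda>s'. fst s' 7 = x \<and> fst s' 1 = k \<and> (\<forall>a. a \<noteq> 7 \<longrightarrow> fst ((fst s')(7 := Suc x), snd s') a = fst s a) \<and>
       snd ((fst s')(7 := Suc x), snd s') = (snd s)(adr L 1 (m + i * k + j) := sum (c i) {l. l < Suc x \<and> c i l \<le> c i j},
       adr L 2 (m + i * k + j) := real (card {l. l < Suc x \<and> c i l \<le> c i j})))"
    by (intro runs_straight)
      (simp_all add: cells v R ij baseD[OF base] lt lx x Collect_less_Suc not_less fun_upd_twist fun_eq_iff)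
qed (use base zero w_bounds in \<open>auto simp: baseD fun_eq_iff\<close>)

text \<open>Each of the \<open>m * k\<close> star sums is computed from scratch in linear time; this
  is affordable once, and thereafter the sums are only corrected.\<close>

lemma runs_init_stars:
  assumes base: "base s"
  shows "runs init_stars s (500 * w ^ 3) (\<lambda>s'. frame {4,5,6,7} {1,2} s s' \<and>
    (\<forall>i<m. g s' i = 3/2 * f i) \<and> (\<forall>i<m. \<forall>j<k. starsum s' i j = sum (c i) {l. l < k \<and> c i l \<le> c i j} \<and>
      starcard s' i j = real (card {l. l < k \<and> c i l \<le> c i j})))"
  unfolding init_stars_def
proof (rule runs_site_loop[OF base, where T = "400 * w ^ 2" and I = "\<lambda>i s'. frame {4,5,6,7} {1,2} s s' \<and>
    (\<forall>i'<i. g s' i' = 3/2 * f i') \<and> (\<forall>i'<i. \<forall>j<k. starsum s' i' j = sum (c i') {l. l < k \<and> c i' l \<le> c i' j} \<and>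
      starcard s' i' j = real (card {l. l < k \<and> c i' l \<le> c i' j}))"])
  let ?rows = "\<lambda>s' i. (\<forall>i'<i. \<forall>j<k. starsum s' i' j = sum (c i') {l. l < k \<and> c i' l \<le> c i' j} \<and>
      starcard s' i' j = real (card {l. l < k \<and> c i' l \<le> c i' j}))"
  fix i s1
  assume i: "i < m" and I: "frame {4,5,6,7} {1,2} s s1 \<and> (\<forall>i'<i. g s1 i' = 3/2 * f i') \<and> ?rows s1 i"
    and b1: "base s1" and v: "fst s1 4 = i" "fst s1 5 = m + i * k"
  note si = site_less[OF i]
  show "runs (Seq (RAssign (blk 1 (V 4)) (RTimes (RC (3/2)) (rd 0 (V 4))))
     (for_loop 6 1 (Seq (RAssign (blk 1 cur) (RC 0)) (Seq (RAssign (blk 2 cur) (RC 0)) init_row)))) s1 (400 * w ^ 2)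
     (\<lambda>s''. base s'' \<and> fst s'' 4 = i \<and> fst s'' 5 = m + i * k \<and> frame {4,5,6,7} {1,2} s s'' \<and>
        (\<forall>i'<Suc i. g s'' i' = 3/2 * f i') \<and> ?rows s'' (Suc i))"
  proof (rule runs_Seq_le)
    show "runs (RAssign (blk 1 (V 4)) (RTimes (RC (3/2)) (rd 0 (V 4)))) s1 20
      (\<lambda>s'. s' = (fst s1, (snd s1)(adr L 1 i := 3/2 * f i)))"
      by (intro runs_straight) (simp_all add: v baseD[OF b1] i si of_rat_divide)
    fix s2 assume s2: "s2 = (fst s1, (snd s1)(adr L 1 i := 3/2 * f i))"
    let ?I = "\<lambda>j s'. base s' \<and> fst s' 4 = i \<and> fst s' 5 = m + i * k \<and> frame {4,5,6,7} {1,2} s s' \<and>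
        (\<forall>i'<Suc i. g s' i' = 3/2 * f i') \<and> ?rows s' i \<and>
        (\<forall>j'<j. starsum s' i j' = sum (c i) {l. l < k \<and> c i l \<le> c i j'} \<and>
          starcard s' i j' = real (card {l. l < k \<and> c i l \<le> c i j'}))"
    have rows2: "?rows s2 i"
    proof (intro allI impI)
      fix i' j assume "i' < i" "j < k"
      then have "m + i' * k + j < L" using i by (intro cell_less_L) auto
      then show "starsum s2 i' j = sum (c i') {l. l < k \<and> c i' l \<le> c i' j} \<and>
         starcard s2 i' j = real (card {l. l < k \<and> c i' l \<le> c i' j})"
        using I \<open>i' < i\<close> \<open>j < k\<close> si i by (simp add: s2)
    qed
    have fr2: "frame {4,5,6,7} {1,2} s s2" using I si by (simp add: s2)
    have b2: "base s2" by (rule base_frame[OF base fr2]) auto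
    have g2: "\<forall>i'<Suc i. g s2 i' = 3/2 * f i'"
    proof (intro allI impI)
      fix i' assume "i' < Suc i"
      then have "i' < L" using i by (intro site_less) simp
      then show "g s2 i' = 3/2 * f i'" using I si \<open>i' < Suc i\<close> by (cases "i' = i") (simp_all add: s2)
    qed
    show "runs (for_loop 6 1 (Seq (RAssign (blk 1 cur) (RC 0)) (Seq (RAssign (blk 2 cur) (RC 0)) init_row))) s2
      (k * ((20 + (20 + 200 * w)) + 13) + 10)
      (\<lambda>s''. base s'' \<and> fst s'' 4 = i \<and> fst s'' 5 = m + i * k \<and> frame {4,5,6,7} {1,2} s s'' \<and>
        (\<forall>i'<Suc i. g s'' i' = 3/2 * f i') \<and> ?rows s'' (Suc i))"
    proof (rule runs_for[where I = ?I and T = "20 + (20 + 200 * w)"])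
      fix j s' assume j: "j < k" and I': "?I j s'" and v': "fst s' 6 = j"
      note cl = cell_less_L[OF i j]
      have b': "base s'" using I' by blast
      show "runs (Seq (RAssign (blk 1 cur) (RC 0)) (Seq (RAssign (blk 2 cur) (RC 0)) init_row)) s' (20 + (20 + 200 * w))
        (\<lambda>s'. fst s' 6 = j \<and> fst s' 1 = k \<and> ?I (Suc j) ((fst s')(6 := Suc j), snd s'))"
      proof (rule runs_Seq[where R = "\<lambda>s''. s'' = (fst s', (snd s')(adr L 1 (m + i * k + j) := 0))"], goal_cases)
        case 1 show ?case using I' by (intro runs_straight) (simp_all add: v' baseD[OF b'])
      next
        case (2 s3)
        show ?case
        proof (rule runs_Seq[where R = "\<lambda>s''. s'' = (fst s', (snd s')(adr L 1 (m + i * k + j) := 0, adr L 2 (m + i * k + j) := 0))"], goal_cases)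
          case 1 show ?case using I' by (intro runs_straight) (simp_all add: 2 v' baseD[OF b'])
        next
          case (2 s4)
          have fr4: "frame {4,5,6,7} {1,2} s s4" using I' cl by (simp add: 2)
          have b4: "base s4" by (rule base_frame[OF base fr4]) auto
          have "runs init_row s4 (200 * w) (\<lambda>s'. (\<forall>a. a \<noteq> 7 \<longrightarrow> fst s' a = fst s4 a) \<and>
            snd s' = (snd s4)(adr L 1 (m + i * k + j) := sum (c i) {l. l < k \<and> c i l \<le> c i j},
             adr L 2 (m + i * k + j) := real (card {l. l < k \<and> c i l \<le> c i j})))"
            using I' cl by (intro runs_init_row b4 i j) (simp_all add: 2 v')
          then show ?case
          proof (rule runs_mono)
            fix s5 assume 5: "(\<forall>a. a \<noteq> 7 \<longrightarrow> fst s5 a = fst s4 a) \<and>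
              snd s5 = (snd s4)(adr L 1 (m + i * k + j) := sum (c i) {l. l < k \<and> c i l \<le> c i j},
               adr L 2 (m + i * k + j) := real (card {l. l < k \<and> c i l \<le> c i j}))"
            then have R5: "snd s5 = (snd s')(adr L 1 (m + i * k + j) := sum (c i) {l. l < k \<and> c i l \<le> c i j},
               adr L 2 (m + i * k + j) := real (card {l. l < k \<and> c i l \<le> c i j}))"
              using cl by (simp add: 2 fun_eq_iff)
            have c5: "fst s5 a = fst s' a" if "a \<noteq> 7" for a using 5 that by (simp add: 2)
            have "frame {4,5,6,7} {1,2} s s'" using I' by blast
            then have "frame {4,5,6,7} {1,2} s (fst s5, snd s')" by (simp add: frame_def c5)
            then have "frame {4,5,6,7} {1,2} s (fst s5, snd s5)" using cl unfolding R5 by simp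
            then have fr5: "frame {4,5,6,7} {1,2} s s5" by simp
            have b5: "base s5" by (rule base_frame[OF base fr5]) auto
            have g5: "\<forall>i'<Suc i. g s5 i' = 3/2 * f i'"
            proof (intro allI impI)
              fix i' assume i': "i' < Suc i"
              then have "i' < L" "i' < m" using i site_less[of i'] by simp_all
              then show "g s5 i' = 3/2 * f i'" using I' cl i' by (simp add: R5)
            qed
            have r5: "starsum s5 i' j' = (if i' = i \<and> j' = j then sum (c i) {l. l < k \<and> c i l \<le> c i j} else starsum s' i' j')"
              "starcard s5 i' j' = (if i' = i \<and> j' = j then real (card {l. l < k \<and> c i l \<le> c i j}) else starcard s' i' j')"
              if "i' < m" "j' < k" for i' j'
              using cell_less_L[OF that] cl j that by (auto simp: R5)
            have rows5: "?rows s5 i" using I' i r5 by simp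
            have row5: "\<forall>j'<Suc j. starsum s5 i j' = sum (c i) {l. l < k \<and> c i l \<le> c i j'} \<and>
              starcard s5 i j' = real (card {l. l < k \<and> c i l \<le> c i j'})"
              using I' i j r5 by (auto simp: less_Suc_eq)
            show "fst s5 6 = j \<and> fst s5 1 = k \<and> ?I (Suc j) ((fst s5)(6 := Suc j), snd s5)"
              using I' fr5 b5 g5 rows5 row5 v' by (simp add: c5 baseD[OF b'])
          qed simp
        qed
      qed
    next
      show "?I 0 ((fst s2)(6 := 0), snd s2)"
        using rows2 fr2 b2 g2 v by (simp add: s2)
      show "fst s2 1 = k" using b2 by (simp add: baseD)
    qed (auto simp: less_Suc_eq)
  next
    have "k * (40 + 200 * w + 13) + 30 \<le> 400 * w ^ Suc 1"
      using w_bounds by (intro loop_cost[where b = 253 and e = 1]) simp_all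
    then show "20 + (k * (20 + (20 + 200 * w) + 13) + 10) \<le> 400 * w ^ 2"
      by (simp only: Suc_1) simp
  qed
next
  have "m * (400 * w ^ 2 + 20) + 15 \<le> 500 * w ^ Suc 2"
    using w_bounds w_powers(2) by (intro loop_cost[where b = 420]) linarith+
  then show "m * (400 * w ^ 2 + 20) + 15 \<le> 500 * w ^ 3" by (simp add: numeral_3_eq_3 numeral_2_eq_2)
qed auto

lemma runs_init_clients:
  assumes base: "base s"
  shows "runs init_clients s (100 * w) (\<lambda>s'. frame {6} {3,4} s s' \<and> (\<forall>j<k. D s' j = -1 \<and> sg s' j = 0))"
  unfolding init_clients_def
proof (rule runs_for[where T = 60 and I = "\<lambda>x s'. frame {6} {3,4} s s' \<and> (\<forall>j<x. D s' j = -1 \<and> sg s' j = 0)"])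
  fix x s' assume x: "x < k" and I: "frame {6} {3,4} s s' \<and> (\<forall>j<x. D s' j = -1 \<and> sg s' j = 0)" and v: "fst s' 6 = x"
  have b: "base s'" using I by (intro base_frame[OF base, of "{6}" "{3,4}"]) auto
  have lt: "j < L" if "j < Suc x" for j using that x by (intro client_less) simp
  show "runs (Seq (RAssign (blk 3 (V 6)) (RC (-1))) (RAssign (blk 4 (V 6)) (RC 0))) s' 60
    (\<lambda>s'. fst s' 6 = x \<and> fst s' 1 = k \<and> frame {6} {3,4} s ((fst s')(6 := Suc x), snd s') \<and>
      (\<forall>j<Suc x. D ((fst s')(6 := Suc x), snd s') j = -1 \<and> sg ((fst s')(6 := Suc x), snd s') j = 0))"
    using I lt by (intro runs_straight) (simp_all add: v baseD[OF b] less_Suc_eq)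
qed (use base w_bounds in \<open>auto simp: baseD\<close>)

end

context uftra_run
begin

lemma runs_update_stars:
  assumes base: "base s" and j: "j < k" "fst s 6 = j"
  shows "runs update_stars s (300 * w ^ 2) (\<lambda>s'. frame {4,5,7} {1,2} s s' \<and> (\<forall>i<m. g s' i = g s i) \<and>
    (\<forall>i<m. \<forall>l<k. starsum s' i l = starsum s i l - (if c i j \<le> c i l then c i j else 0) \<and>
      starcard s' i l = starcard s i l - (if c i j \<le> c i l then 1 else 0)))"
  unfolding update_stars_def
proof (rule runs_site_loop[OF base, where T = "200 * w" and I = "\<lambda>i s'. frame {4,5,7} {1,2} s s' \<and>
    (\<forall>i<m. g s' i = g s i) \<and>
    (\<forall>i'<m. \<forall>l<k. starsum s' i' l = starsum s i' l - (if i' < i \<and> c i' j \<le> c i' l then c i' j else 0) \<and>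
      starcard s' i' l = starcard s i' l - (if i' < i \<and> c i' j \<le> c i' l then 1 else 0))"])
  let ?J = "\<lambda>i x s'. frame {4,5,7} {1,2} s s' \<and> (\<forall>i<m. g s' i = g s i) \<and>
    (\<forall>i'<m. \<forall>l<k. starsum s' i' l = starsum s i' l - (if (i' < i \<or> i' = i \<and> l < x) \<and> c i' j \<le> c i' l then c i' j else 0) \<and>
      starcard s' i' l = starcard s i' l - (if (i' < i \<or> i' = i \<and> l < x) \<and> c i' j \<le> c i' l then 1 else 0))"
  fix i s1
  assume i: "i < m" and I: "frame {4,5,7} {1,2} s s1 \<and> (\<forall>i<m. g s1 i = g s i) \<and>
    (\<forall>i'<m. \<forall>l<k. starsum s1 i' l = starsum s i' l - (if i' < i \<and> c i' j \<le> c i' l then c i' j else 0) \<and>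
      starcard s1 i' l = starcard s i' l - (if i' < i \<and> c i' j \<le> c i' l then 1 else 0))"
    and b1: "base s1" and v: "fst s1 4 = i" "fst s1 5 = m + i * k"
  show "runs (for_loop 7 1 (IfC (BRLess (rd 0 (NPlus (V 5) (V 7))) (rd 0 cur)) SKIP
     (Seq (RAssign (blk 1 (NPlus (V 5) (V 7))) (RMinus (rd 1 (NPlus (V 5) (V 7))) (rd 0 cur)))
          (RAssign (blk 2 (NPlus (V 5) (V 7))) (RMinus (rd 2 (NPlus (V 5) (V 7))) (RC 1)))))) s1 (200 * w)
     (\<lambda>s''. base s'' \<and> fst s'' 4 = i \<and> fst s'' 5 = m + i * k \<and> frame {4,5,7} {1,2} s s'' \<and>
       (\<forall>i<m. g s'' i = g s i) \<and>
       (\<forall>i'<m. \<forall>l<k. starsum s'' i' l = starsum s i' l - (if i' < Suc i \<and> c i' j \<le> c i' l then c i' j else 0) \<and>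
         starcard s'' i' l = starcard s i' l - (if i' < Suc i \<and> c i' j \<le> c i' l then 1 else 0)))"
  proof (rule runs_for[where T = 150 and I = "\<lambda>x s'. fst s' 4 = i \<and> fst s' 5 = m + i * k \<and> ?J i x s'"])
    fix x s' assume x: "x < k" and J: "fst s' 4 = i \<and> fst s' 5 = m + i * k \<and> ?J i x s'" and v': "fst s' 7 = x"
    have fr: "frame {4,5,7} {1,2} s s'" and v4: "fst s' 4 = i" "fst s' 5 = m + i * k" using J by blast+
    have b': "base s'" by (rule base_frame[OF base fr]) auto
    have v6: "fst s' 6 = j" using frame_fst[OF fr, of 6] j by simp
    note lt = cell_less_L[OF i x] cell_less_L[OF i j(1)]
    have gs: "\<forall>i<m. g s' i = g s i" using J by blast
    have st: "starsum s' i' l = starsum s i' l - (if (i' < i \<or> i' = i \<and> l < x) \<and> c i' j \<le> c i' l then c i' j else 0)"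
      "starcard s' i' l = starcard s i' l - (if (i' < i \<or> i' = i \<and> l < x) \<and> c i' j \<le> c i' l then 1 else 0)"
      if "i' < m" "l < k" for i' l using J that by blast+
    note ev = v4 v6 v' baseD[OF b'] lt x i j(1)
    let ?p = "IfC (BRLess (rd 0 (NPlus (V 5) (V 7))) (rd 0 cur)) SKIP
     (Seq (RAssign (blk 1 (NPlus (V 5) (V 7))) (RMinus (rd 1 (NPlus (V 5) (V 7))) (rd 0 cur)))
          (RAssign (blk 2 (NPlus (V 5) (V 7))) (RMinus (rd 2 (NPlus (V 5) (V 7))) (RC 1))))"
    have eff: "effect ?p s' = (if c i j \<le> c i x then (fst s', (snd s')(adr L 1 (m + i * k + x) := starsum s' i x - c i j,
        adr L 2 (m + i * k + x) := starcard s' i x - 1)) else s')"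
      by (simp add: ev not_less)
    have "fst (effect ?p s') 7 = x \<and> fst (effect ?p s') 1 = k \<and> (fst (effect ?p s') 4 = i \<and> fst (effect ?p s') 5 = m + i * k \<and>
      ?J i (Suc x) ((fst (effect ?p s'))(7 := Suc x), snd (effect ?p s')))"
    proof (intro conjI allI impI)
      show "fst (effect ?p s') 7 = x" "fst (effect ?p s') 1 = k" "fst (effect ?p s') 4 = i" "fst (effect ?p s') 5 = m + i * k"
        unfolding eff by (simp_all add: ev)
      show "frame {4,5,7} {1,2} s ((fst (effect ?p s'))(7 := Suc x), snd (effect ?p s'))"
        unfolding eff using fr lt by simp
      fix i' assume i': "i' < m"
      show "g ((fst (effect ?p s'))(7 := Suc x), snd (effect ?p s')) i' = g s i'"
        unfolding eff using gs lt i' site_less[OF i'] by simp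
      fix l assume l: "l < k"
      note ll = cell_less_L[OF i' l]
      have new: "starsum ((fst (effect ?p s'))(7 := Suc x), snd (effect ?p s')) i' l =
          (if c i j \<le> c i x \<and> i' = i \<and> l = x then starsum s' i x - c i j else starsum s' i' l)"
        "starcard ((fst (effect ?p s'))(7 := Suc x), snd (effect ?p s')) i' l =
          (if c i j \<le> c i x \<and> i' = i \<and> l = x then starcard s' i x - 1 else starcard s' i' l)"
        unfolding eff using lt ll x l by simp_all
      show "starsum ((fst (effect ?p s'))(7 := Suc x), snd (effect ?p s')) i' l =
          starsum s i' l - (if (i' < i \<or> i' = i \<and> l < Suc x) \<and> c i' j \<le> c i' l then c i' j else 0)"
        unfolding new using st[OF i' l] by (auto simp: less_Suc_eq)
      show "starcard ((fst (effect ?p s'))(7 := Suc x), snd (effect ?p s')) i' l =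
          starcard s i' l - (if (i' < i \<or> i' = i \<and> l < Suc x) \<and> c i' j \<le> c i' l then 1 else 0)"
        unfolding new using st[OF i' l] by (auto simp: less_Suc_eq)
    qed
    then show "runs ?p s' 150 (\<lambda>s'. fst s' 7 = x \<and> fst s' 1 = k \<and> fst ((fst s')(7 := Suc x), snd s') 4 = i \<and>
      fst ((fst s')(7 := Suc x), snd s') 5 = m + i * k \<and> ?J i (Suc x) ((fst s')(7 := Suc x), snd s'))"
      by (intro runs_straight) simp_all
  next
    show "fst ((fst s1)(7 := 0), snd s1) 4 = i \<and> fst ((fst s1)(7 := 0), snd s1) 5 = m + i * k \<and> ?J i 0 ((fst s1)(7 := 0), snd s1)"
      using I v by simp
    fix s' assume J: "fst s' 4 = i \<and> fst s' 5 = m + i * k \<and> ?J i k s'"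
    then have "frame {4,5,7} {1,2} s s'" by blast
    then have "base s'" by (rule base_frame[OF base]) auto
    then show "base s' \<and> fst s' 4 = i \<and> fst s' 5 = m + i * k \<and> frame {4,5,7} {1,2} s s' \<and>
       (\<forall>i<m. g s' i = g s i) \<and>
       (\<forall>i'<m. \<forall>l<k. starsum s' i' l = starsum s i' l - (if i' < Suc i \<and> c i' j \<le> c i' l then c i' j else 0) \<and>
         starcard s' i' l = starcard s i' l - (if i' < Suc i \<and> c i' j \<le> c i' l then 1 else 0))"
      using J by (simp add: less_Suc_eq)
  qed (use b1 w_bounds in \<open>simp_all add: baseD\<close>)
next
  have "m * (200 * w + 20) + 15 \<le> 300 * w ^ Suc 1"
    using w_bounds by (intro loop_cost[where b = 220]) simp_all
  then show "m * (200 * w + 20) + 15 \<le> 300 * w ^ 2" by (simp only: Suc_1)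
qed auto

definition unconnected :: "state \<Rightarrow> nat" where
  "unconnected s = card {j. j < k \<and> D s j < 0}"

text \<open>Client \<open>j\<close> belongs to the star of threshold \<open>l\<close> exactly if
  \<open>c i j \<le> c i l\<close>, whether or not \<open>l\<close> itself is still unconnected. So
  the correction depends on distances alone and can be made for all \<open>l\<close>.\<close>

lemma stars_ok_connect:
  assumes ok: "stars_ok s" and j: "j < k" "D s j < 0" "0 \<le> D s' j"
    and other: "\<And>l. l < k \<Longrightarrow> l \<noteq> j \<Longrightarrow> D s' l < 0 \<longleftrightarrow> D s l < 0"
    and upd: "\<And>i l. i < m \<Longrightarrow> l < k \<Longrightarrow> starsum s' i l = starsum s i l - (if c i j \<le> c i l then c i j else 0) \<and>
      starcard s' i l = starcard s i l - (if c i j \<le> c i l then 1 else 0)"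
  shows "stars_ok s'"
  unfolding stars_ok_def
proof (intro allI impI)
  fix i l assume i: "i < m" and l: "l < k"
  have star: "star k c (D s') i l = star k c (D s) i l - {j}"
    using j other by (auto simp: star_def)
  have fin: "finite (star k c (D s) i l)" by (simp add: star_def)
  have mem: "j \<in> star k c (D s) i l \<longleftrightarrow> c i j \<le> c i l" using j by (simp add: star_def)
  have cardr: "real (card (star k c (D s) i l - {j})) = real (card (star k c (D s) i l)) - (if c i j \<le> c i l then 1 else 0)"
  proof (cases "c i j \<le> c i l")
    case True
    then have "card (star k c (D s) i l) = Suc (card (star k c (D s) i l - {j}))"
      using mem fin by (intro card.remove) auto
    then show ?thesis using True by simp
  next
    case False
    then show ?thesis using mem by simp
  qed
  show "starsum s' i l = sum (c i) (star k c (D s') i l) \<and> starcard s' i l = real (card (star k c (D s') i l))"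
    using upd[OF i l] ok[unfolded stars_ok_def, rule_format, OF i l] cardr mem fin
    unfolding star by (simp add: sum_diff1)
qed

definition unconn_cost :: "state \<Rightarrow> nat" where
  "unconn_cost s = 300 * w ^ 2 * unconnected s"

definition connected_upto :: "nat \<Rightarrow> nat \<Rightarrow> real \<Rightarrow> state \<Rightarrow> state \<Rightarrow> bool" where
  "connected_upto x bi th s s' \<longleftrightarrow> frame {4,5,6,7} {1,2,3,4} s s' \<and> (\<forall>i<m. g s' i = g s i) \<and> stars_ok s' \<and>
     (\<forall>j<k. D s' j = (if j < x \<and> ((D s j < 0 \<and> c bi j \<le> th) \<or> c bi j < D s j) then c bi j else D s j)) \<and>
     (\<forall>j<k. sg s' j = (if j < x \<and> ((D s j < 0 \<and> c bi j \<le> th) \<or> c bi j < D s j) then real bi else sg s j))"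

lemma connected_upto_upd [simp]:
  "connected_upto x bi th s (n(6 := y), R) \<longleftrightarrow> connected_upto x bi th s (n, R)"
  by (simp add: connected_upto_def stars_ok_def)

text \<open>The bound is linear because \<open>update_stars\<close> is charged to the potential:
  each call connects one more client for good, which lowers \<open>unconn_cost\<close> by the cost
  of the call.\<close>

lemma pruns_connect_loop:
  assumes base: "base s" and ok: "stars_ok s" and bi: "bi < m" "fst s 9 = bi" "fst s 10 = m + bi * k"
    and th: "snd s (adr L 6 0) = th"
  shows "pruns unconn_cost connect_loop s (300 * w) (connected_upto k bi th s)"
  unfolding connect_loop_def
proof (rule pruns_for[where T = 250 and I = "\<lambda>x. connected_upto x bi th s"])
  fix x s'
  assume x: "x < k" and P: "connected_upto x bi th s s'" and v: "fst s' 6 = x"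
  have fr: "frame {4,5,6,7} {1,2,3,4} s s'" and gs: "\<And>i. i < m \<Longrightarrow> g s' i = g s i" and ok': "stars_ok s'"
    and Ds: "\<And>j. j < k \<Longrightarrow> D s' j = (if j < x \<and> ((D s j < 0 \<and> c bi j \<le> th) \<or> c bi j < D s j) then c bi j else D s j)"
    and Ss: "\<And>j. j < k \<Longrightarrow> sg s' j = (if j < x \<and> ((D s j < 0 \<and> c bi j \<le> th) \<or> c bi j < D s j) then real bi else sg s j)"
    using P unfolding connected_upto_def by blast+
  have b': "base s'" by (rule base_frame[OF base fr]) auto
  have cells: "fst s' 9 = bi" "fst s' 10 = m + bi * k" using frame_fst[OF fr, of 9] frame_fst[OF fr, of 10] bi by simp_all
  have th': "snd s' (adr L 6 0) = th" using frame_snd[OF fr _ L_pos, of 6] th by simp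
  have Dx: "D s' x = D s x" using Ds[OF x] by simp
  have cx: "0 \<le> c bi x" by (rule c[OF bi(1) x])
  note lx = client_less[OF x] cell_less_L[OF bi(1) x]
  note ev = v cells th' Dx baseD[OF b'] bi(1) x lx L_pos
  define s2 where "s2 = (fst s', (snd s')(adr L 3 x := c bi x, adr L 4 x := real bi))"
  have assign: "runs assign_best s' 60 (\<lambda>t. t = s2)"
    unfolding assign_best_def s2_def by (rule runs_straight) (simp_all add: ev)
  have fr2: "frame {4,5,6,7} {1,2,3,4} s s2" using fr lx by (simp add: s2_def)
  have b2: "base s2" by (rule base_frame[OF base fr2]) auto
  have rd2: "D s2 j = (if j = x then c bi x else D s' j)" "sg s2 j = (if j = x then real bi else sg s' j)"
    if "j < k" for j using client_less[OF that] lx by (auto simp: s2_def)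
  have g2: "g s2 i = g s i" if "i < m" for i using gs[OF that] site_less[OF that] lx by (simp add: s2_def)
  have st2: "starsum s2 i l = starsum s' i l" "starcard s2 i l = starcard s' i l" if "i < m" "l < k" for i l
    using cell_less_L[OF that] lx by (simp_all add: s2_def)
  let ?q = "IfC (BAnd (BRLess (rd 3 (V 6)) (RC 0)) (BNot (BRLess (rd 6 (NC 0)) (rd 0 best_cell))))
        (Seq assign_best update_stars) SKIP"
  let ?R = "\<lambda>s'. fst s' 6 = x \<and> fst s' 1 = k \<and> connected_upto (Suc x) bi th s ((fst s')(6 := Suc x), snd s')"
  consider "c bi x < D s x" | "\<not> c bi x < D s x" "D s x < 0" "c bi x \<le> th"
    | "\<not> c bi x < D s x" "\<not> (D s x < 0 \<and> c bi x \<le> th)" by blast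
  then show "pruns unconn_cost (IfC (BRLess (rd 0 best_cell) (rd 3 (V 6))) assign_best ?q) s' 250 ?R"
  proof cases
    case 1
    \<comment> \<open>Only a connected client can satisfy the first test, since the mark -1 is below
      \<open>c bi x\<close>. Switching keeps it connected, so no star changes.\<close>
    have same: "D s2 j < 0 \<longleftrightarrow> D s' j < 0" if "j < k" for j using rd2[OF that] cx 1 Dx by auto
    have "star k c (D s2) i j = star k c (D s') i j" for i j using same by (intro star_cong) auto
    then have ok2: "stars_ok s2" using ok' st2 by (simp add: stars_ok_def)
    have un: "unconn_cost s2 = unconn_cost s'"
      unfolding unconn_cost_def unconnected_def
      using same by (intro arg_cong[of _ _ "\<lambda>A. 300 * w ^ 2 * card A"]) auto
    have "connected_upto (Suc x) bi th s s2"
      unfolding connected_upto_def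
    proof (intro conjI allI impI)
      show "D s2 j = (if j < Suc x \<and> ((D s j < 0 \<and> c bi j \<le> th) \<or> c bi j < D s j) then c bi j else D s j)"
        if "j < k" for j using rd2(1)[OF that] Ds[OF that] 1 by (auto simp: less_Suc_eq)
      show "sg s2 j = (if j < Suc x \<and> ((D s j < 0 \<and> c bi j \<le> th) \<or> c bi j < D s j) then real bi else sg s j)"
        if "j < k" for j using rd2(2)[OF that] Ss[OF that] 1 by (auto simp: less_Suc_eq)
    qed (use fr2 g2 ok2 in auto)
    then have R2: "?R s2" using v baseD[OF b2] by (simp add: s2_def)
    show ?thesis
    proof (rule runs_IfT)
      show "bval (BRLess (rd 0 best_cell) (rd 3 (V 6))) s'" using 1 by (simp add: ev)
      show "pruns unconn_cost assign_best s' 60 ?R"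
        by (rule pruns_of_runs[OF runs_mono[OF assign order_refl]]) (use R2 un in simp)
    qed simp
  next
    case 2
    have "runs update_stars s2 (300 * w ^ 2) (\<lambda>s3. frame {4,5,7} {1,2} s2 s3 \<and> (\<forall>i<m. g s3 i = g s2 i) \<and>
      (\<forall>i<m. \<forall>l<k. starsum s3 i l = starsum s2 i l - (if c i x \<le> c i l then c i x else 0) \<and>
       starcard s3 i l = starcard s2 i l - (if c i x \<le> c i l then 1 else 0)))"
      by (rule runs_update_stars[OF b2 x]) (simp add: s2_def v)
    then have 3: "runs update_stars s2 (300 * w ^ 2) (\<lambda>s3. 300 * w ^ 2 + unconn_cost s3 \<le> unconn_cost s' \<and> ?R s3)"
    proof (rule runs_mono)
      fix s3 assume 3: "frame {4,5,7} {1,2} s2 s3 \<and> (\<forall>i<m. g s3 i = g s2 i) \<and>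
        (\<forall>i<m. \<forall>l<k. starsum s3 i l = starsum s2 i l - (if c i x \<le> c i l then c i x else 0) \<and>
         starcard s3 i l = starcard s2 i l - (if c i x \<le> c i l then 1 else 0))"
      then have fr23: "frame {4,5,7} {1,2} s2 s3" by blast
      have fr3: "frame {4,5,6,7} {1,2,3,4} s s3" by (rule frame_trans[OF fr2 fr23]) auto
      have b3: "base s3" by (rule base_frame[OF base fr3]) auto
      have rd3: "D s3 j = (if j = x then c bi x else D s' j)" "sg s3 j = (if j = x then real bi else sg s' j)"
        if "j < k" for j
        using rd2[OF that] frame_snd[OF fr23 _ client_less[OF that], of 3] frame_snd[OF fr23 _ client_less[OF that], of 4]
        by simp_all
      have ok3: "stars_ok s3"
      proof (rule stars_ok_connect[OF ok' x])
        show "D s' x < 0" using Dx 2 by simp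
        show "0 \<le> D s3 x" using rd3[OF x] cx by simp
        show "D s3 l < 0 \<longleftrightarrow> D s' l < 0" if "l < k" "l \<noteq> x" for l using rd3 that by simp
        show "starsum s3 i l = starsum s' i l - (if c i x \<le> c i l then c i x else 0) \<and>
           starcard s3 i l = starcard s' i l - (if c i x \<le> c i l then 1 else 0)" if "i < m" "l < k" for i l
          using 3 st2[OF that] that by simp
      qed
      have "{j. j < k \<and> D s' j < 0} = insert x {j. j < k \<and> D s3 j < 0}"
        using rd3(1) x 2 Dx cx by (auto split: if_splits)
      moreover have "x \<notin> {j. j < k \<and> D s3 j < 0}" using rd3(1)[OF x] cx by simp
      ultimately have un: "unconnected s' = Suc (unconnected s3)" unfolding unconnected_def by simp
      have "connected_upto (Suc x) bi th s s3"
        unfolding connected_upto_def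
      proof (intro conjI allI impI)
        show "D s3 j = (if j < Suc x \<and> ((D s j < 0 \<and> c bi j \<le> th) \<or> c bi j < D s j) then c bi j else D s j)"
          if "j < k" for j using rd3(1)[OF that] Ds[OF that] 2 by (auto simp: less_Suc_eq)
        show "sg s3 j = (if j < Suc x \<and> ((D s j < 0 \<and> c bi j \<le> th) \<or> c bi j < D s j) then real bi else sg s j)"
          if "j < k" for j using rd3(2)[OF that] Ss[OF that] 2 by (auto simp: less_Suc_eq)
      qed (use fr3 3 g2 ok3 in auto)
      moreover have "fst s3 6 = x" using frame_fst[OF fr23, of 6] v by (simp add: s2_def)
      ultimately show "300 * w ^ 2 + unconn_cost s3 \<le> unconn_cost s' \<and> ?R s3"
        using un baseD[OF b3] by (simp add: unconn_cost_def)
    qed simp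
    have 4: "runs (Seq assign_best update_stars) s' (60 + 300 * w ^ 2)
       (\<lambda>s3. 300 * w ^ 2 + unconn_cost s3 \<le> unconn_cost s' \<and> ?R s3)"
      by (rule runs_Seq[OF assign]) (use 3 in simp)
    show ?thesis
    proof (rule runs_IfF)
      show "\<not> bval (BRLess (rd 0 best_cell) (rd 3 (V 6))) s'" using 2 by (simp add: ev)
      show "pruns unconn_cost ?q s' 160 ?R"
      proof (rule runs_IfT)
        show "bval (BAnd (BRLess (rd 3 (V 6)) (RC 0)) (BNot (BRLess (rd 6 (NC 0)) (rd 0 best_cell)))) s'"
          using 2 by (simp add: ev)
        show "pruns unconn_cost (Seq assign_best update_stars) s' 60 ?R"
          by (rule pruns_of_runs[OF runs_mono[OF 4 order_refl]]) simp
      qed simp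
    qed simp
  next
    case 3
    have "connected_upto (Suc x) bi th s s'"
      unfolding connected_upto_def
    proof (intro conjI allI impI)
      show "D s' j = (if j < Suc x \<and> ((D s j < 0 \<and> c bi j \<le> th) \<or> c bi j < D s j) then c bi j else D s j)"
        if "j < k" for j using Ds[OF that] 3 by (auto simp: less_Suc_eq)
      show "sg s' j = (if j < Suc x \<and> ((D s j < 0 \<and> c bi j \<le> th) \<or> c bi j < D s j) then real bi else sg s j)"
        if "j < k" for j using Ss[OF that] 3 by (auto simp: less_Suc_eq)
    qed (use fr gs ok' in auto)
    then have R': "?R s'" using v baseD[OF b'] by simp
    have skip: "pruns unconn_cost SKIP s' 1 ?R"
      by (rule pruns_of_runs, rule runs_straight[where T = 1]) (use R' in simp_all)
    show ?thesis
    proof (rule runs_IfF)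
      show "\<not> bval (BRLess (rd 0 best_cell) (rd 3 (V 6))) s'" using 3 by (simp add: ev)
      show "pruns unconn_cost ?q s' 100 ?R"
        by (rule runs_IfF[OF _ skip]) (use 3 in \<open>auto simp: ev\<close>)
    qed simp
  qed
next
  show "connected_upto 0 bi th s ((fst s)(6 := 0), snd s)"
    unfolding connected_upto_upd prod.collapse using ok by (simp add: connected_upto_def)
  show "unconn_cost ((fst s)(6 := x), snd s) = unconn_cost s" for s x
    by (simp add: unconn_cost_def unconnected_def)
  show "k * (250 + 13) + 10 \<le> 300 * w" using w_bounds by simp
qed (use base in \<open>simp_all add: baseD\<close>)

end

subsection \<open>The greedy phase and the augmentation phase\<close>

text \<open>Further cells: 8 tells whether a candidate has been found, 9 is its site, 10 the offset of the
  row of that site, 11 the threshold client, 12 the outer loop counter. Real scalars occupy offset 0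
  of a block: 5 the saving, 6 and 7 the data of the best candidate.\<close>

definition try_star :: com where
  "try_star = IfC (BRLess (rd 3 (V 6)) (RC 0))
     (Seq (RAssign (blk 7 (NC 0)) (RDiv (RPlus (RMinus (rd 1 (V 4)) (rd 5 (NC 0))) (rd 1 cur)) (rd 2 cur)))
       (IfC (BNot (BAnd (BNot (BNLess (V 8) (NC 1))) (BNot (BRLess (rd 7 (NC 0)) (rd 6 (NC 0))))))
         (Seq (RAssign (blk 6 (NC 0)) (rd 7 (NC 0))) (Seq (NAssign (NC 9) (V 4)) (Seq (NAssign (NC 10) (V 5))
           (Seq (NAssign (NC 11) (V 6)) (NAssign (NC 8) (NC 1)))))) SKIP)) SKIP"

definition find_star :: com where
  "find_star = Seq (NAssign (NC 8) (NC 0)) (site_loop (Seq saving_prog (for_loop 6 1 try_star)))"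

text \<open>The residual cost becomes 0, so the site can be used again for free. The ratio in block
  6 is replaced by the threshold distance, which is what \<open>connect_loop\<close> reads
  there.\<close>

definition open_best :: com where
  "open_best = Seq (RAssign (blk 1 (V 9)) (RC 0)) (RAssign (blk 6 (NC 0)) (rd 0 (NPlus (V 10) (V 11))))"

definition greedy_phase :: com where
  "greedy_phase = for_loop 12 1 (Seq find_star
     (IfC (BNLess (NC 0) (V 8)) (Seq open_best connect_loop) SKIP))"

definition try_site :: com where
  "try_site = IfC (BAnd (BRLess (rd 0 (V 4)) (rd 5 (NC 0))) (BNot (BAnd (BNot (BNLess (V 8) (NC 1)))
       (BNot (BRLess (RTimes (rd 6 (NC 0)) (rd 0 (V 4))) (RTimes (rd 5 (NC 0)) (rd 7 (NC 0))))))))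
     (Seq (RAssign (blk 6 (NC 0)) (rd 5 (NC 0))) (Seq (RAssign (blk 7 (NC 0)) (rd 0 (V 4)))
       (Seq (NAssign (NC 9) (V 4)) (Seq (NAssign (NC 10) (V 5)) (NAssign (NC 8) (NC 1)))))) SKIP"

definition find_site :: com where
  "find_site = Seq (NAssign (NC 8) (NC 0)) (site_loop (Seq saving_prog try_site))"

definition aug_phase :: com where
  "aug_phase = for_loop 12 0 (Seq find_site (IfC (BNLess (NC 0) (V 8)) connect_loop SKIP))"

text \<open>Transitivity of comparing the ratios a / x, b / y, d / z after cross-multiplication. The
  denominators are opening costs and may be 0, so the positive middle saving \<open>b\<close> is
  cancelled instead.\<close>

lemma saving_ratio_trans:
  fixes a :: real
  assumes "0 < b" "0 \<le> a" "0 \<le> d" "a * y \<le> b * x" "b * z \<le> d * y"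
  shows "a * z \<le> d * x"
proof -
  have "b * (a * z) \<le> a * (d * y)" using mult_left_mono[OF assms(5,2)] by (simp add: mult_ac)
  also have "\<dots> \<le> d * (b * x)" using mult_left_mono[OF assms(4,3)] by (simp add: mult_ac)
  finally have "b * (a * z) \<le> b * (d * x)" by (simp add: mult_ac)
  then show ?thesis using assms(1) by simp
qed

(* keeps the block number in g s = (\<lambda>i. snd s (adr L 1 i)) in one normal form *)
declare One_nat_def [simp del]

context uftra_run
begin

text \<open>\<open>P\<close> describes the pairs inspected so far. All ratios refer to the state
  \<open>s\<close> before the search, whose blocks 1 and 3 the search leaves intact.\<close>

definition best_star :: "state \<Rightarrow> (nat \<Rightarrow> nat \<Rightarrow> bool) \<Rightarrow> state \<Rightarrow> bool" where
  "best_star s P s' \<longleftrightarrow> (if fst s' 8 = 0 then \<forall>i<m. \<forall>j<k. P i j \<longrightarrow> 0 \<le> D s j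
     else fst s' 9 < m \<and> fst s' 10 = m + fst s' 9 * k \<and> fst s' 11 < k \<and> D s (fst s' 11) < 0 \<and>
       snd s' (adr L 6 0) = star_ratio k c (D s) (g s) (fst s' 9) (fst s' 11) \<and>
       (\<forall>i<m. \<forall>j<k. P i j \<longrightarrow> D s j < 0 \<longrightarrow> snd s' (adr L 6 0) \<le> star_ratio k c (D s) (g s) i j))"

lemma best_star_frame:
  assumes "best_star s P s'" "frame A B s' t" "A \<inter> {8,9,10,11} = {}" "6 \<notin> B"
  shows "best_star s P t"
proof -
  have eqs: "fst t 8 = fst s' 8" "fst t 9 = fst s' 9" "fst t 10 = fst s' 10" "fst t 11 = fst s' 11"
    "snd t (adr L 6 0) = snd s' (adr L 6 0)"
    using frame_fst[OF assms(2)] frame_snd[OF assms(2,4) L_pos] assms(3) by simp_all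
  show ?thesis using assms(1) unfolding best_star_def eqs .
qed

lemma best_star_mono:
  "best_star s P s' \<Longrightarrow> (\<And>i j. i < m \<Longrightarrow> j < k \<Longrightarrow> P' i j \<Longrightarrow> P i j) \<Longrightarrow> best_star s P' s'"
  unfolding best_star_def by (cases "fst s' 8 = 0") auto

lemma best_star_none:
  "best_star s P s' \<Longrightarrow> fst s' 8 = 0 \<Longrightarrow> i < m \<Longrightarrow> j < k \<Longrightarrow> P i j \<Longrightarrow> 0 \<le> D s j"
  unfolding best_star_def by simp

lemma best_star_le:
  assumes "best_star s P s'" "fst s' 8 \<noteq> 0" "i < m" "j < k" "P i j" "D s j < 0"
  shows "snd s' (adr L 6 0) \<le> star_ratio k c (D s) (g s) i j"
proof -
  have "\<forall>i<m. \<forall>j<k. P i j \<longrightarrow> D s j < 0 \<longrightarrow> snd s' (adr L 6 0) \<le> star_ratio k c (D s) (g s) i j"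
    using assms(1) unfolding best_star_def if_not_P[OF assms(2)] by (elim conjE)
  then show ?thesis using assms(3-) by blast
qed

lemma best_star_upd [simp]:
  "v \<notin> {8,9,10,11} \<Longrightarrow> best_star s P (n(v := x), R) \<longleftrightarrow> best_star s P (n, R)"
  by (simp add: best_star_def)

lemma runs_find_star:
  assumes base: "base s" and ok: "stars_ok s"
  shows "runs find_star s (700 * w ^ 2) (\<lambda>s'. frame {4,5,6,8,9,10,11} {5,6,7} s s' \<and> best_star s (\<lambda>_ _. True) s')"
  unfolding find_star_def
proof (rule runs_Seq_le)
  let ?F = "\<lambda>s'. frame {4,5,6,8,9,10,11} {5,6,7} s s'"
  show "runs (NAssign (NC 8) (NC 0)) s 3 (\<lambda>s'. s' = ((fst s)(8 := 0), snd s))"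
    by (rule runs_straight) simp_all
  fix s1 assume s1: "s1 = ((fst s)(8 := 0), snd s)"
  show "runs (site_loop (Seq saving_prog (for_loop 6 1 try_star))) s1 (600 * w ^ 2) (\<lambda>s'. ?F s' \<and> best_star s (\<lambda>_ _. True) s')"
  proof (rule runs_site_loop[where T = "500 * w" and I = "\<lambda>i s'. ?F s' \<and> best_star s (\<lambda>i' _. i' < i) s'"])
    show "base s1" using base by (simp add: s1)
    show "?F s1 \<and> best_star s (\<lambda>i' _. i' < 0) s1" by (simp add: s1 best_star_def)
    fix i s2 assume i: "i < m" and I: "?F s2 \<and> best_star s (\<lambda>i' _. i' < i) s2" and b2: "base s2"
      and v: "fst s2 4 = i" "fst s2 5 = m + i * k"
    have fr2: "?F s2" using I by blast
    show "runs (Seq saving_prog (for_loop 6 1 try_star)) s2 (500 * w)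
      (\<lambda>s''. base s'' \<and> fst s'' 4 = i \<and> fst s'' 5 = m + i * k \<and> ?F s'' \<and> best_star s (\<lambda>i' _. i' < Suc i) s'')"
    proof (rule runs_Seq_le[OF runs_saving[OF b2 i v(2)]])
      fix s3 assume 3: "frame {6} {5} s2 s3 \<and> snd s3 (adr L 5 0) = saving k c (D s2) i"
      then have fr23: "frame {6} {5} s2 s3" by blast
      have fr3: "?F s3" by (rule frame_trans[OF fr2 fr23]) auto
      have "saving k c (D s2) i = saving k c (D s) i"
        using frame_snd[OF fr2, of 3] client_less by (intro saving_cong) simp
      then have sav3: "snd s3 (adr L 5 0) = saving k c (D s) i" using 3 by simp
      have bs3: "best_star s (\<lambda>i' _. i' < i) s3"
        by (rule best_star_frame[OF _ fr23]) (use I in auto)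
      have v3: "fst s3 4 = i" "fst s3 5 = m + i * k" using frame_fst[OF fr23] v by simp_all
      let ?I = "\<lambda>x s'. fst s' 4 = i \<and> fst s' 5 = m + i * k \<and> ?F s' \<and> snd s' (adr L 5 0) = saving k c (D s) i \<and>
         best_star s (\<lambda>i' j. i' < i \<or> i' = i \<and> j < x) s'"
      show "runs (for_loop 6 1 try_star) s3 (350 * w)
        (\<lambda>s''. base s'' \<and> fst s'' 4 = i \<and> fst s'' 5 = m + i * k \<and> ?F s'' \<and> best_star s (\<lambda>i' _. i' < Suc i) s'')"
      proof (rule runs_for[where T = 320 and I = ?I])
        show "?I 0 ((fst s3)(6 := 0), snd s3)"
          using v3 fr3 sav3 bs3 by simp
        show "fst s3 1 = k" using base_frame[OF base fr3] by (simp add: baseD)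
        show "k * (320 + 13) + 10 \<le> 350 * w" using w_bounds by simp
      next
        fix s' assume I: "?I k s'"
        then have fr': "?F s'" by blast
        have "base s'" by (rule base_frame[OF base fr']) auto
        moreover have "best_star s (\<lambda>i' _. i' < Suc i) s'"
          by (rule best_star_mono[of s "\<lambda>i' j. i' < i \<or> i' = i \<and> j < k"]) (use I in auto)
        ultimately show "base s' \<and> fst s' 4 = i \<and> fst s' 5 = m + i * k \<and> ?F s' \<and> best_star s (\<lambda>i' _. i' < Suc i) s'"
          using I by blast
      next
        fix x s' assume x: "x < k" and I: "?I x s'" and v6: "fst s' 6 = x"
        have fr': "?F s'" and v4: "fst s' 4 = i" "fst s' 5 = m + i * k" and sav: "snd s' (adr L 5 0) = saving k c (D s) i"
          and bs: "best_star s (\<lambda>i' j. i' < i \<or> i' = i \<and> j < x) s'" using I by blast+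
        have b': "base s'" by (rule base_frame[OF base fr']) auto
        note lx = client_less[OF x] cell_less_L[OF i x] site_less[OF i] L_pos
        have rds: "D s' x = D s x" "g s' i = g s i" "starsum s' i x = sum (c i) (star k c (D s) i x)"
          "starcard s' i x = real (card (star k c (D s) i x))"
          using frame_snd[OF fr' _ lx(1), of 3] frame_snd[OF fr' _ lx(3), of 1] frame_snd[OF fr' _ lx(2), of 1]
            frame_snd[OF fr' _ lx(2), of 2] ok[unfolded stars_ok_def, rule_format, OF i x] by simp_all
        note ev = v4 v6 baseD[OF b'] i x lx sav rds
        define rho where "rho = star_ratio k c (D s) (g s) i x"
        have rho: "(g s i - saving k c (D s) i + sum (c i) (star k c (D s) i x)) / real (card (star k c (D s) i x)) = rho"
          by (simp add: rho_def star_ratio_def)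
        define R where "R = (snd s')(adr L 7 0 := rho)"
        have eff: "effect try_star s' = (if D s x < 0 then
            if fst s' 8 = 0 \<or> rho < snd s' (adr L 6 0) then
              ((fst s')(9 := i, 10 := m + i * k, 11 := x, 8 := 1), R(adr L 6 0 := rho))
            else (fst s', R) else s')"
          unfolding try_star_def R_def by (simp add: ev rho)
        have "?I (Suc x) ((fst (effect try_star s'))(6 := Suc x), snd (effect try_star s'))
          \<and> fst (effect try_star s') 6 = x \<and> fst (effect try_star s') 1 = k"
        proof -
          consider "0 \<le> D s x" | "D s x < 0" "fst s' 8 = 0 \<or> rho < snd s' (adr L 6 0)"
            | "D s x < 0" "fst s' 8 \<noteq> 0" "snd s' (adr L 6 0) \<le> rho" by linarith
          then show ?thesis
          proof cases
            case 1
            then have e: "effect try_star s' = s'" by (simp add: eff)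
            have "best_star s (\<lambda>i' j. i' < i \<or> i' = i \<and> j < Suc x) ((fst s')(6 := Suc x), snd s')"
              using bs 1 unfolding best_star_def by (auto simp: less_Suc_eq)
            then show ?thesis unfolding e using fr' by (simp add: ev)
          next
            case 2
            then have e: "effect try_star s' = ((fst s')(9 := i, 10 := m + i * k, 11 := x, 8 := 1), R(adr L 6 0 := rho))"
              by (simp add: eff)
            have "best_star s (\<lambda>i' j. i' < i \<or> i' = i \<and> j < Suc x)
              ((fst s')(9 := i, 10 := m + i * k, 11 := x, 8 := 1, 6 := Suc x), R(adr L 6 0 := rho))"
            proof -
              have "rho \<le> star_ratio k c (D s) (g s) i' j"
                if "i' < m" "j < k" "i' < i \<or> i' = i \<and> j < Suc x" "D s j < 0" for i' j
              proof (cases "i' = i \<and> j = x")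
                case True then show ?thesis by (simp add: rho_def)
              next
                case False
                then have P: "i' < i \<or> i' = i \<and> j < x" using that(3) by auto
                have nz: "fst s' 8 \<noteq> 0"
                proof
                  assume "fst s' 8 = 0"
                  from best_star_none[OF bs this that(1,2) P] show False using that(4) by simp
                qed
                from best_star_le[OF bs nz that(1,2) P that(4)]
                have "snd s' (adr L 6 0) \<le> star_ratio k c (D s) (g s) i' j" .
                then show ?thesis using 2 nz by simp
              qed
              then show ?thesis using i x 2 unfolding best_star_def by (simp add: rho_def)
            qed
            then show ?thesis unfolding e using fr' lx by (simp add: ev R_def)
          next
            case 3
            then have e: "effect try_star s' = (fst s', R)" by (simp add: eff)
            have "best_star s (\<lambda>i' j. i' < i \<or> i' = i \<and> j < Suc x) ((fst s')(6 := Suc x), R)"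
              using bs 3 lx unfolding best_star_def rho_def R_def by (auto simp: less_Suc_eq)
            then show ?thesis unfolding e using fr' lx by (simp add: ev R_def)
          qed
        qed
        then show "runs try_star s' 320 (\<lambda>s'. fst s' 6 = x \<and> fst s' 1 = k \<and> ?I (Suc x) ((fst s')(6 := Suc x), snd s'))"
          by (intro runs_straight) (auto simp: try_star_def)
      qed simp
    qed simp
  next
    show "?F s' \<and> best_star s (\<lambda>_ _. True) s'" if "?F s' \<and> best_star s (\<lambda>i' _. i' < m) s'" for s'
      using that by (auto elim: best_star_mono)
    have "m * (500 * w + 20) + 15 \<le> 600 * w ^ Suc 1"
      using w_bounds by (intro loop_cost[where b = 520]) simp_all
    then show "m * (500 * w + 20) + 15 \<le> 600 * w ^ 2" by (simp only: Suc_1)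
    show "?F ((fst s')(4 := x, 5 := y), snd s') \<and> best_star s (\<lambda>i' _. i' < i) ((fst s')(4 := x, 5 := y), snd s')"
      if "?F s' \<and> best_star s (\<lambda>i' _. i' < i) s'" for i s' x y
      using that by simp
  qed
next
  show "3 + 600 * w ^ 2 \<le> 700 * w ^ 2" using w_powers(2) by linarith
qed

definition greedy_ok :: "state \<Rightarrow> bool" where
  "greedy_ok s \<longleftrightarrow> base s \<and> stars_ok s \<and> (\<exists>sg' n \<alpha> e X t Op. (\<forall>j<k. sg s j = real (sg' j)) \<and>
     jms_inv m k c (\<lambda>i. 3/2 * f i) (D s) sg' (g s) n \<alpha> e X t Op)"

lemma stars_ok_frame:
  assumes "stars_ok s" "frame A B s s'" "1 \<notin> B" "2 \<notin> B" "3 \<notin> B"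
  shows "stars_ok s'"
proof -
  have "star k c (D s') i j = star k c (D s) i j" for i j
    using frame_snd[OF assms(2,5)] client_less by (intro star_cong) simp
  then show ?thesis
    using assms(1) frame_snd[OF assms(2,3)] frame_snd[OF assms(2,4)] cell_less_L by (simp add: stars_ok_def)
qed

text \<open>Truncated subtraction covers the idle rounds after the last connection, so a loop of
  exactly \<open>k\<close> rounds suffices without an exit test.\<close>

lemma greedy_step:
  assumes ok: "greedy_ok s"
  shows "pruns unconn_cost (Seq find_star (IfC (BNLess (NC 0) (V 8)) (Seq open_best connect_loop) SKIP)) s (1200 * w ^ 2)
    (\<lambda>s'. fst s' 12 = fst s 12 \<and> greedy_ok s' \<and> unconnected s' \<le> unconnected s - 1)"
    (is "pruns _ _ _ _ ?Q")
proof (rule runs_Seq_le)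
  have base: "base s" and sok: "stars_ok s" using ok by (auto simp: greedy_ok_def)
  obtain sg' n \<alpha> e X t Op where sg': "\<And>j. j < k \<Longrightarrow> sg s j = real (sg' j)"
    and inv: "jms_inv m k c (\<lambda>i. 3/2 * f i) (D s) sg' (g s) n \<alpha> e X t Op"
    using ok unfolding greedy_ok_def by blast
  let ?R = "\<lambda>s'. frame {4,5,6,8,9,10,11} {5,6,7} s s' \<and> best_star s (\<lambda>_ _. True) s'"
  have same: "unconn_cost s' = unconn_cost s" "unconnected s' = unconnected s" if "frame A B s s'" "3 \<notin> B" for A B s'
  proof -
    have "D s' j = D s j" if "j < k" for j by (rule frame_snd[OF \<open>frame A B s s'\<close> \<open>3 \<notin> B\<close> client_less[OF that]])
    then show "unconnected s' = unconnected s" unfolding unconnected_def by (metis (no_types, lifting))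
    then show "unconn_cost s' = unconn_cost s" by (simp add: unconn_cost_def)
  qed
  show "pruns unconn_cost find_star s (700 * w ^ 2) ?R"
    by (rule pruns_of_runs[OF runs_mono[OF runs_find_star[OF base sok] order_refl]]) (use same in auto)
  fix s1 assume 1: "?R s1"
  then have fr1: "frame {4,5,6,8,9,10,11} {5,6,7} s s1" and best: "best_star s (\<lambda>_ _. True) s1" by blast+
  have b1: "base s1" by (rule base_frame[OF base fr1]) auto
  have sok1: "stars_ok s1" by (rule stars_ok_frame[OF sok fr1]) auto
  have D1: "D s1 j = D s j" "sg s1 j = sg s j" if "j < k" for j
    using frame_snd[OF fr1 _ client_less[OF that]] by simp_all
  have g1: "g s1 i = g s i" if "i < m" for i using frame_snd[OF fr1 _ site_less[OF that]] by simp
  have c12: "fst s1 12 = fst s 12" using frame_fst[OF fr1] by simp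
  show "pruns unconn_cost (IfC (BNLess (NC 0) (V 8)) (Seq open_best connect_loop) SKIP) s1 (500 * w ^ 2)
    ?Q"
  proof (cases "fst s1 8 = 0")
    case True
    then have all: "\<And>j. j < k \<Longrightarrow> 0 \<le> D s j" using best m unfolding best_star_def by auto
    \<comment> \<open>As functions \<open>D s1\<close> and \<open>D s\<close> are only known to
      agree below \<open>k\<close>, so the invariant has to be transferred field by field.\<close>
    have "jms_inv m k c (\<lambda>i. 3/2 * f i) (D s1) sg' (g s1) n \<alpha> e X t Op"
    proof -
      have offer: "offer k c (D s1) t i = offer k c (D s) t i" for i unfolding offer_def using D1 by (intro sum.cong) auto
      have sets: "{j. j < k \<and> 0 \<le> D s1 j} = {j. j < k \<and> 0 \<le> D s j}" using D1 by auto
      interpret jms_inv m k c "\<lambda>i. 3/2 * f i" "D s" sg' "g s" n \<alpha> e X t Op by (rule inv)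
      show ?thesis
      proof
        show "sum \<alpha> {j. j < k \<and> 0 \<le> D s1 j} = (\<Sum>i\<in>Op. 3/2 * f i) + sum (D s1) {j. j < k \<and> 0 \<le> D s1 j}"
          unfolding sets balance using D1 by simp
      next
        fix l i assume "l < k" "i < m" "0 \<le> D s1 l"
        then have "(\<Sum>j<k. if 0 \<le> D s j \<and> e j < e l then max (X j l - c i j) 0 else max (\<alpha> l - c i j) 0) \<le> 3/2 * f i"
          using D1 by (intro budget) simp_all
        then show "(\<Sum>j<k. if 0 \<le> D s1 j \<and> e j < e l then max (X j l - c i j) 0 else max (\<alpha> l - c i j) 0) \<le> 3/2 * f i"
          using D1 by simp
      qed (use Op t_nonneg g sg_Op D_sg offer_le alpha_nonneg alpha_le_t e_less D_le_alpha alpha_mono X_le_alpha D_le_X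
          alpha_le_X X_antimono D1 g1 offer in auto)
    qed
    then have gok1: "greedy_ok s1" unfolding greedy_ok_def using b1 sok1 D1 sg' by (intro conjI exI) auto
    have "{j. j < k \<and> D s j < 0} = {}" using all by force
    then have "unconnected s = 0" by (simp add: unconnected_def)
    then have "unconnected s1 = 0" using same(2)[OF fr1] by simp
    then have Q: "fst s1 12 = fst s 12 \<and> greedy_ok s1 \<and> unconnected s1 \<le> unconnected s - 1" using c12 gok1 by simp
    show ?thesis
    proof (rule runs_IfF)
      show "pruns unconn_cost SKIP s1 1 ?Q"
        by (rule pruns_of_runs, rule runs_straight[where T = 1]) (use Q in simp_all)
      show "1 + bcost (BNLess (NC 0) (V 8)) + 1 \<le> 500 * w ^ 2" using w_powers(2) by simp
    qed (use True in simp)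
  next
    case False
    define bi where "bi = fst s1 9"
    define bj where "bj = fst s1 11"
    have bst: "bi < m" "fst s1 10 = m + bi * k" "bj < k" "D s bj < 0"
      and opt: "\<And>i j. i < m \<Longrightarrow> j < k \<Longrightarrow> D s j < 0 \<Longrightarrow>
         star_ratio k c (D s) (g s) bi bj \<le> star_ratio k c (D s) (g s) i j"
      using best False unfolding best_star_def bi_def bj_def by auto
    note lx = site_less[OF bst(1)] L_pos cell_less_L[OF bst(1,3)]
    define s2 where "s2 = (fst s1, (snd s1)(adr L 1 bi := 0, adr L 6 0 := c bi bj))"
    have 2: "runs open_best s1 60 (\<lambda>s'. s' = s2)"
      unfolding open_best_def s2_def
      by (rule runs_straight) (simp_all add: baseD[OF b1] bst bi_def[symmetric] bj_def[symmetric] lx)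
    have rd2: "D s2 j = D s j" "sg s2 j = sg s j" if "j < k" for j
      using client_less[OF that] lx D1[OF that] by (simp_all add: s2_def)
    have b2: "base s2"
      by (rule base_frame[OF b1, of "{}" "{1,6}"]) (use lx in \<open>auto simp: s2_def\<close>)
    have sok2: "stars_ok s2"
    proof -
      have "star k c (D s2) i j = star k c (D s1) i j" for i j using rd2 D1 by (intro star_cong) simp
      moreover have "starsum s2 i j = starsum s1 i j" "starcard s2 i j = starcard s1 i j" if "i < m" "j < k" for i j
        using cell_less_L[OF that] lx bst(1) by (simp_all add: s2_def)
      ultimately show ?thesis using sok1 by (simp add: stars_ok_def)
    qed
    have un2: "unconnected s2 = unconnected s" unfolding unconnected_def using rd2 by (metis (no_types, lifting))
    have "pruns unconn_cost connect_loop s2 (300 * w) (connected_upto k bi (c bi bj) s2)"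
      using b2 sok2 bst lx by (intro pruns_connect_loop) (simp_all add: s2_def bi_def)
    then have 3: "pruns unconn_cost connect_loop s2 (300 * w)
      ?Q"
    proof (rule runs_mono)
      fix s3 assume 3: "connected_upto k bi (c bi bj) s2 s3"
      then have fr3: "frame {4,5,6,7} {1,2,3,4} s2 s3" and g3: "\<And>i. i < m \<Longrightarrow> g s3 i = g s2 i" and sok3: "stars_ok s3"
        and D3: "\<And>j. j < k \<Longrightarrow> D s3 j = (if (D s2 j < 0 \<and> c bi j \<le> c bi bj) \<or> c bi j < D s2 j then c bi j else D s2 j)"
        and sg3: "\<And>j. j < k \<Longrightarrow> sg s3 j = (if (D s2 j < 0 \<and> c bi j \<le> c bi bj) \<or> c bi j < D s2 j then real bi else sg s2 j)"
        unfolding connected_upto_def by auto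
      have b3: "base s3" by (rule base_frame[OF b2 fr3]) auto
      have c3: "fst s3 12 = fst s 12" using frame_fst[OF fr3, of 12] c12 by (simp add: s2_def)
      define sg'' where "sg'' j = (if (D s j < 0 \<and> c bi j \<le> c bi bj) \<or> c bi j < D s j then bi else sg' j)" for j
      have "\<exists>\<alpha> e X t Op. jms_inv m k c (\<lambda>i. 3/2 * f i) (D s3) sg'' (g s3) (Suc n) \<alpha> e X t Op"
      proof (rule jms_step[OF metric c _ inv bst(1,3,4) opt])
        show "0 \<le> 3/2 * f i" if "i < m" for i using f[OF that] by simp
        show "D s3 j = connect c bi bj (D s) j" if "j < k" for j
          using D3[OF that] rd2[OF that] c[OF bst(1) that] by (auto simp: connect_def min_def)
        show "g s3 i = (if i = bi then 0 else g s i)" if "i < m" for i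
          using g3[OF that] site_less[OF that] lx g1[OF that] by (simp add: s2_def)
      qed (simp_all add: sg''_def)
      moreover have "\<forall>j<k. sg s3 j = real (sg'' j)" using sg3 rd2 sg' by (simp add: sg''_def)
      ultimately have "greedy_ok s3" unfolding greedy_ok_def using b3 sok3 by blast
      moreover have "unconnected s3 < unconnected s"
        unfolding unconnected_def
      proof (intro psubset_card_mono psubsetI)
        show "{j. j < k \<and> D s3 j < 0} \<subseteq> {j. j < k \<and> D s j < 0}"
        proof
          fix j assume "j \<in> {j. j < k \<and> D s3 j < 0}"
          then show "j \<in> {j. j < k \<and> D s j < 0}"
            using D3[of j] rd2[of j] c[OF bst(1), of j] by (auto split: if_splits)
        qed
        have pos: "0 \<le> D s3 bj" using D3[OF bst(3)] rd2[OF bst(3)] bst(4) c[OF bst(1,3)] by simp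
        have "bj \<in> {j. j < k \<and> D s j < 0}" "bj \<notin> {j. j < k \<and> D s3 j < 0}" using bst pos by simp_all
        then show "{j. j < k \<and> D s3 j < 0} \<noteq> {j. j < k \<and> D s j < 0}" by metis
      qed simp
      ultimately show "fst s3 12 = fst s 12 \<and> greedy_ok s3 \<and> unconnected s3 \<le> unconnected s - 1" using c3 by simp
    qed simp
    show ?thesis
    proof (rule runs_IfT)
      show "pruns unconn_cost (Seq open_best connect_loop) s1 (60 + 300 * w)
        ?Q"
      proof (rule runs_Seq)
        have "unconn_cost s2 = unconn_cost s1" using un2 same(2)[OF fr1] by (simp add: unconn_cost_def)
        then show "pruns unconn_cost open_best s1 60 (\<lambda>s'. s' = s2)"
          by (intro pruns_of_runs[OF runs_mono[OF 2 order_refl]]) simp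
      qed (use 3 in simp)
      show "1 + bcost (BNLess (NC 0) (V 8)) + (60 + 300 * w) \<le> 500 * w ^ 2" using w_powers(1,2) by simp
    qed (use False in simp)
  qed
qed simp

lemma runs_greedy_phase:
  assumes ok: "greedy_ok s"
  shows "runs greedy_phase s (1800 * w ^ 3) (\<lambda>s'. greedy_ok s' \<and> (\<forall>j<k. 0 \<le> D s' j))"
proof -
  have "pruns unconn_cost greedy_phase s (1300 * w ^ 3) (\<lambda>s'. greedy_ok s' \<and> (\<forall>j<k. 0 \<le> D s' j))"
    unfolding greedy_phase_def
  proof (rule pruns_for[where T = "1200 * w ^ 2" and I = "\<lambda>x s'. greedy_ok s' \<and> unconnected s' \<le> k - x" and n = k])
    have upd: "greedy_ok ((fst s')(12 := y), snd s') = greedy_ok s'" "unconnected ((fst s')(12 := y), snd s') = unconnected s'" for s' y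
      by (simp_all add: greedy_ok_def stars_ok_def unconnected_def)
    show "unconn_cost ((fst s')(12 := y), snd s') = unconn_cost s'" for s' y
      by (simp add: unconn_cost_def upd)
    have "unconnected s \<le> k" unfolding unconnected_def
      by (rule order_trans[OF card_mono[of "{..<k}"]]) auto
    then show "greedy_ok ((fst s)(12 := 0), snd s) \<and> unconnected ((fst s)(12 := 0), snd s) \<le> k - 0"
      using ok by (simp add: upd)
    show "fst s 1 = k" using ok by (simp add: greedy_ok_def baseD)
    show "greedy_ok s' \<and> (\<forall>j<k. 0 \<le> D s' j)" if "greedy_ok s' \<and> unconnected s' \<le> k - k" for s'
    proof -
      have "{j. j < k \<and> D s' j < 0} = {}" using that by (simp add: unconnected_def)
      then show ?thesis using that by force
    qed
    have "k * (1200 * w ^ 2 + 13) + 10 \<le> 1300 * w ^ Suc 2"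
      using w_bounds w_powers(2) by (intro loop_cost[where b = 1213]) linarith+
    then show "k * (1200 * w ^ 2 + 13) + 10 \<le> 1300 * w ^ 3" by (simp add: numeral_3_eq_3 numeral_2_eq_2)
    fix x s' assume x: "x < k" "greedy_ok s' \<and> unconnected s' \<le> k - x" "fst s' 12 = x"
    show "pruns unconn_cost (Seq find_star (IfC (BNLess (NC 0) (V 8)) (Seq open_best connect_loop) SKIP)) s' (1200 * w ^ 2)
      (\<lambda>s'. fst s' 12 = x \<and> fst s' 1 = k \<and> greedy_ok ((fst s')(12 := Suc x), snd s') \<and>
        unconnected ((fst s')(12 := Suc x), snd s') \<le> k - Suc x)"
    proof (rule runs_mono[OF greedy_step order_refl])
      show "greedy_ok s'" using x by simp
      fix s'' assume "fst s'' 12 = fst s' 12 \<and> greedy_ok s'' \<and> unconnected s'' \<le> unconnected s' - 1"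
      moreover from this have "base s''" by (simp add: greedy_ok_def)
      moreover have "unconnected s'' \<le> k - Suc x" using calculation(1) x by auto
      ultimately show "fst s'' 12 = x \<and> fst s'' 1 = k \<and> greedy_ok ((fst s'')(12 := Suc x), snd s'') \<and>
        unconnected ((fst s'')(12 := Suc x), snd s'') \<le> k - Suc x"
        using x by (simp add: upd baseD)
    qed
  qed simp
  then show ?thesis
  proof (rule runs_of_pruns)
    have "unconnected s \<le> k" unfolding unconnected_def
      by (rule order_trans[OF card_mono[of "{..<k}"]]) auto
    \<comment> \<open>All star updates of the whole phase together cost at most the initial
      potential, which is cubic.\<close>
    then have "unconn_cost s \<le> 300 * w ^ 2 * w" unfolding unconn_cost_def using w_bounds by (intro mult_le_mono) auto
    then show "1300 * w ^ 3 + unconn_cost s \<le> 1800 * w ^ 3" by (simp add: power3_eq_cube power2_eq_square)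
  qed
qed

end

section \<open>Execution of the augmentation\<close>

lemma aug_inv_cong:
  "(\<And>j. j < k \<Longrightarrow> d' j = d j) \<Longrightarrow> aug_inv m k r f c d' s Op = aug_inv m k r f c d s Op"
  by (simp add: aug_inv_def)

context uftra_run
begin

text \<open>Ratios of saving to opening cost are compared by cross-multiplication, since a gainful
  site may have opening cost 0.\<close>

definition best_site :: "state \<Rightarrow> nat \<Rightarrow> state \<Rightarrow> bool" where
  "best_site s x s' \<longleftrightarrow> (if fst s' 8 = 0 then \<forall>i<x. saving k c (D s) i \<le> f i
     else fst s' 9 < m \<and> fst s' 10 = m + fst s' 9 * k \<and> f (fst s' 9) < saving k c (D s) (fst s' 9) \<and>
       snd s' (adr L 6 0) = saving k c (D s) (fst s' 9) \<and> snd s' (adr L 7 0) = f (fst s' 9) \<and>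
       (\<forall>i<x. f i < saving k c (D s) i \<longrightarrow>
          saving k c (D s) i * f (fst s' 9) \<le> saving k c (D s) (fst s' 9) * f i))"

lemma runs_find_site:
  assumes base: "base s"
  shows "runs find_site s (700 * w ^ 2) (\<lambda>s'. frame {4,5,6,8,9,10} {5,6,7} s s' \<and> best_site s m s')"
  unfolding find_site_def
proof (rule runs_Seq_le)
  let ?F = "\<lambda>s'. frame {4,5,6,8,9,10} {5,6,7} s s'"
  show "runs (NAssign (NC 8) (NC 0)) s 3 (\<lambda>s'. s' = ((fst s)(8 := 0), snd s))"
    by (rule runs_straight) simp_all
  fix s1 assume s1: "s1 = ((fst s)(8 := 0), snd s)"
  show "runs (site_loop (Seq saving_prog try_site)) s1 (600 * w ^ 2) (\<lambda>s'. ?F s' \<and> best_site s m s')"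
  proof (rule runs_site_loop[where T = "500 * w" and I = "\<lambda>i s'. ?F s' \<and> best_site s i s'"])
    show "base s1" using base by (simp add: s1)
    show "?F s1 \<and> best_site s 0 s1" by (simp add: s1 best_site_def)
    show "?F ((fst s')(4 := x, 5 := y), snd s') \<and> best_site s i ((fst s')(4 := x, 5 := y), snd s')"
      if "?F s' \<and> best_site s i s'" for i s' x y
      using that by (simp add: best_site_def)
    have "m * (500 * w + 20) + 15 \<le> 600 * w ^ Suc 1"
      using w_bounds by (intro loop_cost[where b = 520]) simp_all
    then show "m * (500 * w + 20) + 15 \<le> 600 * w ^ 2" by (simp only: Suc_1)
    fix i s2 assume i: "i < m" and I: "?F s2 \<and> best_site s i s2" and b2: "base s2"
      and v: "fst s2 4 = i" "fst s2 5 = m + i * k"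
    have fr2: "?F s2" using I by blast
    show "runs (Seq saving_prog try_site) s2 (500 * w)
      (\<lambda>s''. base s'' \<and> fst s'' 4 = i \<and> fst s'' 5 = m + i * k \<and> ?F s'' \<and> best_site s (Suc i) s'')"
    proof (rule runs_Seq_le[OF runs_saving[OF b2 i v(2)]])
      fix s3 assume 3: "frame {6} {5} s2 s3 \<and> snd s3 (adr L 5 0) = saving k c (D s2) i"
      then have fr23: "frame {6} {5} s2 s3" by blast
      have fr3: "?F s3" by (rule frame_trans[OF fr2 fr23]) auto
      have b3: "base s3" by (rule base_frame[OF base fr3]) auto
      define z where "z = saving k c (D s) i"
      have "saving k c (D s2) i = z" unfolding z_def
        using frame_snd[OF fr2, of 3] client_less by (intro saving_cong) simp
      then have sav3: "snd s3 (adr L 5 0) = z" using 3 by simp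
      have v3: "fst s3 4 = i" "fst s3 5 = m + i * k" using frame_fst[OF fr23] v by simp_all
      have eqs: "fst s3 8 = fst s2 8" "fst s3 9 = fst s2 9" "fst s3 10 = fst s2 10"
        "snd s3 (adr L 6 0) = snd s2 (adr L 6 0)" "snd s3 (adr L 7 0) = snd s2 (adr L 7 0)"
        using frame_fst[OF fr23] frame_snd[OF fr23 _ L_pos] by simp_all
      have bs: "best_site s i s3" using I unfolding best_site_def eqs by blast
      note lx = site_less[OF i] L_pos
      note ev = v3 sav3 baseD[OF b3] i lx
      have eff: "effect try_site s3 = (if f i < z \<and> (fst s3 8 = 0 \<or> snd s3 (adr L 6 0) * f i < z * snd s3 (adr L 7 0))
         then ((fst s3)(9 := i, 10 := m + i * k, 8 := 1), (snd s3)(adr L 6 0 := z, adr L 7 0 := f i)) else s3)"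
        unfolding try_site_def by (cases "fst s3 8 = 0") (simp_all add: ev)
      have "best_site s (Suc i) (effect try_site s3)"
      proof (cases "f i < z \<and> (fst s3 8 = 0 \<or> snd s3 (adr L 6 0) * f i < z * snd s3 (adr L 7 0))")
        case True
        have e: "effect try_site s3 = ((fst s3)(9 := i, 10 := m + i * k, 8 := 1), (snd s3)(adr L 6 0 := z, adr L 7 0 := f i))"
          unfolding eff using True by (rule if_P)
        have key: "saving k c (D s) i' * f i \<le> z * f i'" if i': "i' < Suc i" "f i' < saving k c (D s) i'" for i'
        proof (cases "i' = i")
          case True then show ?thesis by (simp add: z_def)
        next
          case False
          then have ii: "i' < i" using i' by simp
          have nz: "fst s3 8 \<noteq> 0"
          proof
            assume z: "fst s3 8 = 0"
            have "saving k c (D s) i' \<le> f i'" using bs ii unfolding best_site_def if_P[OF z] by blast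
            then show False using i'(2) by simp
          qed
          define b where "b = fst s3 9"
          have old: "b < m" "f b < saving k c (D s) b" "snd s3 (adr L 6 0) = saving k c (D s) b" "snd s3 (adr L 7 0) = f b"
            "\<forall>l<i. f l < saving k c (D s) l \<longrightarrow> saving k c (D s) l * f b \<le> saving k c (D s) b * f l"
            using bs unfolding best_site_def if_not_P[OF nz] b_def by blast+
          have lt: "saving k c (D s) b * f i < z * f b" using True nz old(3,4) by simp
          have fpos: "0 \<le> f i" "0 \<le> f i'" "0 \<le> f b" using f i ii old(1) by simp_all
          show ?thesis
          proof (rule saving_ratio_trans[where b = "saving k c (D s) b" and y = "f b"])
            show "saving k c (D s) i' * f b \<le> saving k c (D s) b * f i'" using old(5)[rule_format, OF ii i'(2)] .
            show "0 < saving k c (D s) b" using old(2) fpos by linarith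
            show "0 \<le> saving k c (D s) i'" using i'(2) fpos by linarith
            show "0 \<le> z" using True fpos by linarith
            show "saving k c (D s) b * f i \<le> z * f b" by (rule less_imp_le[OF lt])
          qed
        qed
        show ?thesis unfolding e using key i lx True by (simp add: best_site_def z_def)
      next
        case False
        have e: "effect try_site s3 = s3" unfolding eff using False by (rule if_not_P)
        show ?thesis
        proof (cases "fst s3 8 = 0")
          case T: True
          then show ?thesis unfolding e using bs False by (auto simp: best_site_def less_Suc_eq z_def)
        next
          case nz: False
          have "z * f (fst s3 9) \<le> saving k c (D s) (fst s3 9) * f i" if "f i < z"
            using bs False nz that unfolding best_site_def if_not_P[OF nz] by (auto simp: not_less)
          then show ?thesis unfolding e using bs unfolding best_site_def if_not_P[OF nz] by (auto simp: less_Suc_eq z_def)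
        qed
      qed
      moreover have "base (effect try_site s3)"
        unfolding eff using base_frame[OF b3, of "{8,9,10}" "{6,7}"] L_pos by (simp add: b3)
      moreover have "fst (effect try_site s3) 4 = i" "fst (effect try_site s3) 5 = m + i * k" "?F (effect try_site s3)"
        unfolding eff using v3 fr3 lx by simp_all
      ultimately show "runs try_site s3 300
        (\<lambda>s''. base s'' \<and> fst s'' 4 = i \<and> fst s'' 5 = m + i * k \<and> ?F s'' \<and> best_site s (Suc i) s'')"
        by (intro runs_straight) (auto simp: try_site_def)
    qed (use w_bounds in simp)
  qed
next
  show "3 + 600 * w ^ 2 \<le> 700 * w ^ 2" using w_powers(2) by linarith
qed

definition aug_ok :: "state \<Rightarrow> bool" where
  "aug_ok s \<longleftrightarrow> base s \<and> stars_ok s \<and>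
     (\<exists>sg' Op. (\<forall>j<k. sg s j = real (sg' j)) \<and> aug_inv m k r f c (D s) sg' Op)"

definition gainful :: "state \<Rightarrow> nat set" where
  "gainful s = {i. i < m \<and> f i < saving k c (D s) i}"

text \<open>Opening a site reduces its own saving to 0 and increases no other saving. Hence the set
  of gainful sites loses a member in each round that opens something, and \<open>m\<close> rounds
  suffice.\<close>

lemma aug_step:
  assumes ok: "aug_ok s"
  shows "runs (Seq find_site (IfC (BNLess (NC 0) (V 8)) connect_loop SKIP)) s (1200 * w ^ 2)
    (\<lambda>s'. fst s' 12 = fst s 12 \<and> aug_ok s' \<and> card (gainful s') \<le> card (gainful s) - 1)"
proof (rule runs_Seq_le)
  have base: "base s" and sok: "stars_ok s" using ok by (auto simp: aug_ok_def)
  obtain sg' Op where sg': "\<And>j. j < k \<Longrightarrow> sg s j = real (sg' j)" and inv: "aug_inv m k r f c (D s) sg' Op"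
    using ok unfolding aug_ok_def by blast
  have D0: "0 \<le> D s j" if "j < k" for j
  proof -
    have "sg' j < m" "D s j = c (sg' j) j" using inv that unfolding aug_inv_def by auto
    then show ?thesis using c[OF _ that] by simp
  qed
  show "runs find_site s (700 * w ^ 2) (\<lambda>s'. frame {4,5,6,8,9,10} {5,6,7} s s' \<and> best_site s m s')"
    by (rule runs_find_site[OF base])
  fix s1 assume 1: "frame {4,5,6,8,9,10} {5,6,7} s s1 \<and> best_site s m s1"
  then have fr1: "frame {4,5,6,8,9,10} {5,6,7} s s1" and best: "best_site s m s1" by blast+
  have b1: "base s1" by (rule base_frame[OF base fr1]) auto
  have sok1: "stars_ok s1" by (rule stars_ok_frame[OF sok fr1]) auto
  have D1: "D s1 j = D s j" "sg s1 j = sg s j" if "j < k" for j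
    using frame_snd[OF fr1 _ client_less[OF that]] by simp_all
  have c12: "fst s1 12 = fst s 12" using frame_fst[OF fr1] by simp
  let ?Q = "\<lambda>s'. fst s' 12 = fst s 12 \<and> aug_ok s' \<and> card (gainful s') \<le> card (gainful s) - 1"
  show "runs (IfC (BNLess (NC 0) (V 8)) connect_loop SKIP) s1 (500 * w ^ 2) ?Q"
  proof (cases "fst s1 8 = 0")
    case True
    then have no: "\<And>i. i < m \<Longrightarrow> saving k c (D s) i \<le> f i" using best unfolding best_site_def by auto
    have "saving k c (D s1) i = saving k c (D s) i" for i using D1 by (intro saving_cong) simp
    then have "gainful s1 = {}" unfolding gainful_def using no by force
    moreover have "aug_inv m k r f c (D s1) sg' Op" using inv aug_inv_cong[of k "D s1" "D s"] D1 by blast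
    then have "aug_ok s1" unfolding aug_ok_def using b1 sok1 D1 sg' by auto
    ultimately have Q: "?Q s1" using c12 by simp
    show ?thesis
    proof (rule runs_IfF)
      show "runs SKIP s1 1 ?Q" by (rule runs_straight) (use Q in simp_all)
      show "1 + bcost (BNLess (NC 0) (V 8)) + 1 \<le> 500 * w ^ 2" using w_powers(2) by simp
    qed (use True in simp)
  next
    case False
    define b where "b = fst s1 9"
    have bst: "b < m" "fst s1 10 = m + b * k" "f b < saving k c (D s) b"
      and opt: "\<And>i. i < m \<Longrightarrow> f i < saving k c (D s) i \<Longrightarrow> saving k c (D s) i * f b \<le> saving k c (D s) b * f i"
      using best unfolding best_site_def if_not_P[OF False] b_def by blast+
    define th where "th = snd s1 (adr L 6 0)"
    \<comment> \<open>All clients are connected here, so the branch of \<open>connect_loop\<close>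
      that compares with the threshold is never taken, and the potential is 0.\<close>
    have "{j. j < k \<and> D s1 j < 0} = {}" using D0 D1 by force
    then have un1: "unconn_cost s1 = 0" by (simp add: unconn_cost_def unconnected_def)
    have "pruns unconn_cost connect_loop s1 (300 * w) (connected_upto k b th s1)"
      using bst by (intro pruns_connect_loop b1 sok1) (simp_all add: b_def th_def)
    then have "runs connect_loop s1 (300 * w) (connected_upto k b th s1)"
      by (rule runs_of_pruns) (simp add: un1)
    then have 3: "runs connect_loop s1 (300 * w) ?Q"
    proof (rule runs_mono)
      fix s3 assume 3: "connected_upto k b th s1 s3"
      then have fr3: "frame {4,5,6,7} {1,2,3,4} s1 s3" and sok3: "stars_ok s3"
        and D3: "\<And>j. j < k \<Longrightarrow> D s3 j = (if (D s1 j < 0 \<and> c b j \<le> th) \<or> c b j < D s1 j then c b j else D s1 j)"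
        and sg3: "\<And>j. j < k \<Longrightarrow> sg s3 j = (if (D s1 j < 0 \<and> c b j \<le> th) \<or> c b j < D s1 j then real b else sg s1 j)"
        unfolding connected_upto_def by auto
      have b3: "base s3" by (rule base_frame[OF b1 fr3]) auto
      have c3: "fst s3 12 = fst s 12" using frame_fst[OF fr3, of 12] c12 by simp
      have D3': "D s3 j = min (D s j) (c b j)" if "j < k" for j using D3[OF that] D1[OF that] D0[OF that] by auto
      define sg'' where "sg'' j = (if c b j < D s j then b else sg' j)" for j
      have "aug_inv m k r f c (D s3) sg'' (insert b Op)"
        by (rule aug_inv_step[OF inv c f r bst(1,3) opt D3']) (simp_all add: sg''_def)
      moreover have "\<forall>j<k. sg s3 j = real (sg'' j)" using sg3 D1 D0 sg' by (auto simp: sg''_def not_less[symmetric])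
      ultimately have "aug_ok s3" unfolding aug_ok_def using b3 sok3 by blast
      moreover have "card (gainful s3) < card (gainful s)"
      proof (intro psubset_card_mono psubsetI)
        have "saving k c (D s3) i \<le> saving k c (D s) i" for i
          unfolding saving_def using D3' by (intro sum_mono) auto
        then show "gainful s3 \<subseteq> gainful s" unfolding gainful_def by (force intro: less_le_trans)
        have "saving k c (D s3) b = 0" unfolding saving_def using D3' by (intro sum.neutral) auto
        then have "b \<notin> gainful s3" unfolding gainful_def using f[OF bst(1)] by simp
        moreover have "b \<in> gainful s" unfolding gainful_def using bst by simp
        ultimately show "gainful s3 \<noteq> gainful s" by metis
      qed (simp add: gainful_def)
      ultimately show "?Q s3" using c3 by simp
    qed simp
    show ?thesis
      by (rule runs_IfT[OF _ 3]) (use False w_powers(1,2) in simp_all)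
  qed
qed simp

lemma runs_aug_phase:
  assumes ok: "aug_ok s"
  shows "runs aug_phase s (1300 * w ^ 3) (\<lambda>s'. aug_ok s' \<and> gainful s' = {})"
  unfolding aug_phase_def
proof (rule runs_for[where T = "1200 * w ^ 2" and I = "\<lambda>x s'. aug_ok s' \<and> card (gainful s') \<le> m - x" and n = m])
  have upd: "aug_ok ((fst s')(12 := y), snd s') = aug_ok s'" "gainful ((fst s')(12 := y), snd s') = gainful s'" for s' y
    by (simp_all add: aug_ok_def stars_ok_def gainful_def)
  have fin: "finite (gainful s')" for s' by (simp add: gainful_def)
  have "card (gainful s) \<le> m"
    by (rule order_trans[OF card_mono[of "{..<m}"]]) (auto simp: gainful_def)
  then show "aug_ok ((fst s)(12 := 0), snd s) \<and> card (gainful ((fst s)(12 := 0), snd s)) \<le> m - 0"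
    using ok by (simp add: upd)
  show "fst s 0 = m" using ok by (simp add: aug_ok_def baseD)
  show "aug_ok s' \<and> gainful s' = {}" if "aug_ok s' \<and> card (gainful s') \<le> m - m" for s'
    using that fin[of s'] by simp
  have "m * (1200 * w ^ 2 + 13) + 10 \<le> 1300 * w ^ Suc 2"
    using w_bounds w_powers(2) by (intro loop_cost[where b = 1213]) linarith+
  then show "m * (1200 * w ^ 2 + 13) + 10 \<le> 1300 * w ^ 3" by (simp add: numeral_3_eq_3 numeral_2_eq_2)
  fix x s' assume x: "x < m" "aug_ok s' \<and> card (gainful s') \<le> m - x" "fst s' 12 = x"
  show "runs (Seq find_site (IfC (BNLess (NC 0) (V 8)) connect_loop SKIP)) s' (1200 * w ^ 2)
    (\<lambda>s'. fst s' 12 = x \<and> fst s' 0 = m \<and> aug_ok ((fst s')(12 := Suc x), snd s') \<and>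
      card (gainful ((fst s')(12 := Suc x), snd s')) \<le> m - Suc x)"
  proof (rule runs_mono[OF aug_step order_refl])
    show "aug_ok s'" using x by simp
    fix s'' assume a: "fst s'' 12 = fst s' 12 \<and> aug_ok s'' \<and> card (gainful s'') \<le> card (gainful s') - 1"
    then have "base s''" by (simp add: aug_ok_def)
    moreover have "card (gainful s'') \<le> m - Suc x" using a x by auto
    ultimately show "fst s'' 12 = x \<and> fst s'' 0 = m \<and> aug_ok ((fst s'')(12 := Suc x), snd s'') \<and>
      card (gainful ((fst s'')(12 := Suc x), snd s'')) \<le> m - Suc x"
      using x a by (simp add: upd baseD)
  qed
qed simp

lemma greedy_ok_init:
  assumes base: "base s" and g: "\<And>i. i < m \<Longrightarrow> g s i = 3/2 * f i"
    and stars: "\<And>i j. i < m \<Longrightarrow> j < k \<Longrightarrow> starsum s i j = sum (c i) {l. l < k \<and> c i l \<le> c i j} \<and>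
      starcard s i j = real (card {l. l < k \<and> c i l \<le> c i j})"
    and D: "\<And>j. j < k \<Longrightarrow> D s j = -1 \<and> sg s j = 0"
  shows "greedy_ok s"
proof -
  have "star k c (D s) i j = {l. l < k \<and> c i l \<le> c i j}" for i j using D by (auto simp: star_def)
  then have sok: "stars_ok s" using stars by (simp add: stars_ok_def)
  have neg: "\<not> 0 \<le> D s j" if "j < k" for j using D[OF that] by simp
  have none: "{j. j < k \<and> 0 \<le> D s j} = {}" using neg by blast
  \<comment> \<open>At time 0 no unconnected client has a positive bid, because connection costs are
    nonnegative; the other fields hold vacuously or trivially before the first event.\<close>
  have off: "offer k c (D s) 0 i \<le> g s i" if "i < m" for i
  proof -
    have "offer k c (D s) 0 i = (\<Sum>j<k. 0)" unfolding offer_def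
      using D c[OF that] by (intro sum.cong) auto
    then show ?thesis using g[OF that] f[OF that] by simp
  qed
  have "jms_inv m k c (\<lambda>i. 3/2 * f i) (D s) (\<lambda>_. 0) (g s) 0 (\<lambda>_. 0) (\<lambda>_. 0) (\<lambda>_ _. 0) 0 {}"
    by unfold_locales (use neg g off in \<open>simp_all add: none\<close>)
  then show ?thesis unfolding greedy_ok_def using base sok D by (intro conjI exI) auto
qed

lemma aug_ok_of_greedy_ok:
  assumes ok: "greedy_ok s" and D: "\<And>j. j < k \<Longrightarrow> 0 \<le> D s j"
  shows "aug_ok s"
proof -
  obtain sg' n \<alpha> e X t Op where sg': "\<forall>j<k. sg s j = real (sg' j)"
    and inv: "jms_inv m k c (\<lambda>i. 3/2 * f i) (D s) sg' (g s) n \<alpha> e X t Op"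
    using ok unfolding greedy_ok_def by blast
  have "aug_inv m k r f c (D s) sg' Op" by (rule aug_inv_init[OF inv D c f r])
  then show ?thesis using ok sg' unfolding greedy_ok_def aug_ok_def by blast
qed

end

subsection \<open>Output\<close>

text \<open>The serving sites are stored as reals and the language cannot convert them back to
  naturals. So each site number is converted instead and tested for equality by two
  comparisons.\<close>

definition write_entry :: com where
  "write_entry = IfC (BAnd (BNot (BRLess (rd 4 (V 6)) (ROfNat (V 4)))) (BNot (BRLess (ROfNat (V 4)) (rd 4 (V 6)))))
     (Seq (NAssign (NPlus (V 13) cur) (V 2)) (NAssign (NPlus (V 13) (V 4)) (V 2)))
     (NAssign (NPlus (V 13) cur) (NC 0))"

definition write_solution :: com where
  "write_solution = Seq (NAssign (NC 13) (NPlus (V 3) (NC 16)))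
     (site_loop (Seq (NAssign (NPlus (V 13) (V 4)) (NC 0)) (for_loop 6 1 write_entry)))"

text \<open>The targets start at cell 16, above the cells 3, 6 and 13 that control this
  loop.\<close>

definition copy_high :: com where
  "copy_high = for_loop 6 3 (NAssign (NPlus (NC 16) (V 6)) (NRd (NPlus (V 13) (NPlus (NC 16) (V 6)))))"

text \<open>This part is unrolled with constant addresses, since a loop would overwrite its own
  counter and bound.\<close>

fun copy_low :: "nat \<Rightarrow> com" where
  "copy_low 0 = SKIP"
| "copy_low (Suc n) = Seq (copy_low n) (NAssign (NC (Suc n)) (NRd (NPlus (V 0) (NC (Suc n)))))"

text \<open>The output area overlaps the working cells. The solution is therefore prepared at address
  \<open>L + 16\<close> and moved down at the end, cell 0, which then holds that address, being overwritten
  last.\<close>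

definition output_prog :: com where
  "output_prog = Seq write_solution (Seq copy_high (Seq (NAssign (NC 0) (V 13)) (Seq (copy_low 15)
     (NAssign (NC 0) (NRd (NPlus (V 0) (NC 0)))))))"

definition uftra_prog :: com where
  "uftra_prog = Seq size_loop (Seq init_stars (Seq init_clients (Seq greedy_phase (Seq aug_phase output_prog))))"

lemma runs_copy_low:
  assumes "fst s 0 = z" "n < z"
  shows "runs (copy_low n) s (7 * n + 1)
    (\<lambda>s'. \<forall>a. fst s' a = (if 1 \<le> a \<and> a \<le> n then fst s (z + a) else fst s a))"
  using assms(2)
proof (induction n)
  case 0
  show ?case by (simp, rule runs_straight) simp_all
next
  case (Suc n)
  have "runs (copy_low (Suc n)) s ((7 * n + 1) + 7)
    (\<lambda>s'. \<forall>a. fst s' a = (if 1 \<le> a \<and> a \<le> Suc n then fst s (z + a) else fst s a))"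
    unfolding copy_low.simps
  proof (rule runs_Seq[OF Suc.IH])
    fix s' :: state assume s': "\<forall>a. fst s' a = (if 1 \<le> a \<and> a \<le> n then fst s (z + a) else fst s a)"
    then have "fst s' 0 = z" "fst s' (z + Suc n) = fst s (z + Suc n)" using assms(1) Suc.prems by simp_all
    then show "runs (NAssign (NC (Suc n)) (NRd (NPlus (V 0) (NC (Suc n))))) s' 7
      (\<lambda>s'. \<forall>a. fst s' a = (if 1 \<le> a \<and> a \<le> Suc n then fst s (z + a) else fst s a))"
      using s' by (intro runs_straight) (auto simp: le_Suc_eq)
  qed (use Suc.prems in simp)
  then show ?case by (rule runs_mono) simp_all
qed

context uftra_run
begin

definition sol_x :: "(nat \<Rightarrow> nat) \<Rightarrow> nat \<Rightarrow> nat \<Rightarrow> nat" where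
  "sol_x sg' i j = (if sg' j = i then r else 0)"

text \<open>A site is opened only if it serves a client, so the output is determined by the
  assignment and the ghost set \<open>Op\<close> never has to be represented in memory.\<close>

definition sol_y :: "(nat \<Rightarrow> nat) \<Rightarrow> nat \<Rightarrow> nat \<Rightarrow> nat" where
  "sol_y sg' n i = (if \<exists>j<n. sg' j = i then r else 0)"

abbreviation "Z \<equiv> L + 16"

lemma runs_write_solution:
  assumes base: "base s" and sg': "\<And>j. j < k \<Longrightarrow> sg s j = real (sg' j)"
  shows "runs write_solution s (400 * w ^ 2) (\<lambda>s'. fst s' 3 = L \<and> fst s' 13 = Z \<and>
    (\<forall>i<m. fst s' (Z + i) = sol_y sg' k i \<and> (\<forall>j<k. fst s' (Z + (m + i * k + j)) = sol_x sg' i j)))"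
  unfolding write_solution_def
proof (rule runs_Seq_le)
  show "runs (NAssign (NC 13) (NPlus (V 3) (NC 16))) s 7 (\<lambda>s'. s' = ((fst s)(13 := Z), snd s))"
    using base by (intro runs_straight) (simp_all add: baseD)
  fix s1 assume s1: "s1 = ((fst s)(13 := Z), snd s)"
  let ?rows = "\<lambda>i s'. \<forall>i'<i. fst s' (Z + i') = sol_y sg' k i' \<and> (\<forall>j<k. fst s' (Z + (m + i' * k + j)) = sol_x sg' i' j)"
  let ?I = "\<lambda>i s'. fst s' 13 = Z \<and> snd s' = snd s \<and> ?rows i s'"
  show "runs (site_loop (Seq (NAssign (NPlus (V 13) (V 4)) (NC 0)) (for_loop 6 1 write_entry))) s1 (350 * w ^ 2)
     (\<lambda>s'. fst s' 3 = L \<and> fst s' 13 = Z \<and> ?rows m s')"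
  proof (rule runs_site_loop[where T = "200 * w" and I = ?I])
    show "base s1" using base by (simp add: s1)
    show "?I 0 s1" by (simp add: s1)
    show "?I i ((fst s')(4 := x, 5 := y), snd s')" if "?I i s'" for i s' x y using that by simp
    have "m * (200 * w + 20) + 15 \<le> 350 * w ^ Suc 1"
      using w_bounds by (intro loop_cost[where b = 220]) simp_all
    then show "m * (200 * w + 20) + 15 \<le> 350 * w ^ 2" by (simp only: Suc_1)
    show "fst s' 3 = L \<and> fst s' 13 = Z \<and> ?rows m s'" if "?I m s'" "base s'" for s'
      using that by (simp add: baseD)
    fix i s2 assume i: "i < m" and I: "?I i s2" and b2: "base s2" and v: "fst s2 4 = i" "fst s2 5 = m + i * k"
    show "runs (Seq (NAssign (NPlus (V 13) (V 4)) (NC 0)) (for_loop 6 1 write_entry)) s2 (200 * w)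
      (\<lambda>s''. base s'' \<and> fst s'' 4 = i \<and> fst s'' 5 = m + i * k \<and> ?I (Suc i) s'')"
    proof (rule runs_Seq_le)
      show "runs (NAssign (NPlus (V 13) (V 4)) (NC 0)) s2 7 (\<lambda>s'. s' = ((fst s2)(Z + i := 0), snd s2))"
        using I v by (intro runs_straight) simp_all
      fix s3 assume s3: "s3 = ((fst s2)(Z + i := 0), snd s2)"
      let ?J = "\<lambda>x s'. base s' \<and> fst s' 4 = i \<and> fst s' 5 = m + i * k \<and> ?I i s' \<and> fst s' (Z + i) = sol_y sg' x i \<and>
        (\<forall>j<x. fst s' (Z + (m + i * k + j)) = sol_x sg' i j)"
      show "runs (for_loop 6 1 write_entry) s3 (k * (120 + 13) + 10)
        (\<lambda>s''. base s'' \<and> fst s'' 4 = i \<and> fst s'' 5 = m + i * k \<and> ?I (Suc i) s'')"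
      proof (rule runs_for[where T = 120 and I = ?J])
        have "m + i' * k + j \<noteq> i" for i' j using i by simp
        moreover have "base (fst s2, snd s)" using b2 I by (metis prod.collapse)
        ultimately show "?J 0 ((fst s3)(6 := 0), snd s3)"
          using I v by (simp add: s3 sol_y_def)
        show "fst s3 1 = k" using b2 by (simp add: s3 baseD)
        show "base s' \<and> fst s' 4 = i \<and> fst s' 5 = m + i * k \<and> ?I (Suc i) s'" if "?J k s'" for s'
          using that by (auto simp: less_Suc_eq)
        fix x s' assume x: "x < k" and J: "?J x s'" and v6: "fst s' 6 = x"
        have b': "base s'" and v4: "fst s' 4 = i" "fst s' 5 = m + i * k" "fst s' 13 = Z" and R: "snd s' = snd s"
          and rows: "?rows i s'" and y: "fst s' (Z + i) = sol_y sg' x i"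
          and row: "\<forall>j<x. fst s' (Z + (m + i * k + j)) = sol_x sg' i j" using J by blast+
        have bR: "base (fst s', snd s)" using b' R by (metis prod.collapse)
        have sgx: "snd s' (adr L 4 x) = real (sg' x)" using R sg'[OF x] by simp
        have r2: "fst s' 2 = r" using b' x by (simp add: base_def)
        note ev = v4 v6 baseD[OF b'] sgx r2
        have eff: "effect write_entry s' = (if sg' x = i
            then ((fst s')(Z + (m + i * k + x) := r, Z + i := r), snd s')
            else ((fst s')(Z + (m + i * k + x) := 0), snd s'))"
          unfolding write_entry_def by (auto simp: ev not_less)
        have neq: "m + i' * k + j \<noteq> i" "i \<noteq> m + i' * k + j" for i' j using i by simp_all
        have "?J (Suc x) ((fst (effect write_entry s'))(6 := Suc x), snd (effect write_entry s'))"
        proof (cases "sg' x = i")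
          case True
          then have e: "effect write_entry s' = ((fst s')(Z + (m + i * k + x) := r, Z + i := r), snd s')" by (simp add: eff)
          have rows': "?rows i ((fst s')(Z + (m + i * k + x) := r, Z + i := r, 6 := Suc x), snd s')"
            using rows i x neq by simp
          have ysol: "sol_y sg' (Suc x) i = r" unfolding sol_y_def using True lessI by (intro if_P) blast
          have row': "((fst s')(Z + (m + i * k + x) := r, Z + i := r, 6 := Suc x)) (Z + (m + i * k + j)) = sol_x sg' i j"
            if "j < Suc x" for j
            using row neq that True by (cases "j = x") (simp_all add: sol_x_def)
          show ?thesis unfolding e
          proof (intro conjI)
            show "\<forall>j<Suc x. fst ((fst ((fst s')(Z + (m + i * k + x) := r, Z + i := r), snd s'))(6 := Suc x),
                snd ((fst s')(Z + (m + i * k + x) := r, Z + i := r), snd s')) (Z + (m + i * k + j)) = sol_x sg' i j"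
              using row' by simp
            show "?rows i ((fst ((fst s')(Z + (m + i * k + x) := r, Z + i := r), snd s'))(6 := Suc x),
                snd ((fst s')(Z + (m + i * k + x) := r, Z + i := r), snd s'))"
              using rows' by simp
          qed (use bR v4 R ysol in simp_all)
        next
          case False
          then have e: "effect write_entry s' = ((fst s')(Z + (m + i * k + x) := 0), snd s')" by (simp add: eff)
          have rows': "?rows i ((fst s')(Z + (m + i * k + x) := 0, 6 := Suc x), snd s')"
            using rows i x neq by simp
          have ysol: "sol_y sg' (Suc x) i = sol_y sg' x i" unfolding sol_y_def using False by (simp add: less_Suc_eq ex_disj_distrib conj_disj_distribR)
          have row': "((fst s')(Z + (m + i * k + x) := 0, 6 := Suc x)) (Z + (m + i * k + j)) = sol_x sg' i j"
            if "j < Suc x" for j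
            using row that False by (cases "j = x") (simp_all add: sol_x_def)
          show ?thesis unfolding e
          proof (intro conjI)
            show "\<forall>j<Suc x. fst ((fst ((fst s')(Z + (m + i * k + x) := 0), snd s'))(6 := Suc x),
                snd ((fst s')(Z + (m + i * k + x) := 0), snd s')) (Z + (m + i * k + j)) = sol_x sg' i j"
              using row' by simp
            show "?rows i ((fst ((fst s')(Z + (m + i * k + x) := 0), snd s'))(6 := Suc x),
                snd ((fst s')(Z + (m + i * k + x) := 0), snd s'))"
              using rows' by simp
          qed (use bR v4 R ysol y neq in simp_all)
        qed
        moreover have "fst (effect write_entry s') 6 = x" "fst (effect write_entry s') 1 = k"
          unfolding eff by (simp_all add: ev)
        ultimately have Q: "fst (effect write_entry s') 6 = x \<and> fst (effect write_entry s') 1 = k \<and>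
            ?J (Suc x) ((fst (effect write_entry s'))(6 := Suc x), snd (effect write_entry s'))" by blast
        show "runs write_entry s' 120 (\<lambda>s'. fst s' 6 = x \<and> fst s' 1 = k \<and> ?J (Suc x) ((fst s')(6 := Suc x), snd s'))"
        proof (rule runs_straight)
          show "straight write_entry" "len write_entry \<le> 120" by (simp_all add: write_entry_def)
        qed (rule Q)
      qed simp_all
    qed (use w_bounds in simp)
  qed
next
  show "7 + 350 * w ^ 2 \<le> 400 * w ^ 2" using w_powers(2) by linarith
qed

lemma runs_copy_high:
  assumes "fst s 3 = L" "fst s 13 = Z"
  shows "runs copy_high s (L * 30 + 10) (\<lambda>s'. fst s' 13 = Z \<and> (\<forall>a. Z \<le> a \<longrightarrow> fst s' a = fst s a) \<and>
    (\<forall>a<L. fst s' (16 + a) = fst s (Z + (16 + a))))"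
  unfolding copy_high_def
proof (rule runs_for[where T = 17 and I = "\<lambda>x s'. fst s' 13 = Z \<and> (\<forall>a. Z \<le> a \<longrightarrow> fst s' a = fst s a) \<and>
    (\<forall>a<x. fst s' (16 + a) = fst s (Z + (16 + a)))"])
  fix x and s' :: state assume x: "x < L" and I: "fst s' 13 = Z \<and> (\<forall>a. Z \<le> a \<longrightarrow> fst s' a = fst s a) \<and>
    (\<forall>a<x. fst s' (16 + a) = fst s (Z + (16 + a)))" and v: "fst s' 6 = x" "fst s' 3 = L"
  let ?p = "NAssign (NPlus (NC 16) (V 6)) (NRd (NPlus (V 13) (NPlus (NC 16) (V 6))))"
  let ?Q = "\<lambda>s'. fst s' 6 = x \<and> fst s' 3 = L \<and> fst ((fst s')(6 := Suc x), snd s') 13 = Z \<and>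
      (\<forall>a. Z \<le> a \<longrightarrow> fst ((fst s')(6 := Suc x), snd s') a = fst s a) \<and>
      (\<forall>a<Suc x. fst ((fst s')(6 := Suc x), snd s') (16 + a) = fst s (Z + (16 + a)))"
  have old: "fst s' (Z + (16 + x)) = fst s (Z + (16 + x))" "fst s' 13 = Z" using I by simp_all
  have eff: "effect ?p s' = ((fst s')(16 + x := fst s (Z + (16 + x))), snd s')"
    using old by (simp add: v)
  show "runs ?p s' 17 ?Q"
  proof (rule runs_straight)
    show "?Q (effect ?p s')" unfolding eff using I v x by (simp add: less_Suc_eq)
  qed simp_all
qed (use assms in simp_all)

lemma runs_output:
  assumes base: "base s" and sg': "\<And>j. j < k \<Longrightarrow> sg s j = real (sg' j)"
  shows "runs output_prog s (1000 * w ^ 2) (\<lambda>s'. \<forall>i<m. fst s' i = sol_y sg' k i \<and>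
    (\<forall>j<k. fst s' (m + i * k + j) = sol_x sg' i j))"
  unfolding output_prog_def
proof (rule runs_Seq_le)
  show "runs write_solution s (400 * w ^ 2) (\<lambda>s'. fst s' 3 = L \<and> fst s' 13 = Z \<and>
    (\<forall>i<m. fst s' (Z + i) = sol_y sg' k i \<and> (\<forall>j<k. fst s' (Z + (m + i * k + j)) = sol_x sg' i j)))"
    by (rule runs_write_solution[OF base sg'])
  fix s1 :: state assume s1: "fst s1 3 = L \<and> fst s1 13 = Z \<and>
    (\<forall>i<m. fst s1 (Z + i) = sol_y sg' k i \<and> (\<forall>j<k. fst s1 (Z + (m + i * k + j)) = sol_x sg' i j))"
  let ?Q = "\<lambda>s'. \<forall>i<m. fst s' i = sol_y sg' k i \<and> (\<forall>j<k. fst s' (m + i * k + j) = sol_x sg' i j)"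
  show "runs (Seq copy_high (Seq (NAssign (NC 0) (V 13)) (Seq (copy_low 15) (NAssign (NC 0) (NRd (NPlus (V 0) (NC 0))))))) s1
    (L * 30 + 10 + (4 + (7 * 15 + 1 + 7))) ?Q"
  proof (rule runs_Seq[OF runs_copy_high])
    fix s2 :: state assume 2: "fst s2 13 = Z \<and> (\<forall>a. Z \<le> a \<longrightarrow> fst s2 a = fst s1 a) \<and>
      (\<forall>a<L. fst s2 (16 + a) = fst s1 (Z + (16 + a)))"
    show "runs (Seq (NAssign (NC 0) (V 13)) (Seq (copy_low 15) (NAssign (NC 0) (NRd (NPlus (V 0) (NC 0)))))) s2
      (4 + (7 * 15 + 1 + 7)) ?Q"
    proof (rule runs_Seq)
      show "runs (NAssign (NC 0) (V 13)) s2 4 (\<lambda>s'. s' = ((fst s2)(0 := Z), snd s2))"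
        using 2 by (intro runs_straight) simp_all
      fix s3 assume s3: "s3 = ((fst s2)(0 := Z), snd s2)"
      show "runs (Seq (copy_low 15) (NAssign (NC 0) (NRd (NPlus (V 0) (NC 0))))) s3 (7 * 15 + 1 + 7) ?Q"
      proof (rule runs_Seq[OF runs_copy_low[where z = Z]])
        fix s4 :: state assume 4: "\<forall>a. fst s4 a = (if 1 \<le> a \<and> a \<le> 15 then fst s3 (Z + a) else fst s3 a)"
        define s5 where "s5 = ((fst s4)(0 := fst s4 Z), snd s4)"
        have eff: "effect (NAssign (NC 0) (NRd (NPlus (V 0) (NC 0)))) s4 = s5"
          using 4 by (simp add: s5_def s3)
        have high: "fst s2 a = fst s1 a" if "Z \<le> a" for a using 2 that by blast
        have val: "fst s5 a = fst s1 (Z + a)" if a: "a < L" for a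
        proof -
          consider "a = 0" | "1 \<le> a" "a \<le> 15" | "16 \<le> a" by linarith
          then show ?thesis
          proof cases
            case 1 then show ?thesis using 4 high by (simp add: s5_def s3)
          next
            case 2 then show ?thesis using 4 high by (simp add: s5_def s3)
          next
            case 3
            then have "fst s2 (16 + (a - 16)) = fst s1 (Z + (16 + (a - 16)))" using 2 a by (meson less_imp_diff_less)
            then have "fst s2 a = fst s1 (Z + a)" using 3 by simp
            then show ?thesis using 3 4 by (simp add: s5_def s3)
          qed
        qed
        have "?Q s5" using s1 val site_less cell_less_L by simp
        then show "runs (NAssign (NC 0) (NRd (NPlus (V 0) (NC 0)))) s4 7 ?Q"
          unfolding eff[symmetric] by (intro runs_straight) simp_all
      qed (simp_all add: s3)
    qed
  qed (use s1 in simp_all)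
next
  have "m * k \<le> w * w" using w_bounds by (intro mult_le_mono)
  moreover have "m \<le> w ^ 2" using w_bounds(1) w_powers(1) by (rule order_trans)
  ultimately have "L \<le> w ^ 2 + w ^ 2" unfolding L by (simp add: power2_eq_square)
  then show "400 * w ^ 2 + (L * 30 + 10 + (4 + (7 * 15 + 1 + 7))) \<le> 1000 * w ^ 2" using w_powers(2) by linarith
qed

section \<open>Assembly of the phases\<close>

lemma base_after_size:
  assumes rq: "\<forall>j<k. rq j = r"
    and s: "snd s = snd (input_state m k f c rq)" "fst s 3 = L"
      "\<forall>a. a \<notin> {3, 4} \<longrightarrow> fst s a = fst (input_state m k f c rq) a"
  shows "base s"
proof -
  have "(m + i * k + j - m) div k = i" "(m + i * k + j - m) mod k = j" if "j < k" for i j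
    using that by simp_all
  then show ?thesis
    unfolding base_def using s rq cell_less by (auto simp: input_state_def adr_def L)
qed

theorem uftra_prog_correct:
  assumes rq: "\<forall>j<k. rq j = r"
  shows "runs uftra_prog (input_state m k f c rq) (6000 * w ^ 3)
    (\<lambda>s'. uftra_feasible {..<m} {..<k} rq (out_y s') (out_x m k s') \<and>
      (\<forall>y' x'. uftra_feasible {..<m} {..<k} rq y' x' \<longrightarrow>
         uftra_cost {..<m} {..<k} f c (out_y s') (out_x m k s') \<le> 1.5186 * uftra_cost {..<m} {..<k} f c y' x'))"
    (is "runs _ _ _ ?Q")
proof -
  let ?s = "input_state m k f c rq"
  have final: "?Q s'" if inv: "aug_inv m k r f c d sg' Op" and no: "\<And>i. i < m \<Longrightarrow> saving k c d i \<le> f i"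
    and out: "\<forall>i<m. fst s' i = sol_y sg' k i \<and> (\<forall>j<k. fst s' (m + i * k + j) = sol_x sg' i j)" for s' d sg' Op
  proof -
    have Op: "Op \<subseteq> {..<m}" and sgD: "\<And>j. j < k \<Longrightarrow> sg' j \<in> Op \<and> d j = c (sg' j) j"
      using inv by (auto simp: aug_inv_def)
    have y: "out_y s' i = sol_y sg' k i" if "i < m" for i using out that by (simp add: out_y_def)
    have x: "out_x m k s' i j = sol_x sg' i j" if "i < m" "j < k" for i j using out that by (simp add: out_x_def)
    have feas: "uftra_feasible {..<m} {..<k} rq (out_y s') (out_x m k s')"
      unfolding uftra_feasible_def
    proof (intro conjI ballI)
      fix j assume "j \<in> {..<k}"
      then have j: "j < k" by simp
      have "sg' j < m" using sgD[OF j] Op by auto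
      then have "(\<Sum>i<m. out_x m k s' i j) = r"
        using j by (simp add: x sol_x_def)
      then show "rq j \<le> (\<Sum>i<m. out_x m k s' i j)" using rq j by simp
    next
      fix i j assume "i \<in> {..<m}" "j \<in> {..<k}"
      then show "out_x m k s' i j \<le> out_y s' i" by (auto simp: x y sol_x_def sol_y_def)
    qed
    have "uftra_cost {..<m} {..<k} f c (out_y s') (out_x m k s') \<le> real r * (sum f Op + (\<Sum>j<k. d j))"
    proof -
      \<comment> \<open>An inequality, because members of \<open>Op\<close> whose clients have all
        switched elsewhere are not opened.\<close>
      have "(\<Sum>i<m. f i * real (out_y s' i)) \<le> (\<Sum>i<m. if i \<in> Op then f i * real r else 0)"
        using f sgD by (intro sum_mono) (auto simp: y sol_y_def)
      also have "\<dots> = (\<Sum>i\<in>Op. f i * real r)"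
        using Op by (simp add: sum.inter_restrict[symmetric] Int_absorb1)
      finally have 1: "(\<Sum>i<m. f i * real (out_y s' i)) \<le> real r * sum f Op"
        by (simp add: sum_distrib_left mult.commute)
      have "(\<Sum>i<m. \<Sum>j<k. c i j * real (out_x m k s' i j)) = (\<Sum>j<k. \<Sum>i<m. if sg' j = i then c i j * real r else 0)"
        by (subst sum.swap) (auto simp: x sol_x_def intro!: sum.cong)
      also have "\<dots> = (\<Sum>j<k. real r * d j)"
        using sgD Op by (intro sum.cong) (auto simp: mult.commute)
      finally have "(\<Sum>i<m. \<Sum>j<k. c i j * real (out_x m k s' i j)) = real r * (\<Sum>j<k. d j)"
        by (simp add: sum_distrib_left)
      then show ?thesis using 1 unfolding uftra_cost_def by (simp add: distrib_left)
    qed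
    also have "\<dots> \<le> 1.5184 * uftra_cost {..<m} {..<k} f c y' x'" if "uftra_feasible {..<m} {..<k} rq y' x'" for y' x'
    proof -
      have "uftra_feasible {..<m} {..<k} (\<lambda>_. r) y' x'" using that rq by (simp add: uftra_feasible_def)
      then show ?thesis using aug_inv_final[OF inv c f r no] by blast
    qed
    finally have bound: "uftra_cost {..<m} {..<k} f c (out_y s') (out_x m k s') \<le> 1.5184 * uftra_cost {..<m} {..<k} f c y' x'"
      if "uftra_feasible {..<m} {..<k} rq y' x'" for y' x' using that .
    have nonneg: "0 \<le> uftra_cost {..<m} {..<k} f c y' x'" for y' x'
      unfolding uftra_cost_def using f c by (intro add_nonneg_nonneg sum_nonneg mult_nonneg_nonneg) auto
    have "uftra_cost {..<m} {..<k} f c (out_y s') (out_x m k s') \<le> 1.5186 * uftra_cost {..<m} {..<k} f c y' x'"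
      if "uftra_feasible {..<m} {..<k} rq y' x'" for y' x'
    proof (rule order_trans[OF bound[OF that]])
      show "1.5184 * uftra_cost {..<m} {..<k} f c y' x' \<le> 1.5186 * uftra_cost {..<m} {..<k} f c y' x'"
        by (rule mult_right_mono[OF _ nonneg]) simp
    qed
    then show ?thesis using feas by blast
  qed
  show ?thesis
    unfolding uftra_prog_def
  proof (rule runs_Seq_le[where T = "40 * w" and T' = "500 * w ^ 3 + (100 * w + (1800 * w ^ 3 + (1300 * w ^ 3 + 1000 * w ^ 2)))"])
    show "runs size_loop ?s (40 * w) (\<lambda>s'. snd s' = snd ?s \<and> fst s' 3 = L \<and> (\<forall>a. a \<notin> {3, 4} \<longrightarrow> fst s' a = fst ?s a))"
      by (rule runs_size_loop) (simp_all add: input_state_def)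
    fix s1 assume "snd s1 = snd ?s \<and> fst s1 3 = L \<and> (\<forall>a. a \<notin> {3, 4} \<longrightarrow> fst s1 a = fst ?s a)"
    then have b1: "base s1" using base_after_size[OF rq] by blast
    show "runs (Seq init_stars (Seq init_clients (Seq greedy_phase (Seq aug_phase output_prog)))) s1
      (500 * w ^ 3 + (100 * w + (1800 * w ^ 3 + (1300 * w ^ 3 + 1000 * w ^ 2)))) ?Q"
    proof (rule runs_Seq[OF runs_init_stars[OF b1]])
      fix s2 assume 2: "frame {4,5,6,7} {1,2} s1 s2 \<and> (\<forall>i<m. g s2 i = 3/2 * f i) \<and>
        (\<forall>i<m. \<forall>j<k. starsum s2 i j = sum (c i) {l. l < k \<and> c i l \<le> c i j} \<and>
          starcard s2 i j = real (card {l. l < k \<and> c i l \<le> c i j}))"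
      then have fr2: "frame {4,5,6,7} {1,2} s1 s2" by blast
      have b2: "base s2" by (rule base_frame[OF b1 fr2]) auto
      show "runs (Seq init_clients (Seq greedy_phase (Seq aug_phase output_prog))) s2
        (100 * w + (1800 * w ^ 3 + (1300 * w ^ 3 + 1000 * w ^ 2))) ?Q"
      proof (rule runs_Seq[OF runs_init_clients[OF b2]])
        fix s3 assume 3: "frame {6} {3,4} s2 s3 \<and> (\<forall>j<k. D s3 j = -1 \<and> sg s3 j = 0)"
        then have fr3: "frame {6} {3,4} s2 s3" by blast
        have b3: "base s3" by (rule base_frame[OF b2 fr3]) auto
        have ok3: "greedy_ok s3"
        proof (rule greedy_ok_init[OF b3])
          show "g s3 i = 3/2 * f i" if "i < m" for i
            using frame_snd[OF fr3 _ site_less[OF that], of 1] 2 that by simp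
          show "starsum s3 i j = sum (c i) {l. l < k \<and> c i l \<le> c i j} \<and>
            starcard s3 i j = real (card {l. l < k \<and> c i l \<le> c i j})" if "i < m" "j < k" for i j
            using frame_snd[OF fr3 _ cell_less_L[OF that], of 1] frame_snd[OF fr3 _ cell_less_L[OF that], of 2] 2 that by simp
          show "D s3 j = -1 \<and> sg s3 j = 0" if "j < k" for j using 3 that by blast
        qed
        show "runs (Seq greedy_phase (Seq aug_phase output_prog)) s3 (1800 * w ^ 3 + (1300 * w ^ 3 + 1000 * w ^ 2)) ?Q"
        proof (rule runs_Seq[OF runs_greedy_phase[OF ok3]])
          fix s4 assume "greedy_ok s4 \<and> (\<forall>j<k. 0 \<le> D s4 j)"
          then have ok4: "aug_ok s4" using aug_ok_of_greedy_ok by blast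
          show "runs (Seq aug_phase output_prog) s4 (1300 * w ^ 3 + 1000 * w ^ 2) ?Q"
          proof (rule runs_Seq[OF runs_aug_phase[OF ok4]])
            fix s5 assume 5: "aug_ok s5 \<and> gainful s5 = {}"
            then obtain sg' Op where b5: "base s5" and sg': "\<And>j. j < k \<Longrightarrow> sg s5 j = real (sg' j)"
              and inv: "aug_inv m k r f c (D s5) sg' Op" unfolding aug_ok_def by blast
            have no: "saving k c (D s5) i \<le> f i" if "i < m" for i
              using 5 that unfolding gainful_def by (simp add: not_less[symmetric])
            have "runs output_prog s5 (1000 * w ^ 2) (\<lambda>s'. \<forall>i<m. fst s' i = sol_y sg' k i \<and>
                (\<forall>j<k. fst s' (m + i * k + j) = sol_x sg' i j))"
              by (rule runs_output[OF b5]) (rule sg')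
            then show "runs output_prog s5 (1000 * w ^ 2) ?Q"
              by (rule runs_mono[OF _ order_refl]) (rule final[OF inv no])
          qed
        qed
      qed
    qed
  next
    show "40 * w + (500 * w ^ 3 + (100 * w + (1800 * w ^ 3 + (1300 * w ^ 3 + 1000 * w ^ 2)))) \<le> 6000 * w ^ 3"
      using w_powers by linarith
  qed
qed

end

theorem mainTheorem1:
  shows "\<exists>(P::com) (K::nat). \<forall>(m::nat) (k::nat) (f::nat \<Rightarrow> real) (c::nat \<Rightarrow> nat \<Rightarrow> real)
            (rq::nat \<Rightarrow> nat) (r::nat).
     0 < m \<longrightarrow> 0 < r \<longrightarrow> (\<forall>j<k. rq j = r) \<longrightarrow>
     (\<forall>i<m. 0 \<le> f i) \<longrightarrow> (\<forall>i<m. \<forall>j<k. 0 \<le> c i j) \<longrightarrow>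
     uftra_metric {..<m} {..<k} c \<longrightarrow>
     (\<exists>t s'. exec P (input_state m k f c rq) t s' \<and>
        t \<le> K * ((m + k) ^ 3 * r + 1) \<and>
        uftra_feasible {..<m} {..<k} rq (out_y s') (out_x m k s') \<and>
        (\<forall>y' x'. uftra_feasible {..<m} {..<k} rq y' x' \<longrightarrow>
           uftra_cost {..<m} {..<k} f c (out_y s') (out_x m k s')
             \<le> 1.5186 * uftra_cost {..<m} {..<k} f c y' x'))"
proof (rule exI[of _ uftra_prog], rule exI[of _ 6000], intro allI impI)
  fix m k :: nat and f :: "nat \<Rightarrow> real" and c :: "nat \<Rightarrow> nat \<Rightarrow> real" and rq :: "nat \<Rightarrow> nat" and r :: nat
  assume m: "0 < m" and r: "0 < r" and rq: "\<forall>j<k. rq j = r" and f: "\<forall>i<m. 0 \<le> f i"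
    and c: "\<forall>i<m. \<forall>j<k. 0 \<le> c i j" and metric: "uftra_metric {..<m} {..<k} c"
  interpret uftra_run m k r "m + m * k" "m + k" f c
    by unfold_locales (use m r f c metric in auto)
  obtain t s' where t: "exec uftra_prog (input_state m k f c rq) t s'" "t + 0 \<le> 6000 * (m + k) ^ 3 + 0"
    and Q: "uftra_feasible {..<m} {..<k} rq (out_y s') (out_x m k s') \<and>
      (\<forall>y' x'. uftra_feasible {..<m} {..<k} rq y' x' \<longrightarrow>
         uftra_cost {..<m} {..<k} f c (out_y s') (out_x m k s') \<le> 1.5186 * uftra_cost {..<m} {..<k} f c y' x')"
    using uftra_prog_correct[OF rq] unfolding pruns_def by blast
  \<comment> \<open>The program runs in time independent of \<open>r\<close>, as it only copies
    \<open>r\<close> into the output; the factor \<open>r\<close> enters by weakening.\<close>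
  have "(m + k) ^ 3 * 1 \<le> (m + k) ^ 3 * r" using r by (intro mult_le_mono2) simp
  then have "6000 * (m + k) ^ 3 \<le> 6000 * ((m + k) ^ 3 * r + 1)" by (intro mult_le_mono2) linarith
  then have "t \<le> 6000 * ((m + k) ^ 3 * r + 1)" using t(2) by linarith
  then show "\<exists>t s'. exec uftra_prog (input_state m k f c rq) t s' \<and>
      t \<le> 6000 * ((m + k) ^ 3 * r + 1) \<and>
      uftra_feasible {..<m} {..<k} rq (out_y s') (out_x m k s') \<and>
      (\<forall>y' x'. uftra_feasible {..<m} {..<k} rq y' x' \<longrightarrow>
         uftra_cost {..<m} {..<k} f c (out_y s') (out_x m k s')
           \<le> 1.5186 * uftra_cost {..<m} {..<k} f c y' x')"
    using t(1) Q by blast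
qed

end
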